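(* Consider a network with routes of length one, $(I,J,(J(i))_{i\in I},(C_j)_{j\in J})$, with traffic intensities $\rho_i=\lambda_i/\mu_i$ satisfying the stability condition $$\sum_{i\in I(J')}\rho_i<C(J')\qquad\text{for all }J'\in\mathscr{SC}(J),$$ and $$\sum_{i\in I'}\rho_i\neq C(J')\qquad\text{for all } J'\in\mathscr{C}(J)\text{ and all } I' \text{ with } I(J')\subset I'\subseteq J^{-1}(J').$$ Let $I=\{1,\dots,|I|\}$ be labelled so that the peak rates are ordered, $r_1\le r_2\le\dots\le r_{|I|}$, and put $r_{|I|+1}=\infty$. Then there is always a unique equilibrium point $\hat n$ of the fluid limit for peak-rate constrained elastic traffic. It is determined by the following algorithm. For $k\ge1$: (1) Find the minimum $$\hat x_{(k)}=\min_{i^*=1,\dots,|I|,\ J'\in\mathscr{SC}(J)}\ \frac{C(J')-\sum_{i\in I(J'):\,i>i^*}\rho_i}{\sum_{i\in I(J'):\,i\le i^*}\rho_i/r_i}.$$ (2) Let $J_k$ be the union of all strongly connected sets that achieve this minimum, and $I_k:=I(J_k)$. (3) Let $i_k^*$ be the unique value of $i^*$ such that $\hat x_{(k)}\in(r_{i_k^*},r_{i_k^*+1}]$. (4) For all $i\in I_k$ set $\hat x_i=\hat x_{(k)}$. (5) For $i\in I_k$ with $i\le i_k^*$ set $\hat n_i=\rho_i/r_i$; for $i\in I_k$ with $i>i_k^*$ set $\hat n_i=\rho_i/\hat x_{(k)}$. (6) Replace the network by the reduced one: $I:=I\setminus I_k$, $J:=J\setminus J_k$, $J(i):=J(i)\setminus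 J_k$ (so that the new $I(J')$ equals the old $I(J'\cup J_k)\setminus I(J_k)$), and repeat until no resources and no users are left. (The labels $i$ and the range $\{1,\dots,|I|\}$ of $i^*$ remain those of the original network.) Moreover, the pair $(I_k,J_k)$ obtained at the $k$-th step is the $k$-th cluster level at the equilibrium point $\hat n$, and exactly the flows in $I^*=\bigcup_k\{i\in I_k:i\le i_k^*\}$ are peak-rate constrained.
   Context: Network: $I$ is a finite set of users (flow types), $J$ a finite set of resources, resource $j$ has capacity $C_j>0$, and user $i$ can use exactly the resources in the nonempty set $J(i)\subseteq J$ (each route is a single resource). Type $i$ flows have arrival rate $\lambda_i>0$, mean size $1/\mu_i$ with $\mu_i>0$, and peak rate $r_i>0$. Optimal allocation: let $U$ be a strictly concave, strictly increasing, differentiable utility function common to all users. For $n=(n_i)_{i\in I}$, $x(n)=(x_i(n))_{i\in I}$ is the solution of: maximize $\sum_{i\in I} n_iU(x_i)$ subject to $\sum_{i: j\in J(i)} n_ix_i^j\le C_j$ for all $j\in J$; $\sum_{j\in J(i)}x_i^j=x_i$ for all $i$; $x_i^j\ge 0$ for $j\in J(i)$. It does not depend on $U$. Fluid limit and equilibrium: the fluid limit for peak-rate constrained elastic traffic is $n_i'(t)=\lambda_i-\mu_in_i(t)\min\{x_i(n(t)),r_i\}$; an equilibrium point is a vector $\hat n$ of positive reals with $\hat n_i\min\{x_i(\hat n),r_i\}=\rho_i$ for all $i\in I$. Type $i$ is peak-rate constrained at $\hat n$ if $r_i<x_i(\hat n)$. Notation: for $J'\subseteq J$: $C(J')=\sum_{j\in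 J'}C_j$, $I(J')=\{i\in I:J(i)\subseteq J'\}$, $J^{-1}(J')=\{i\in I:J(i)\cap J'\ne\emptyset\}$. A fraction with positive numerator and empty (zero) denominator is $+\infty$. Connectivity: a pair $(I',J')$ is connected if $J'$ cannot be partitioned into nonempty $J_1,J_2$ such that $I'$ can be partitioned into (possibly empty) $I_1,I_2$ with $J(i)\cap J_2=\emptyset$ for $i\in I_1$ and $J(i)\cap J_1=\emptyset$ for $i\in I_2$. A nonempty $J'\subseteq J$ is connected if $(I,J')$ is connected and strongly connected if $(I(J'),J')$ is connected; $\mathscr{C}(J)$ and $\mathscr{SC}(J)$ are the sets of connected, respectively strongly connected, subsets of $J$. At each step of the algorithm these notions refer to the current (reduced) network. Clusters at $n$: a cluster is a nonempty pair $(I',J')$ such that for $i\in I'$: $I'$ consists of all $i'\in I$ reachable by a path $i=i_0,\dots,i_m=i'$ in $I'$, $j_1,\dots,j_m\in J'$ such that, for a feasible allocation solving the optimization problem, all $x_{i_{k-1}}^{j_k}$ and $x_{i_k}^{j_k}$ are strictly positive; $J'$ consists of all $j\in J$ reachable in the same way by such a path ending at $j_m=j$. All users of a cluster have the same rate; clusters with the same rate form a cluster level (identified with the pair consisting of the union of their user sets and the union of their resource sets), and levels are numbered in increasing order of rate.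
   Formalization: If some resources can be used by no user, the last step has no users and rate infinity, so "k-th cluster level" has no meaning there; for that step the formal statement says instead that J_k is exactly the set of unused resources. The set of users is taken to be nonempty. *)

theory Defs
  imports "HOL-Analysis.Analysis" "HOL-Library.FuncSet" "HOL-Library.Extended_Real"
begin

section \<open>Networks with routes of length one\<close>

text \<open>Users are natural numbers because the algorithm refers to users through their labels.\<close>

record 'j network =
  users :: "nat set"
  resources :: "'j set"
  route :: "nat \<Rightarrow> 'j set"
  cap :: "'j \<Rightarrow> real"

definition is_network :: "'j network \<Rightarrow> bool" where
  "is_network N \<longleftrightarrow> finite (users N) \<and> finite (resources N) \<and>
     (\<forall>j\<in>resources N. cap N j > 0) \<and>
     (\<forall>i\<in>users N. route N i \<noteq> {} \<and> route N i \<subseteq> resources N)"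

text \<open>\<open>capacity N J'\<close>, \<open>users_within N J'\<close> and \<open>users_meeting N J'\<close> are
  $C(J')$, $I(J')$ and $J^{-1}(J')$.\<close>

definition capacity :: "'j network \<Rightarrow> 'j set \<Rightarrow> real" where
  "capacity N J' = (\<Sum>j\<in>J'. cap N j)"

definition users_within :: "'j network \<Rightarrow> 'j set \<Rightarrow> nat set" where
  "users_within N J' = {i\<in>users N. route N i \<subseteq> J'}"

definition users_meeting :: "'j network \<Rightarrow> 'j set \<Rightarrow> nat set" where
  "users_meeting N J' = {i\<in>users N. route N i \<inter> J' \<noteq> {}}"

definition connected_pair :: "'j network \<Rightarrow> nat set \<Rightarrow> 'j set \<Rightarrow> bool" where
  "connected_pair N I' J' \<longleftrightarrow>
     \<not> (\<exists>J1 J2. J1 \<noteq> {} \<and> J2 \<noteq> {} \<and> J1 \<union> J2 = J' \<and> J1 \<inter> J2 = {} \<and>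
          (\<exists>I1 I2. I1 \<union> I2 = I' \<and> I1 \<inter> I2 = {} \<and>
             (\<forall>i\<in>I1. route N i \<inter> J2 = {}) \<and> (\<forall>i\<in>I2. route N i \<inter> J1 = {})))"

definition connected_sets :: "'j network \<Rightarrow> 'j set set" where
  "connected_sets N = {J'. J' \<noteq> {} \<and> J' \<subseteq> resources N \<and> connected_pair N (users N) J'}"

definition strongly_connected_sets :: "'j network \<Rightarrow> 'j set set" where
  "strongly_connected_sets N =
     {J'. J' \<noteq> {} \<and> J' \<subseteq> resources N \<and> connected_pair N (users_within N J') J'}"

section \<open>Optimal allocations and equilibrium points\<close>

text \<open>The value at \<open>0\<close> may be \<open>-\<infinity>\<close>, so that \<open>ln\<close> is admitted besides utilities
  that are finite on the closed half line. Strict concavity on the positive half line and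
  strict monotonicity on the closed one imply strict concavity on the closed half line.\<close>

definition is_utility :: "(real \<Rightarrow> ereal) \<Rightarrow> bool" where
  "is_utility U \<longleftrightarrow> strict_mono_on {0..} U \<and>
     (\<exists>u :: real \<Rightarrow> real. (\<forall>x>0. U x = ereal (u x)) \<and> u differentiable_on {0<..} \<and>
        (\<forall>x>0. \<forall>y>0. \<forall>t. x \<noteq> y \<and> 0 < t \<and> t < 1 \<longrightarrow>
           (1 - t) * u x + t * u y < u ((1 - t) * x + t * y)))"

text \<open>An allocation \<open>X\<close> gives rate \<open>X i j\<close> on resource \<open>j\<close> to each flow of type \<open>i\<close>;
  only the values with \<open>j \<in> route N i\<close> matter.\<close>

definition total_rate :: "'j network \<Rightarrow> (nat \<Rightarrow> 'j \<Rightarrow> real) \<Rightarrow> nat \<Rightarrow> real" where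
  "total_rate N X i = (\<Sum>j\<in>route N i. X i j)"

definition feasible :: "'j network \<Rightarrow> (nat \<Rightarrow> real) \<Rightarrow> (nat \<Rightarrow> 'j \<Rightarrow> real) \<Rightarrow> bool" where
  "feasible N n X \<longleftrightarrow>
     (\<forall>j\<in>resources N. (\<Sum>i\<in>{i\<in>users N. j \<in> route N i}. n i * X i j) \<le> cap N j) \<and>
     (\<forall>i\<in>users N. \<forall>j\<in>route N i. 0 \<le> X i j)"

definition objective ::
    "'j network \<Rightarrow> (real \<Rightarrow> ereal) \<Rightarrow> (nat \<Rightarrow> real) \<Rightarrow> (nat \<Rightarrow> 'j \<Rightarrow> real) \<Rightarrow> ereal" where
  "objective N U n X = (\<Sum>i\<in>users N. ereal (n i) * U (total_rate N X i))"

definition optimal ::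
    "'j network \<Rightarrow> (real \<Rightarrow> ereal) \<Rightarrow> (nat \<Rightarrow> real) \<Rightarrow> (nat \<Rightarrow> 'j \<Rightarrow> real) \<Rightarrow> bool" where
  "optimal N U n X \<longleftrightarrow>
     feasible N n X \<and> (\<forall>Y. feasible N n Y \<longrightarrow> objective N U n Y \<le> objective N U n X)"

text \<open>The rate vector $x(n)$. For positive \<open>n\<close> the optimal rates are unique although the
  optimal allocation need not be.\<close>

definition opt_rate :: "'j network \<Rightarrow> (real \<Rightarrow> ereal) \<Rightarrow> (nat \<Rightarrow> real) \<Rightarrow> nat \<Rightarrow> real" where
  "opt_rate N U n =
     (THE x. x \<in> extensional (users N) \<and>
        (\<exists>X. optimal N U n X \<and> (\<forall>i\<in>users N. x i = total_rate N X i)))"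

text \<open>Vectors indexed by the users are extensional functions, which makes uniqueness of an
  equilibrium point plain equality.\<close>

definition equilibrium ::
    "'j network \<Rightarrow> (real \<Rightarrow> ereal) \<Rightarrow> (nat \<Rightarrow> real) \<Rightarrow> (nat \<Rightarrow> real) \<Rightarrow> (nat \<Rightarrow> real) \<Rightarrow> bool" where
  "equilibrium N U \<rho> r n \<longleftrightarrow> n \<in> users N \<rightarrow>\<^sub>E {0<..} \<and>
     (\<forall>i\<in>users N. n i * min (opt_rate N U n i) (r i) = \<rho> i)"

definition peak_constrained ::
    "'j network \<Rightarrow> (real \<Rightarrow> ereal) \<Rightarrow> (nat \<Rightarrow> real) \<Rightarrow> (nat \<Rightarrow> real) \<Rightarrow> nat \<Rightarrow> bool" where
  "peak_constrained N U r n i \<longleftrightarrow> r i < opt_rate N U n i"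

section \<open>Clusters and cluster levels\<close>

text \<open>One step of a path between users with respect to the allocation \<open>X\<close>.\<close>

definition shares :: "'j network \<Rightarrow> (nat \<Rightarrow> 'j \<Rightarrow> real) \<Rightarrow> (nat \<times> nat) set" where
  "shares N X = {(i, i'). i \<in> users N \<and> i' \<in> users N \<and>
     (\<exists>j\<in>route N i \<inter> route N i'. 0 < X i j \<and> 0 < X i' j)}"

definition reachable_users ::
    "'j network \<Rightarrow> (real \<Rightarrow> ereal) \<Rightarrow> (nat \<Rightarrow> real) \<Rightarrow> nat \<Rightarrow> nat set" where
  "reachable_users N U n i =
     {i'\<in>users N. \<exists>X. optimal N U n X \<and> (i, i') \<in> (shares N X)\<^sup>*}"

text \<open>A path ending at \<open>j\<close> may stay at its last user in the final step, so it suffices that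
  some reachable user has positive rate on \<open>j\<close>.\<close>

definition reachable_resources ::
    "'j network \<Rightarrow> (real \<Rightarrow> ereal) \<Rightarrow> (nat \<Rightarrow> real) \<Rightarrow> nat \<Rightarrow> 'j set" where
  "reachable_resources N U n i =
     {j\<in>resources N. \<exists>X. optimal N U n X \<and>
        (\<exists>i'\<in>users N. (i, i') \<in> (shares N X)\<^sup>* \<and> j \<in> route N i' \<and> 0 < X i' j)}"

text \<open>Paths are not confined to \<open>I'\<close> and \<open>J'\<close> in advance (every single user would otherwise
  be a cluster together with any one resource it uses); a path starting in \<open>I'\<close> stays in
  \<open>I'\<close> and \<open>J'\<close> since these contain everything reachable. A cluster has at least one user
  and one resource.\<close>

definition cluster ::
    "'j network \<Rightarrow> (real \<Rightarrow> ereal) \<Rightarrow> (nat \<Rightarrow> real) \<Rightarrow> nat set \<Rightarrow> 'j set \<Rightarrow> bool" where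
  "cluster N U n I' J' \<longleftrightarrow> I' \<noteq> {} \<and> J' \<noteq> {} \<and> I' \<subseteq> users N \<and> J' \<subseteq> resources N \<and>
     (\<forall>i\<in>I'. I' = reachable_users N U n i \<and> J' = reachable_resources N U n i)"

definition clusters_with_rate ::
    "'j network \<Rightarrow> (real \<Rightarrow> ereal) \<Rightarrow> (nat \<Rightarrow> real) \<Rightarrow> real \<Rightarrow> (nat set \<times> 'j set) set" where
  "clusters_with_rate N U n y =
     {(I', J'). cluster N U n I' J' \<and> (\<forall>i\<in>I'. opt_rate N U n i = y)}"

definition cluster_rates :: "'j network \<Rightarrow> (real \<Rightarrow> ereal) \<Rightarrow> (nat \<Rightarrow> real) \<Rightarrow> real set" where
  "cluster_rates N U n = {y. clusters_with_rate N U n y \<noteq> {}}"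

text \<open>\<open>(A, B)\<close> is the \<open>k\<close>-th cluster level, counted from \<open>1\<close>.\<close>

definition is_cluster_level ::
    "'j network \<Rightarrow> (real \<Rightarrow> ereal) \<Rightarrow> (nat \<Rightarrow> real) \<Rightarrow> nat \<Rightarrow> nat set \<Rightarrow> 'j set \<Rightarrow> bool" where
  "is_cluster_level N U n k A B \<longleftrightarrow>
     (\<exists>y\<in>cluster_rates N U n.
        k = card {y'\<in>cluster_rates N U n. y' < y} + 1 \<and>
        A = (\<Union>(I', J')\<in>clusters_with_rate N U n y. I') \<and>
        B = (\<Union>(I', J')\<in>clusters_with_rate N U n y. J'))"

section \<open>The algorithm\<close>

text \<open>\<open>M\<close> is the current network and \<open>m\<close> the number of users of the original network.
  Division on \<^typ>\<open>ereal\<close> yields \<open>\<infinity>\<close> for a positive numerator and zero denominator.\<close>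

definition level_ratio ::
    "(nat \<Rightarrow> real) \<Rightarrow> (nat \<Rightarrow> real) \<Rightarrow> 'j network \<Rightarrow> nat \<Rightarrow> 'j set \<Rightarrow> ereal" where
  "level_ratio \<rho> r M s J' =
     ereal (capacity M J' - (\<Sum>i\<in>{i\<in>users_within M J'. i > s}. \<rho> i)) /
     ereal (\<Sum>i\<in>{i\<in>users_within M J'. i \<le> s}. \<rho> i / r i)"

definition min_ratio ::
    "(nat \<Rightarrow> real) \<Rightarrow> (nat \<Rightarrow> real) \<Rightarrow> nat \<Rightarrow> 'j network \<Rightarrow> ereal" where
  "min_ratio \<rho> r m M =
     Min {level_ratio \<rho> r M s J' | s J'. s \<in> {1..m} \<and> J' \<in> strongly_connected_sets M}"

definition min_resources ::
    "(nat \<Rightarrow> real) \<Rightarrow> (nat \<Rightarrow> real) \<Rightarrow> nat \<Rightarrow> 'j network \<Rightarrow> 'j set" where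
  "min_resources \<rho> r m M =
     \<Union>{J'\<in>strongly_connected_sets M. \<exists>s\<in>{1..m}. level_ratio \<rho> r M s J' = min_ratio \<rho> r m M}"

definition min_users ::
    "(nat \<Rightarrow> real) \<Rightarrow> (nat \<Rightarrow> real) \<Rightarrow> nat \<Rightarrow> 'j network \<Rightarrow> nat set" where
  "min_users \<rho> r m M = users_within M (min_resources \<rho> r m M)"

definition reduced_network ::
    "(nat \<Rightarrow> real) \<Rightarrow> (nat \<Rightarrow> real) \<Rightarrow> nat \<Rightarrow> 'j network \<Rightarrow> 'j network" where
  "reduced_network \<rho> r m M =
     M\<lparr>users := users M - min_users \<rho> r m M,
       resources := resources M - min_resources \<rho> r m M,
       route := (\<lambda>i. route M i - min_resources \<rho> r m M)\<rparr>"

text \<open>Step \<open>k \<ge> 1\<close> of the algorithm is performed on \<open>alg_network \<rho> r N (k - 1)\<close>.\<close>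

definition alg_network ::
    "(nat \<Rightarrow> real) \<Rightarrow> (nat \<Rightarrow> real) \<Rightarrow> 'j network \<Rightarrow> nat \<Rightarrow> 'j network" where
  "alg_network \<rho> r N k = (reduced_network \<rho> r (card (users N)) ^^ k) N"

definition alg_rate ::
    "(nat \<Rightarrow> real) \<Rightarrow> (nat \<Rightarrow> real) \<Rightarrow> 'j network \<Rightarrow> nat \<Rightarrow> ereal" where
  "alg_rate \<rho> r N k = min_ratio \<rho> r (card (users N)) (alg_network \<rho> r N (k - 1))"

definition alg_resources ::
    "(nat \<Rightarrow> real) \<Rightarrow> (nat \<Rightarrow> real) \<Rightarrow> 'j network \<Rightarrow> nat \<Rightarrow> 'j set" where
  "alg_resources \<rho> r N k = min_resources \<rho> r (card (users N)) (alg_network \<rho> r N (k - 1))"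

definition alg_users ::
    "(nat \<Rightarrow> real) \<Rightarrow> (nat \<Rightarrow> real) \<Rightarrow> 'j network \<Rightarrow> nat \<Rightarrow> nat set" where
  "alg_users \<rho> r N k = min_users \<rho> r (card (users N)) (alg_network \<rho> r N (k - 1))"

text \<open>The peak rates with the convention $r_{m+1} = \infty$.\<close>

definition ext_peak :: "(nat \<Rightarrow> real) \<Rightarrow> nat \<Rightarrow> nat \<Rightarrow> ereal" where
  "ext_peak r m i = (if i = m + 1 then \<infinity> else ereal (r i))"

definition is_threshold ::
    "(nat \<Rightarrow> real) \<Rightarrow> (nat \<Rightarrow> real) \<Rightarrow> 'j network \<Rightarrow> nat \<Rightarrow> nat \<Rightarrow> bool" where
  "is_threshold \<rho> r N k s \<longleftrightarrow> s \<in> {1..card (users N)} \<and>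
     alg_rate \<rho> r N k \<in> {ext_peak r (card (users N)) s <.. ext_peak r (card (users N)) (s + 1)}"

definition alg_threshold ::
    "(nat \<Rightarrow> real) \<Rightarrow> (nat \<Rightarrow> real) \<Rightarrow> 'j network \<Rightarrow> nat \<Rightarrow> nat" where
  "alg_threshold \<rho> r N k = (THE s. is_threshold \<rho> r N k s)"

text \<open>The algorithm performs the steps \<open>1, \<dots>, K\<close>.\<close>

definition alg_stops ::
    "(nat \<Rightarrow> real) \<Rightarrow> (nat \<Rightarrow> real) \<Rightarrow> 'j network \<Rightarrow> nat \<Rightarrow> bool" where
  "alg_stops \<rho> r N K \<longleftrightarrow>
     users (alg_network \<rho> r N K) = {} \<and> resources (alg_network \<rho> r N K) = {} \<and>
     (\<forall>k<K. users (alg_network \<rho> r N k) \<noteq> {} \<or> resources (alg_network \<rho> r N k) \<noteq> {})"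

end

theory Submission
  imports Defs
begin

text \<open>An allocation is optimal iff it is max-min fair: used resources are saturated and each serves
  only those of its users that have the smallest rate. At an equilibrium with optimal rates
  \<open>x\<close>, type \<open>i\<close> takes the capacity \<open>\<rho> i * max 1 (x i / r i)\<close> in total. Equilibria thus
  correspond to fair flows with these rate dependent demands. Let \<open>slack M d J'\<close> be the capacity of
  \<open>J'\<close> minus the demand \<open>d\<close> of the users confined to \<open>J'\<close>. The minimum over
  \<open>i\<^sup>*\<close> of the ratios of \<open>J'\<close> is the common rate at which the slack of \<open>J'\<close> vanishes, because
  maximizing the demand over \<open>i\<^sup>*\<close> puts \<open>i\<^sup>*\<close> at the threshold of the rate. By
  supermodularity the sets that are tight at the minimal rate are closed under union. A fractional
  Hall theorem fills the largest tight set exactly, and the construction continues in the reduced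
  network, where all slacks at that rate are positive. Conversely, every fair flow fills the
  resources of its slowest users, which by genericity form the largest tight set.\<close>

text \<open>Rates at an equilibrium depend on the population, which in turn depends on the rates.
  The balance equation breaks this circle: with \<open>n i = \<rho> i / min (x i) (r i)\<close> the
  product \<open>n i * x i\<close> is a function of \<open>x i\<close> alone, so population and
  utility drop out of the problem. This function is constant up to \<open>r i\<close>, hence slack
  decreases only weakly with the rate. Stability forces each set without slack to contain a user
  beyond its peak rate; this restores strictness and makes the rate unique at which a set becomes
  tight. As \<open>opt_rate\<close> is a definite description, nothing is known about it at a
  population until a fair allocation is exhibited there. The filling construction must therefore
  serve arbitrary populations, not just the candidate equilibrium.\<close>

subsection \<open>A fractional Hall theorem\<close>

lemma sum_fun_upd_diff:
  fixes f :: "'a \<Rightarrow> real"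
  assumes "finite A"
  shows "sum (f(a := f a - t)) A = sum f A - (if a \<in> A then t else 0)"
proof (cases "a \<in> A")
  case True
  then show ?thesis using assms by (simp add: sum.remove[of A a])
next
  case False
  then show ?thesis by (auto intro: sum.cong)
qed

lemma fractional_hall:
  fixes s :: "'a \<Rightarrow> real" and c :: "'b \<Rightarrow> real"
  assumes "finite I" "finite J" "\<forall>i\<in>I. S i \<subseteq> J" "\<forall>i\<in>I. 0 \<le> s i"
    and "\<forall>A\<subseteq>J. (\<Sum>i\<in>{i\<in>I. S i \<subseteq> A}. s i) \<le> (\<Sum>j\<in>A. c j)"
  shows "\<exists>Z. (\<forall>i\<in>I. \<forall>j\<in>S i. 0 \<le> Z i j) \<and> (\<forall>i\<in>I. (\<Sum>j\<in>S i. Z i j) = s i) \<and>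
           (\<forall>j\<in>J. (\<Sum>i\<in>{i\<in>I. j \<in> S i}. Z i j) \<le> c j)"
  using assms
proof (induction "\<Sum>i\<in>I. card (S i)" arbitrary: S s c rule: less_induct)
  case less
  note fin = less.prems(1,2) and sub = less.prems(3) and s0 = less.prems(4) and hall = less.prems(5)
  have finS: "finite (S i)" if "i \<in> I" for i
    using that sub fin(2) finite_subset by blast
  show ?case
  proof (cases "\<forall>i\<in>I. S i = {}")
    case True
    have "\<forall>i\<in>I. s i = 0"
    proof -
      have "(\<Sum>i\<in>{i\<in>I. S i \<subseteq> {}}. s i) \<le> (\<Sum>j\<in>{}. c j)" using hall by blast
      moreover have "{i\<in>I. S i \<subseteq> {}} = I" using True by auto
      ultimately have "(\<Sum>i\<in>I. s i) \<le> 0" by simp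
      then have "(\<Sum>i\<in>I. s i) = 0" using s0 by (simp add: antisym sum_nonneg)
      then show ?thesis using s0 fin by (simp add: sum_nonneg_eq_0_iff)
    qed
    moreover have "0 \<le> c j" if "j \<in> J" for j
    proof -
      have "0 \<le> (\<Sum>i\<in>{i\<in>I. S i \<subseteq> {j}}. s i)" using s0 by (intro sum_nonneg) auto
      also have "\<dots> \<le> (\<Sum>j\<in>{j}. c j)" using hall that by blast
      finally show ?thesis by simp
    qed
    ultimately show ?thesis using True by (intro exI[of _ "\<lambda>_ _. 0"]) auto
  next
    case False
    then obtain k l where k: "k \<in> I" and l: "l \<in> S k" by blast
    define g where "g A = (\<Sum>j\<in>A. c j) - (\<Sum>i\<in>{i\<in>I. S i \<subseteq> A}. s i)" for A
    have g0: "0 \<le> g A" if "A \<subseteq> J" for A using hall that by (simp add: g_def)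
    \<comment> \<open>Routing an amount of \<open>k\<close> over \<open>l\<close> costs slack
      exactly on these sets: they lose capacity at \<open>l\<close>, but the demand of
      \<open>k\<close> does not count for them.\<close>
    define F where "F = {A. A \<subseteq> J \<and> l \<in> A \<and> \<not> S k \<subseteq> A}"
    have finF: "finite F" unfolding F_def using fin(2) by simp
    define t where "t = Min (insert (s k) (g ` F))"
    have t_le: "t \<le> s k" and t_F: "\<And>A. A \<in> F \<Longrightarrow> t \<le> g A"
      unfolding t_def using finF by auto
    have t0: "0 \<le> t" unfolding t_def using finF s0 k g0 by (auto simp: F_def)
    have t_in: "t = s k \<or> (\<exists>A\<in>F. t = g A)"
      using Min_in[of "insert (s k) (g ` F)"] finF unfolding t_def by auto
    \<comment> \<open>Without the edge, \<open>k\<close> becomes confined to \<open>B\<close>, so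
      its remaining demand must fit. If a set \<open>A\<close> with \<open>g A = t\<close> stopped
      the routing, then \<open>k\<close> is confined to the union of \<open>A\<close> and
      \<open>B\<close> but to neither of them, and uncrossing gains the summand
      \<open>s k\<close>.\<close>
    have t_B: "s k - t \<le> g B" if B: "B \<subseteq> J" "l \<notin> B" "S k - {l} \<subseteq> B" for B
      using t_in
    proof
      assume "t = s k" then show ?thesis using g0 B by simp
    next
      assume "\<exists>A\<in>F. t = g A"
      then obtain A where A: "A \<subseteq> J" "l \<in> A" "\<not> S k \<subseteq> A" and t: "t = g A" unfolding F_def by blast
      have fAB: "finite A" "finite B" using A B fin(2) finite_subset by blast+
      let ?W = "\<lambda>A. {i\<in>I. S i \<subseteq> A}"
      have "s k + (sum s (?W A) + sum s (?W B)) = s k + (sum s (?W A \<union> ?W B) + sum s (?W A \<inter> ?W B))"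
        using fin by (simp add: sum.union_inter)
      also have "s k + sum s (?W A \<union> ?W B) = sum s (insert k (?W A \<union> ?W B))"
        using fin A B l by (subst sum.insert) auto
      then have "s k + (sum s (?W A \<union> ?W B) + sum s (?W A \<inter> ?W B)) =
          sum s (insert k (?W A \<union> ?W B)) + sum s (?W A \<inter> ?W B)" by simp
      also have "\<dots> \<le> sum s (?W (A \<union> B)) + sum s (?W (A \<inter> B))"
      proof (rule add_mono)
        show "sum s (insert k (?W A \<union> ?W B)) \<le> sum s (?W (A \<union> B))"
          using fin s0 A B k by (intro sum_mono2) auto
        have "?W A \<inter> ?W B = ?W (A \<inter> B)" by auto
        then show "sum s (?W A \<inter> ?W B) \<le> sum s (?W (A \<inter> B))" by simp
      qed
      finally have 1: "s k + (sum s (?W A) + sum s (?W B)) \<le> sum s (?W (A \<union> B)) + sum s (?W (A \<inter> B))" .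
      have 2: "sum c A + sum c B = sum c (A \<union> B) + sum c (A \<inter> B)"
        using fAB by (simp add: sum.union_inter)
      have "0 \<le> g (A \<union> B)" "0 \<le> g (A \<inter> B)" using A B by (auto intro!: g0)
      then show ?thesis using 1 2 t unfolding g_def by linarith
    qed
    \<comment> \<open>Moving the largest amount \<open>t\<close> of user \<open>k\<close> to \<open>l\<close> that keeps Hall's condition removes the edge \<open>(k, l)\<close>.\<close>
    define S' where "S' = S(k := S k - {l})"
    define s' where "s' = s(k := s k - t)"
    define c' where "c' = c(l := c l - t)"
    have lJ: "l \<in> J" using k l sub by blast
    have "(\<Sum>i\<in>I. card (S' i)) < (\<Sum>i\<in>I. card (S i))"
    proof (rule sum_strict_mono_ex1)
      show "\<forall>i\<in>I. card (S' i) \<le> card (S i)" using finS by (auto simp: S'_def intro: card_mono)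
      show "\<exists>i\<in>I. card (S' i) < card (S i)"
        using k card_Diff1_less[OF finS[OF k] l] by (intro bexI[of _ k]) (simp_all only: S'_def fun_upd_same)
    qed (rule fin)
    moreover have "\<forall>i\<in>I. S' i \<subseteq> J" using sub by (auto simp: S'_def)
    moreover have "\<forall>i\<in>I. 0 \<le> s' i" using s0 t_le by (auto simp: s'_def)
    moreover have "\<forall>A\<subseteq>J. (\<Sum>i\<in>{i\<in>I. S' i \<subseteq> A}. s' i) \<le> (\<Sum>j\<in>A. c' j)"
    proof (intro allI impI)
      fix A assume A: "A \<subseteq> J"
      have fA: "finite A" using A fin(2) finite_subset by blast
      have cA: "sum c' A = sum c A - (if l \<in> A then t else 0)"
        unfolding c'_def using fA by (rule sum_fun_upd_diff)
      have sum_upd: "sum s' B = sum s B - (if k \<in> B then t else 0)" if "finite B" for B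
        unfolding s'_def using that by (rule sum_fun_upd_diff)
      show "(\<Sum>i\<in>{i\<in>I. S' i \<subseteq> A}. s' i) \<le> (\<Sum>j\<in>A. c' j)"
      proof (cases "l \<in> A")
        case True
        then have W: "{i\<in>I. S' i \<subseteq> A} = {i\<in>I. S i \<subseteq> A}" by (auto simp: S'_def split: if_splits)
        show ?thesis
        proof (cases "S k \<subseteq> A")
          case True
          with W cA sum_upd[of "{i\<in>I. S i \<subseteq> A}"] fin k g0[OF A] \<open>l \<in> A\<close> show ?thesis
            by (simp add: g_def)
        next
          case False
          with W cA sum_upd[of "{i\<in>I. S i \<subseteq> A}"] fin k t_F[of A] A \<open>l \<in> A\<close> show ?thesis
            by (simp add: g_def F_def)
        qed
      next
        case False
        show ?thesis
        proof (cases "S k - {l} \<subseteq> A")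
          case True
          have W: "{i\<in>I. S' i \<subseteq> A} = insert k {i\<in>I. S i \<subseteq> A}"
            using True k False by (auto simp: S'_def split: if_splits)
          have "k \<notin> {i\<in>I. S i \<subseteq> A}" using l False by auto
          then show ?thesis using W cA sum_upd[of "{i\<in>I. S' i \<subseteq> A}"] fin t_B[OF A False True] False
            by (simp add: g_def)
        next
          case F: False
          have W: "{i\<in>I. S' i \<subseteq> A} = {i\<in>I. S i \<subseteq> A}"
            using F by (auto simp: S'_def split: if_splits)
          have "k \<notin> {i\<in>I. S i \<subseteq> A}" using F by auto
          then show ?thesis using W cA sum_upd[of "{i\<in>I. S i \<subseteq> A}"] fin g0[OF A] False
            by (auto simp: g_def)
        qed
      qed
    qed
    ultimately obtain Z where Z0: "\<forall>i\<in>I. \<forall>j\<in>S' i. 0 \<le> Z i j"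
      and Zs: "\<forall>i\<in>I. (\<Sum>j\<in>S' i. Z i j) = s' i"
      and Zc: "\<forall>j\<in>J. (\<Sum>i\<in>{i\<in>I. j \<in> S' i}. Z i j) \<le> c' j"
      using less.hyps[of S' s' c'] fin by blast
    define Z' where "Z' = Z(k := (Z k)(l := t))"
    have "\<forall>i\<in>I. \<forall>j\<in>S i. 0 \<le> Z' i j"
      using Z0 t0 by (auto simp: Z'_def S'_def split: if_splits)
    moreover have "(\<Sum>j\<in>S i. Z' i j) = s i" if i: "i \<in> I" for i
    proof (cases "i = k")
      case True
      have "(\<Sum>j\<in>S k. Z' k j) = t + (\<Sum>j\<in>S k - {l}. Z k j)"
        using finS k l by (simp add: Z'_def sum.remove[of "S k" l])
      also have "\<dots> = s k" using bspec[OF Zs k] by (simp add: S'_def s'_def)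
      finally show ?thesis using True by simp
    next
      case False
      then show ?thesis using bspec[OF Zs i] by (simp add: Z'_def S'_def s'_def)
    qed
    moreover have "(\<Sum>i\<in>{i\<in>I. j \<in> S i}. Z' i j) \<le> c j" if j: "j \<in> J" for j
    proof (cases "j = l")
      case True
      have W: "{i\<in>I. l \<in> S i} = insert k {i\<in>I. l \<in> S' i}" "k \<notin> {i\<in>I. l \<in> S' i}"
        using k l by (auto simp: S'_def split: if_splits)
      have "(\<Sum>i\<in>{i\<in>I. l \<in> S i}. Z' i l) = Z' k l + (\<Sum>i\<in>{i\<in>I. l \<in> S' i}. Z' i l)"
        unfolding W(1) using fin W(2) by (subst sum.insert) auto
      also have "(\<Sum>i\<in>{i\<in>I. l \<in> S' i}. Z' i l) = (\<Sum>i\<in>{i\<in>I. l \<in> S' i}. Z i l)"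
        using W(2) by (intro sum.cong) (auto simp: Z'_def)
      also have "Z' k l + \<dots> \<le> t + c' l" using Zc lJ by (simp add: Z'_def)
      finally show ?thesis using True by (simp add: c'_def)
    next
      case False
      have W: "{i\<in>I. j \<in> S i} = {i\<in>I. j \<in> S' i}" using False by (auto simp: S'_def)
      have "(\<Sum>i\<in>{i\<in>I. j \<in> S i}. Z' i j) = (\<Sum>i\<in>{i\<in>I. j \<in> S' i}. Z i j)"
        unfolding W using False by (intro sum.cong) (auto simp: Z'_def)
      then show ?thesis using bspec[OF Zc j] False by (simp add: c'_def)
    qed
    ultimately show ?thesis by blast
  qed
qed

subsection \<open>Fair flows and optimal allocations\<close>

text \<open>\<open>D\<close> is the derivative of \<open>u\<close>. The delicate point is
  \<open>y = 0\<close>, where the utility may be \<open>-\<infinity>\<close> and is not assumed to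
  be continuous.\<close>

lemma utility_tangents:
  assumes "is_utility U"
  obtains u D :: "real \<Rightarrow> real"
  where "\<And>x. 0 < x \<Longrightarrow> U x = ereal (u x)"
    and "\<And>x. 0 < x \<Longrightarrow> 0 \<le> D x"
    and "\<And>x y. 0 < x \<Longrightarrow> x \<le> y \<Longrightarrow> D y \<le> D x"
    and "\<And>x y. 0 < x \<Longrightarrow> 0 \<le> y \<Longrightarrow> y \<noteq> x \<Longrightarrow> U y < ereal (u x + D x * (y - x))"
proof -
  from assms obtain u :: "real \<Rightarrow> real" where mono: "strict_mono_on {0..} U"
    and u: "\<And>x. 0 < x \<Longrightarrow> U x = ereal (u x)"
    and diff: "u differentiable_on {0<..}"
    and conc: "\<And>x y t. 0 < x \<Longrightarrow> 0 < y \<Longrightarrow> x \<noteq> y \<Longrightarrow> 0 < t \<Longrightarrow> t < 1 \<Longrightarrow>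
      (1 - t) * u x + t * u y < u ((1 - t) * x + t * y)"
    unfolding is_utility_def by blast
  define D where "D = deriv u"
  have D: "(u has_field_derivative D x) (at x within {0<..})" if "0 < x" for x
  proof -
    have "u differentiable (at x)"
      using diff that by (simp add: differentiable_on_eq_differentiable_at)
    then show ?thesis
      unfolding D_def using DERIV_deriv_iff_real_differentiable has_field_derivative_at_within by blast
  qed
  have cvx: "convex_on {0<..} (\<lambda>x. - u x)"
  proof (rule convex_onI)
    fix t x y :: real assume "0 < t" "t < 1" "x \<in> {0<..}" "y \<in> {0<..}"
    then show "- u ((1 - t) *\<^sub>R x + t *\<^sub>R y) \<le> (1 - t) * - u x + t * - u y"
      using conc[of x y t] by (cases "x = y") (auto simp: algebra_simps)
  qed simp
  have weak: "u y \<le> u x + D x * (y - x)" if "0 < x" "0 < y" for x y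
  proof -
    have "- u y - - u x \<ge> (- D x) * (y - x)"
      using that by (intro convex_on_imp_above_tangent[OF cvx])
        (auto simp: interior_open intro!: derivative_eq_intros D)
    then show ?thesis by simp
  qed
  have strict: "u y < u x + D x * (y - x)" if "0 < x" "0 < y" "y \<noteq> x" for x y
  proof -
    \<comment> \<open>The strict gap at the midpoint becomes twice as large at
      \<open>y\<close>.\<close>
    have "(u x + u y) / 2 < u ((x + y) / 2)" using conc[of x y "1/2"] that by (simp add: field_simps)
    moreover have "u ((x + y) / 2) \<le> u x + D x * ((x + y) / 2 - x)"
      using that by (intro weak) auto
    ultimately show ?thesis by (simp add: field_simps)
  qed
  have D0: "0 \<le> D x" if x: "0 < x" for x
  proof -
    have "U x < U (x + 1)" using mono x by (auto simp: strict_mono_on_def)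
    then have "u x < u (x + 1)" using u x by simp
    also have "\<dots> \<le> u x + D x" using weak[of x "x + 1"] x by simp
    finally show ?thesis by simp
  qed
  have anti: "D y \<le> D x" if "0 < x" "x \<le> y" for x y
  proof (cases "x = y")
    case False
    have "0 \<le> (D x - D y) * (y - x)"
      using weak[of x y] weak[of y x] that by (simp add: algebra_simps)
    then show ?thesis using False that by (simp add: zero_le_mult_iff)
  qed simp
  have zero: "U 0 < ereal (u x + D x * (0 - x))" if x: "0 < x" for x
  proof -
    \<comment> \<open>\<open>U 0\<close> lies below every \<open>u y\<close> with
      \<open>y > 0\<close>, hence in the limit below the tangent at any point. The tangent at
      \<open>z\<close> instead of \<open>x\<close> makes the final inequality strict.\<close>
    define z where "z = x / 2"
    have z: "0 < z" "z < x" using x by (auto simp: z_def)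
    have bound: "U 0 \<le> ereal (u z - D z * z) + ereal e" if e: "0 < e" for e
    proof -
      define y where "y = e / (D z + 1)"
      have y: "0 < y" using e D0[OF z(1)] by (simp add: y_def)
      have "D z * y \<le> e"
        using e D0[OF z(1)] by (simp add: y_def divide_simps mult.commute)
      then have "u y \<le> u z - D z * z + e" using weak[OF z(1) y] by (simp add: algebra_simps)
      then have "ereal (u y) \<le> ereal (u z - D z * z) + ereal e" by simp
      moreover have "U 0 < U y" using mono y by (auto simp: strict_mono_on_def)
      ultimately show ?thesis unfolding u[OF y] by order
    qed
    have "U 0 \<le> ereal (u z - D z * z)" by (rule ereal_le_epsilon2) (rule bound)
    also have "u z - D z * z < u x + D x * (0 - x)"
    proof -
      have "D x * z \<le> D z * z" using anti[of z x] z by (simp add: mult_right_mono)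
      moreover have "u z < u x + D x * (z - x)" using strict[of x z] z x by simp
      ultimately show ?thesis by (simp add: algebra_simps)
    qed
    finally show ?thesis by simp
  qed
  show thesis
  proof (rule that[of u D])
    fix x y :: real assume "0 < x" "0 \<le> y" "y \<noteq> x"
    then show "U y < ereal (u x + D x * (y - x))"
      using strict[of x y] u[of y] zero[of x] by (cases "y = 0") auto
  qed (use u D0 anti in auto)
qed

section \<open>Fair flows and their price duality\<close>

lemma finite_network:
  assumes "is_network N"
  shows "finite (users N)" "finite (resources N)" "i \<in> users N \<Longrightarrow> finite (route N i)"
  using assms finite_subset unfolding is_network_def by blast+

lemma route_network:
  assumes "is_network N" "i \<in> users N"
  shows "route N i \<subseteq> resources N" "route N i \<noteq> {}"
  using assms unfolding is_network_def by blast+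

text \<open>A resource that nobody can use is never saturated, so fair flows have to fill only
  these.\<close>

definition used_resources :: "'j network \<Rightarrow> 'j set" where
  "used_resources N = \<Union>(route N ` users N)"

lemma used_resources_subset: "is_network N \<Longrightarrow> used_resources N \<subseteq> resources N"
  unfolding used_resources_def using route_network by blast

lemma sum_users_routes:
  assumes "is_network N" "I \<subseteq> users N"
  shows "(\<Sum>i\<in>I. \<Sum>j\<in>route N i \<inter> B. g i j) =
    (\<Sum>j\<in>resources N \<inter> B. \<Sum>i\<in>{i\<in>I. j \<in> route N i}. g i j)"
proof -
  have fin: "finite I" "finite (resources N \<inter> B)"
    using assms finite_network[of N] finite_subset by auto
  have "(\<Sum>i\<in>I. \<Sum>j\<in>route N i \<inter> B. g i j) =
      (\<Sum>i\<in>I. \<Sum>j\<in>{j. j \<in> resources N \<inter> B \<and> j \<in> route N i}. g i j)"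
    using route_network(1)[OF assms(1)] assms(2) by (intro sum.cong) auto
  also have "\<dots> = (\<Sum>j\<in>resources N \<inter> B. \<Sum>i\<in>{i\<in>I. j \<in> route N i}. g i j)"
    by (rule sum.swap_restrict[OF fin])
  finally show ?thesis .
qed

text \<open>\<open>Z i j\<close> is the total rate $n_i x_i^j$ of type \<open>i\<close> on \<open>j\<close>, and \<open>d i\<close> is $n_i x_i$.\<close>

definition fair_flow ::
    "'j network \<Rightarrow> (nat \<Rightarrow> real) \<Rightarrow> (nat \<Rightarrow> real) \<Rightarrow> (nat \<Rightarrow> 'j \<Rightarrow> real) \<Rightarrow> bool" where
  "fair_flow N d x Z \<longleftrightarrow>
     (\<forall>i\<in>users N. \<forall>j\<in>route N i. 0 \<le> Z i j \<and>
        (0 < Z i j \<longrightarrow> (\<forall>i'\<in>users N. j \<in> route N i' \<longrightarrow> x i \<le> x i'))) \<and>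
     (\<forall>i\<in>users N. (\<Sum>j\<in>route N i. Z i j) = d i) \<and>
     (\<forall>j\<in>used_resources N. (\<Sum>i\<in>{i\<in>users N. j \<in> route N i}. Z i j) = cap N j)"

lemma fair_flow_cong:
  assumes "fair_flow N d x Z" "\<And>i. i \<in> users N \<Longrightarrow> d i = d' i" "\<And>i. i \<in> users N \<Longrightarrow> x i = x' i"
    and "\<And>i j. i \<in> users N \<Longrightarrow> j \<in> route N i \<Longrightarrow> Z i j = Z' i j"
  shows "fair_flow N d' x' Z'"
proof -
  have "(\<Sum>j\<in>route N i. Z' i j) = (\<Sum>j\<in>route N i. Z i j)" if "i \<in> users N" for i
    using that assms(4) by simp
  moreover have "(\<Sum>i\<in>{i\<in>users N. j \<in> route N i}. Z' i j) = (\<Sum>i\<in>{i\<in>users N. j \<in> route N i}. Z i j)" for j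
    using assms(4) by simp
  ultimately show ?thesis
    using assms unfolding fair_flow_def by simp
qed

lemma column_sum_le_cap:
  assumes "is_network N" "j \<in> resources N"
    and "\<forall>j\<in>used_resources N. (\<Sum>i\<in>{i\<in>users N. j \<in> route N i}. Z i j) = cap N j"
  shows "(\<Sum>i\<in>{i\<in>users N. j \<in> route N i}. Z i j) \<le> cap N j"
proof (cases "j \<in> used_resources N")
  case False
  then have "{i\<in>users N. j \<in> route N i} = {}" unfolding used_resources_def by blast
  then have "(\<Sum>i\<in>{i\<in>users N. j \<in> route N i}. Z i j) = 0" by (simp only: sum.empty)
  then show ?thesis using assms(1,2) unfolding is_network_def by force
qed (use assms(3) in simp)

lemma fair_feasible:
  assumes "is_network N" "\<forall>i\<in>users N. 0 < n i" "fair_flow N d x (\<lambda>i j. n i * X i j)"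
  shows "feasible N n X"
  using assms column_sum_le_cap[OF assms(1), of _ "\<lambda>i j. n i * X i j"]
  unfolding feasible_def fair_flow_def by (force simp: zero_le_mult_iff)

lemma fair_total_rate:
  assumes "\<forall>i\<in>users N. 0 < n i" "fair_flow N (\<lambda>i. n i * x i) x (\<lambda>i j. n i * X i j)" "i \<in> users N"
  shows "total_rate N X i = x i"
proof -
  have "(\<Sum>j\<in>route N i. n i * X i j) = n i * x i"
    using assms(2,3) unfolding fair_flow_def by blast
  then show ?thesis
    using assms(1,3) by (auto simp: total_rate_def sum_distrib_left[symmetric])
qed

text \<open>\<open>q j\<close> is the rate at which \<open>j\<close> serves, and \<open>f (q j)\<close> acts as the price of \<open>j\<close>.\<close>

lemma fair_gap:
  assumes net: "is_network N" and n: "\<forall>i\<in>users N. 0 < n i"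
    and fair: "fair_flow N (\<lambda>i. n i * x i) x (\<lambda>i j. n i * X i j)"
    and f: "\<And>i k. i \<in> users N \<Longrightarrow> k \<in> users N \<Longrightarrow> x i \<le> x k \<Longrightarrow> f (x k) \<le> f (x i)"
    and q: "\<And>j. q j = Min {x i | i. i \<in> users N \<and> j \<in> route N i}"
  shows "(\<Sum>i\<in>users N. n i * f (x i) * x i) - (\<Sum>i\<in>users N. n i * f (x i) * total_rate N Y i) =
    (\<Sum>j\<in>used_resources N. f (q j) * (cap N j - (\<Sum>i\<in>{i\<in>users N. j \<in> route N i}. n i * Y i j))) +
    (\<Sum>i\<in>users N. \<Sum>j\<in>route N i. n i * (f (q j) - f (x i)) * Y i j)"
proof -
  have gap: "(\<Sum>j\<in>used_resources N. f (q j) * cap N j) -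
      (\<Sum>i\<in>users N. n i * f (x i) * total_rate N Y i) =
    (\<Sum>j\<in>used_resources N. f (q j) * (cap N j - (\<Sum>i\<in>{i\<in>users N. j \<in> route N i}. n i * Y i j))) +
    (\<Sum>i\<in>users N. \<Sum>j\<in>route N i. n i * (f (q j) - f (x i)) * Y i j)" (is "_ = ?A + ?B") for Y
  proof -
    have "(\<Sum>i\<in>users N. \<Sum>j\<in>route N i \<inter> used_resources N. f (q j) * (n i * Y i j)) =
        (\<Sum>j\<in>resources N \<inter> used_resources N. \<Sum>i\<in>{i\<in>users N. j \<in> route N i}. f (q j) * (n i * Y i j))"
      by (rule sum_users_routes[OF net]) simp
    moreover have "resources N \<inter> used_resources N = used_resources N"
      using used_resources_subset[OF net] by blast
    moreover have "route N i \<inter> used_resources N = route N i" if "i \<in> users N" for i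
      using that unfolding used_resources_def by blast
    ultimately have "(\<Sum>i\<in>users N. \<Sum>j\<in>route N i. f (q j) * (n i * Y i j)) =
        (\<Sum>j\<in>used_resources N. f (q j) * (\<Sum>i\<in>{i\<in>users N. j \<in> route N i}. n i * Y i j))"
      by (simp add: sum_distrib_left)
    then have "?A + ?B = (\<Sum>j\<in>used_resources N. f (q j) * cap N j) -
        (\<Sum>i\<in>users N. \<Sum>j\<in>route N i. n i * f (x i) * Y i j)"
      by (simp add: algebra_simps sum_subtractf)
    then show ?thesis by (simp add: total_rate_def sum_distrib_left)
  qed
  have qx: "q j = x i" if "i \<in> users N" "j \<in> route N i" "0 < n i * X i j" for i j
  proof -
    have "\<forall>i'\<in>users N. j \<in> route N i' \<longrightarrow> x i \<le> x i'"
      using fair that unfolding fair_flow_def by blast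
    then show ?thesis unfolding q using that finite_network[OF net] by (intro Min_eqI) auto
  qed
  \<comment> \<open>For \<open>X\<close> both parts of the gap vanish. This evaluates the total
    price of the capacities, and the identity for \<open>Y\<close> can be compared with it.\<close>
  have "(\<Sum>i\<in>users N. \<Sum>j\<in>route N i. n i * (f (q j) - f (x i)) * X i j) = 0"
  proof (intro sum.neutral ballI)
    fix i j assume ij: "i \<in> users N" "j \<in> route N i"
    then have "0 \<le> n i * X i j" using fair unfolding fair_flow_def by blast
    then show "n i * (f (q j) - f (x i)) * X i j = 0" using qx[OF ij] by fastforce
  qed
  moreover have "(\<Sum>j\<in>used_resources N. f (q j) *
      (cap N j - (\<Sum>i\<in>{i\<in>users N. j \<in> route N i}. n i * X i j))) = 0"
    using fair unfolding fair_flow_def by (intro sum.neutral) simp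
  moreover have "(\<Sum>i\<in>users N. n i * f (x i) * total_rate N X i) = (\<Sum>i\<in>users N. n i * f (x i) * x i)"
    using fair_total_rate[OF n fair] by simp
  ultimately have "(\<Sum>j\<in>used_resources N. f (q j) * cap N j) = (\<Sum>i\<in>users N. n i * f (x i) * x i)"
    using gap[of X] by linarith
  then show ?thesis using gap[of Y] by simp
qed

lemma min_rate_at_resource:
  assumes net: "is_network N" and q: "\<And>j. q j = Min {x i | i. i \<in> users N \<and> j \<in> route N i}"
    and j: "j \<in> used_resources N"
  shows "\<exists>i\<in>users N. j \<in> route N i \<and> q j = x i" "\<And>i. i \<in> users N \<Longrightarrow> j \<in> route N i \<Longrightarrow> q j \<le> x i"
proof -
  let ?S = "{x i | i. i \<in> users N \<and> j \<in> route N i}"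
  have fin: "finite ?S" using finite_network[OF net] by auto
  have "?S \<noteq> {}" using j unfolding used_resources_def by blast
  then have "q j \<in> ?S" unfolding q using fin by (intro Min_in)
  then show "\<exists>i\<in>users N. j \<in> route N i \<and> q j = x i" by blast
  show "q j \<le> x i" if "i \<in> users N" "j \<in> route N i" for i
    unfolding q using fin that by (intro Min_le) auto
qed

text \<open>\<open>q j\<close> is the smallest rate at \<open>j\<close>, so antitone prices make all
  surcharges nonnegative and both parts of the gap are. With the derivative of the utility as price,
  this bounds the first order change of the objective at the fair rates.\<close>

lemma feasible_price_sum_le:
  assumes net: "is_network N" and n: "\<forall>i\<in>users N. 0 < n i"
    and fair: "fair_flow N (\<lambda>i. n i * x i) x (\<lambda>i j. n i * X i j)"
    and f: "\<And>i k. i \<in> users N \<Longrightarrow> k \<in> users N \<Longrightarrow> x i \<le> x k \<Longrightarrow> f (x k) \<le> f (x i)"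
    and f0: "\<And>i. i \<in> users N \<Longrightarrow> 0 \<le> f (x i)"
    and Y: "feasible N n Y"
  shows "(\<Sum>i\<in>users N. n i * f (x i) * total_rate N Y i) \<le> (\<Sum>i\<in>users N. n i * f (x i) * x i)"
proof -
  define q where "q j = Min {x i | i. i \<in> users N \<and> j \<in> route N i}" for j
  note q_le = min_rate_at_resource(2)[OF net q_def] and q_ex = min_rate_at_resource(1)[OF net q_def]
  have "0 \<le> (\<Sum>j\<in>used_resources N. f (q j) *
      (cap N j - (\<Sum>i\<in>{i\<in>users N. j \<in> route N i}. n i * Y i j)))"
  proof (intro sum_nonneg mult_nonneg_nonneg)
    fix j assume j: "j \<in> used_resources N"
    show "0 \<le> f (q j)" using q_ex[OF j] f0 by auto
    show "0 \<le> cap N j - (\<Sum>i\<in>{i\<in>users N. j \<in> route N i}. n i * Y i j)"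
      using Y used_resources_subset[OF net] j unfolding feasible_def by auto
  qed
  moreover have "0 \<le> (\<Sum>i\<in>users N. \<Sum>j\<in>route N i. n i * (f (q j) - f (x i)) * Y i j)"
  proof (intro sum_nonneg mult_nonneg_nonneg)
    fix i j assume ij: "i \<in> users N" "j \<in> route N i"
    then have j: "j \<in> used_resources N" unfolding used_resources_def by blast
    show "0 \<le> n i" using n ij by force
    show "0 \<le> Y i j" using Y ij unfolding feasible_def by blast
    obtain k where "k \<in> users N" "q j = x k" using q_ex[OF j] by blast
    then show "0 \<le> f (q j) - f (x i)" using q_le[OF j ij] f[of k i] ij by simp
  qed
  ultimately show ?thesis using fair_gap[where x = x and f = f and q = q and Y = Y, OF net n fair f q_def] by linarith
qed

text \<open>The gap of a feasible allocation with the fair rates vanishes for every price function; the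
  strictly decreasing one below turns this into complementary slackness.\<close>

lemma fair_flow_of_rates:
  assumes net: "is_network N" and n: "\<forall>i\<in>users N. 0 < n i"
    and fair: "fair_flow N (\<lambda>i. n i * x i) x (\<lambda>i j. n i * X i j)"
    and Y: "feasible N n Y" "\<forall>i\<in>users N. total_rate N Y i = x i"
  shows "fair_flow N (\<lambda>i. n i * x i) x (\<lambda>i j. n i * Y i j)"
proof -
  define q where "q j = Min {x i | i. i \<in> users N \<and> j \<in> route N i}" for j
  define f :: "real \<Rightarrow> real" where "f y = exp (- y)" for y
  note q_le = min_rate_at_resource(2)[OF net q_def]
  define a where "a j = f (q j) * (cap N j - (\<Sum>i\<in>{i\<in>users N. j \<in> route N i}. n i * Y i j))" for j
  define b where "b i j = n i * (f (q j) - f (x i)) * Y i j" for i j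
  have Y0: "0 \<le> Y i j" if "i \<in> users N" "j \<in> route N i" for i j
    using Y that unfolding feasible_def by blast
  have a0: "0 \<le> a j" if j: "j \<in> used_resources N" for j
    using Y used_resources_subset[OF net] j unfolding feasible_def a_def f_def by auto
  have b0: "0 \<le> b i j" if ij: "i \<in> users N" "j \<in> route N i" for i j
  proof -
    have "j \<in> used_resources N" using ij unfolding used_resources_def by blast
    from q_le[OF this ij] show ?thesis using Y0[OF ij] n ij unfolding b_def f_def by (intro mult_nonneg_nonneg) (auto simp: less_imp_le)
  qed
  have fin: "finite (used_resources N)"
    using used_resources_subset[OF net] finite_network[OF net] finite_subset by blast
  have "(\<Sum>j\<in>used_resources N. a j) + (\<Sum>i\<in>users N. \<Sum>j\<in>route N i. b i j) = 0"
    using fair_gap[where x = x and f = f and q = q and Y = Y, OF net n fair _ q_def] Y(2)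
    unfolding a_def b_def by (simp add: f_def)
  moreover have "0 \<le> (\<Sum>j\<in>used_resources N. a j)" using a0 by (rule sum_nonneg)
  moreover have "0 \<le> (\<Sum>i\<in>users N. \<Sum>j\<in>route N i. b i j)" using b0 by (intro sum_nonneg)
  ultimately have "(\<Sum>j\<in>used_resources N. a j) = 0" "(\<Sum>i\<in>users N. \<Sum>j\<in>route N i. b i j) = 0"
    by linarith+
  then have a: "\<forall>j\<in>used_resources N. a j = 0" and b: "\<forall>i\<in>users N. \<forall>j\<in>route N i. b i j = 0"
    using a0 b0 fin finite_network[OF net] by (simp_all add: sum_nonneg_eq_0_iff sum_nonneg)
  have "x i \<le> x k" if ij: "i \<in> users N" "j \<in> route N i" "0 < n i * Y i j" and k: "k \<in> users N" "j \<in> route N k"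
    for i j k
  proof -
    have "j \<in> used_resources N" using ij unfolding used_resources_def by blast
    moreover have "b i j = 0" using b ij by blast
    then have "q j = x i" using ij unfolding b_def f_def by auto
    ultimately show ?thesis using q_le k by metis
  qed
  moreover have "(\<Sum>j\<in>route N i. n i * Y i j) = n i * x i" if "i \<in> users N" for i
    using Y(2) that by (auto simp: total_rate_def sum_distrib_left[symmetric])
  moreover have "0 \<le> n i * Y i j" if "i \<in> users N" "j \<in> route N i" for i j
    using Y0 n that by (simp add: less_imp_le)
  ultimately show ?thesis using a unfolding fair_flow_def a_def f_def by auto
qed

text \<open>The objective lies below the sum \<open>T\<close> of its tangents at the fair rates, and
  by the price bound \<open>T\<close> never exceeds its value there. Strictness of the tangents
  excludes all other rates.\<close>

lemma optimal_iff_fair_rates: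
  assumes net: "is_network N" and U: "is_utility U"
    and n: "\<forall>i\<in>users N. 0 < n i" and x0: "\<forall>i\<in>users N. 0 < x i"
    and fair: "fair_flow N (\<lambda>i. n i * x i) x (\<lambda>i j. n i * X i j)"
  shows "optimal N U n Y \<longleftrightarrow> feasible N n Y \<and> (\<forall>i\<in>users N. total_rate N Y i = x i)"
proof -
  obtain u D where u: "\<And>x. 0 < x \<Longrightarrow> U x = ereal (u x)"
    and D0: "\<And>x. 0 < x \<Longrightarrow> 0 \<le> D x"
    and anti: "\<And>x y. 0 < x \<Longrightarrow> x \<le> y \<Longrightarrow> D y \<le> D x"
    and tangent: "\<And>x y. 0 < x \<Longrightarrow> 0 \<le> y \<Longrightarrow> y \<noteq> x \<Longrightarrow> U y < ereal (u x + D x * (y - x))"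
    using utility_tangents[OF U] by blast
  define T where "T y i = n i * (u (x i) + D (x i) * (y i - x i))" for y i
  define V where "V = (\<Sum>i\<in>users N. n i * u (x i))"
  note fin = finite_network(1)[OF net]
  have obj_fair: "objective N U n Y = ereal V" if "\<forall>i\<in>users N. total_rate N Y i = x i" for Y
    using that u x0 by (simp add: objective_def V_def)
  have T_le: "(\<Sum>i\<in>users N. T (total_rate N Y) i) \<le> V" if "feasible N n Y" for Y
  proof -
    have "(\<Sum>i\<in>users N. T (total_rate N Y) i) = V +
        ((\<Sum>i\<in>users N. n i * D (x i) * total_rate N Y i) - (\<Sum>i\<in>users N. n i * D (x i) * x i))"
      by (simp add: T_def V_def algebra_simps sum.distrib sum_subtractf)
    then show ?thesis
      using feasible_price_sum_le[where x = x and f = D and Y = Y, OF net n fair] that D0 anti x0 by simp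
  qed
  have y0: "0 \<le> total_rate N Y i" if "feasible N n Y" "i \<in> users N" for Y i
    using that by (auto simp: feasible_def total_rate_def intro: sum_nonneg)
  have value_le: "ereal (n i) * U (total_rate N Y i) \<le> ereal (T (total_rate N Y) i)"
    and value_less: "total_rate N Y i \<noteq> x i \<Longrightarrow>
      ereal (n i) * U (total_rate N Y i) < ereal (T (total_rate N Y) i)"
    if Y: "feasible N n Y" and i: "i \<in> users N" for Y i
  proof -
    let ?y = "total_rate N Y i"
    have n0: "0 < n i" and xi: "0 < x i" using n x0 i by auto
    show *: "ereal (n i) * U ?y < ereal (T (total_rate N Y) i)" if "?y \<noteq> x i"
    proof -
      have "U ?y < ereal (u (x i) + D (x i) * (?y - x i))"
        using tangent[OF xi y0[OF Y i] that] .
      then have "ereal (n i) * U ?y < ereal (n i) * ereal (u (x i) + D (x i) * (?y - x i))"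
        using n0 by (intro ereal_mult_strict_left_mono) auto
      then show ?thesis by (simp add: T_def)
    qed
    show "ereal (n i) * U ?y \<le> ereal (T (total_rate N Y) i)"
      using * u[OF xi] by (cases "?y = x i") (auto simp: T_def less_imp_le)
  qed
  have obj_le: "objective N U n Y \<le> ereal V" if "feasible N n Y" for Y
  proof -
    have "objective N U n Y \<le> (\<Sum>i\<in>users N. ereal (T (total_rate N Y) i))"
      unfolding objective_def using value_le that by (intro sum_mono) auto
    also have "\<dots> \<le> ereal V" using T_le[OF that] by simp
    finally show ?thesis .
  qed
  have rates: "total_rate N Y i = x i"
    if Y: "feasible N n Y" and V: "ereal V \<le> objective N U n Y" and i: "i \<in> users N" for Y i
  proof (rule ccontr)
    assume ne: "total_rate N Y i \<noteq> x i"
    \<comment> \<open>Utilities may be \<open>-\<infinity>\<close>, so strictness of one summand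
      does not pass to the sum by itself. It does after the other summands are replaced by their
      finite tangent bounds.\<close>
    let ?R = "users N - {i}" and ?t = "T (total_rate N Y)"
    have "objective N U n Y = ereal (n i) * U (total_rate N Y i) + (\<Sum>i\<in>?R. ereal (n i) * U (total_rate N Y i))"
      unfolding objective_def using fin i by (simp add: sum.remove)
    also have "\<dots> \<le> ereal (n i) * U (total_rate N Y i) + ereal (\<Sum>i\<in>?R. ?t i)"
      unfolding sum_ereal[symmetric] using value_le[OF Y] by (intro add_left_mono sum_mono) auto
    also have "\<dots> < ereal (?t i) + ereal (\<Sum>i\<in>?R. ?t i)"
      using ereal_less_add[OF _ value_less[OF Y i ne], of "ereal (\<Sum>i\<in>?R. ?t i)"]
      by (simp add: add.commute)
    also have "\<dots> = ereal (\<Sum>i\<in>users N. ?t i)" using fin i by (simp add: sum.remove)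
    also have "\<dots> \<le> ereal V" using T_le[OF Y] by simp
    finally show False using V by simp
  qed
  have X: "feasible N n X" "\<forall>i\<in>users N. total_rate N X i = x i"
    using fair_feasible[OF net n fair] fair_total_rate[OF n fair] by auto
  show ?thesis
    using X obj_fair obj_le rates unfolding optimal_def by metis
qed

lemma opt_rate_fair:
  assumes net: "is_network N" and U: "is_utility U"
    and n: "\<forall>i\<in>users N. 0 < n i" and x0: "\<forall>i\<in>users N. 0 < x i"
    and fair: "fair_flow N (\<lambda>i. n i * x i) x (\<lambda>i j. n i * X i j)"
    and i: "i \<in> users N"
  shows "opt_rate N U n i = x i"
proof -
  note opt = optimal_iff_fair_rates[OF net U n x0 fair]
  have X: "optimal N U n X"
    unfolding opt using fair_feasible[OF net n fair] fair_total_rate[OF n fair] by blast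
  have "opt_rate N U n = restrict x (users N)"
    unfolding opt_rate_def
  proof (rule the_equality)
    show "restrict x (users N) \<in> extensional (users N) \<and>
        (\<exists>X. optimal N U n X \<and> (\<forall>i\<in>users N. restrict x (users N) i = total_rate N X i))"
      using X opt[of X] by auto
  next
    fix y assume "y \<in> extensional (users N) \<and> (\<exists>X. optimal N U n X \<and> (\<forall>i\<in>users N. y i = total_rate N X i))"
    then show "y = restrict x (users N)"
      using opt by (auto intro!: extensionalityI[of _ "users N"])
  qed
  then show ?thesis using i by simp
qed

subsection \<open>Slack and the ratios of the algorithm\<close>

definition slack :: "'j network \<Rightarrow> (nat \<Rightarrow> real) \<Rightarrow> 'j set \<Rightarrow> real" where
  "slack M d J' = capacity M J' - (\<Sum>i\<in>users_within M J'. d i)"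

text \<open>All nonempty sets are included, since a set of the reduced network corresponds to its
  union with the removed resources, which need not be strongly connected.\<close>

definition stable_load :: "'j network \<Rightarrow> (nat \<Rightarrow> real) \<Rightarrow> bool" where
  "stable_load M d \<longleftrightarrow> (\<forall>J'\<subseteq>resources M. J' \<noteq> {} \<longrightarrow> 0 < slack M d J')"

definition without :: "'j network \<Rightarrow> 'j set \<Rightarrow> 'j network" where
  "without M R = M\<lparr>users := users M - users_within M R, resources := resources M - R,
     route := (\<lambda>i. route M i - R)\<rparr>"

lemma without_simps [simp]:
  "users (without M R) = users M - users_within M R"
  "resources (without M R) = resources M - R"
  "route (without M R) i = route M i - R"
  "cap (without M R) = cap M"
  by (simp_all add: without_def)

lemma without_network: "is_network M \<Longrightarrow> is_network (without M R)"
  unfolding is_network_def by (auto simp: users_within_def)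

lemma finite_users_within: "is_network M \<Longrightarrow> finite (users_within M J')"
  by (simp add: finite_network(1) users_within_def)

lemma users_within_disjoint:
  assumes "is_network M" "A \<inter> B = {}"
  shows "users_within M A \<inter> users_within M B = {}"
  using assms route_network(2)[OF assms(1)] unfolding users_within_def by blast

lemma slack_split:
  assumes net: "is_network M" and "A \<inter> B = {}" "A \<union> B \<subseteq> resources M"
    and "users_within M (A \<union> B) = users_within M A \<union> users_within M B"
  shows "slack M d (A \<union> B) = slack M d A + slack M d B"
proof -
  have "finite A" "finite B" using assms finite_network(2)[OF net] finite_subset by blast+
  then show ?thesis
    using assms users_within_disjoint[OF net, of A B] finite_users_within[OF net]
    by (simp add: slack_def capacity_def sum.union_disjoint)
qed

text \<open>Capacity is modular, while a user confined to the union may be confined to neither set;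
  its demand counts only on the left.\<close>

lemma slack_Un_Int_le:
  assumes net: "is_network M" and "A \<subseteq> resources M" "B \<subseteq> resources M"
    and d: "\<forall>i\<in>users M. 0 \<le> d i"
  shows "slack M d (A \<union> B) + slack M d (A \<inter> B) \<le> slack M d A + slack M d B"
proof -
  have fin: "finite A" "finite B" using assms finite_network(2)[OF net] finite_subset by blast+
  let ?W = "users_within M"
  have "sum d (?W A) + sum d (?W B) = sum d (?W A \<union> ?W B) + sum d (?W A \<inter> ?W B)"
    using finite_users_within[OF net] by (simp add: sum.union_inter)
  also have "?W A \<inter> ?W B = ?W (A \<inter> B)" unfolding users_within_def by blast
  also have "sum d (?W A \<union> ?W B) \<le> sum d (?W (A \<union> B))"
    using d by (intro sum_mono2 finite_users_within[OF net]) (auto simp: users_within_def)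
  finally show ?thesis
    using sum.union_inter[OF fin, of "cap M"] by (simp add: slack_def capacity_def)
qed

text \<open>Users confined to \<open>J' \<union> R\<close> either were removed with \<open>R\<close>
  or are confined to \<open>J'\<close> afterwards.\<close>

lemma slack_without:
  assumes net: "is_network M" and "R \<subseteq> resources M" "J' \<subseteq> resources M - R"
  shows "slack (without M R) d J' = slack M d (J' \<union> R) - slack M d R"
proof -
  have fin: "finite R" "finite J'" using assms finite_network(2)[OF net] finite_subset by blast+
  have W: "users_within M (J' \<union> R) = users_within (without M R) J' \<union> users_within M R"
  proof (rule set_eqI)
    fix i
    have "route M i \<subseteq> J' \<union> R \<longleftrightarrow> route M i - R \<subseteq> J'" by blast
    moreover have "route M i \<subseteq> J' \<union> R" if "route M i \<subseteq> R" using that by blast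
    ultimately show "i \<in> users_within M (J' \<union> R) \<longleftrightarrow>
        i \<in> users_within (without M R) J' \<union> users_within M R"
      unfolding users_within_def without_simps by blast
  qed
  have "sum d (users_within M (J' \<union> R)) =
      sum d (users_within (without M R) J') + sum d (users_within M R)"
    unfolding W using finite_users_within[OF net] finite_users_within[OF without_network[OF net]]
    by (intro sum.union_disjoint) (auto simp: users_within_def)
  moreover have "capacity M (J' \<union> R) = capacity M J' + capacity M R"
    unfolding capacity_def using fin assms by (intro sum.union_disjoint) auto
  ultimately show ?thesis by (simp add: slack_def capacity_def)
qed

lemma not_connected_pairE:
  assumes "\<not> connected_pair M I' J'"
  obtains A B I1 I2 where "A \<union> B = J'" "A \<inter> B = {}" "A \<noteq> {}" "B \<noteq> {}" "I1 \<union> I2 = I'" "I1 \<inter> I2 = {}"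
    "\<forall>i\<in>I1. route M i \<inter> B = {}" "\<forall>i\<in>I2. route M i \<inter> A = {}"
  using assms unfolding connected_pair_def not_not by (elim exE conjE) (rule that)

text \<open>A set that is not strongly connected splits into two parts such that each confined user
  belongs to one of them, and slack is additive over this split. Properties of slack thus pass from
  the sets inspected by the algorithm to all nonempty sets.\<close>

lemma strongly_connected_induct [consumes 3, case_names strongly_connected split]:
  assumes net: "is_network M" and "J' \<subseteq> resources M" "J' \<noteq> {}"
    and SC: "\<And>A. A \<in> strongly_connected_sets M \<Longrightarrow> P A"
    and split: "\<And>A B. A \<noteq> {} \<Longrightarrow> B \<noteq> {} \<Longrightarrow> A \<inter> B = {} \<Longrightarrow> A \<union> B \<subseteq> resources M \<Longrightarrow>
      users_within M (A \<union> B) = users_within M A \<union> users_within M B \<Longrightarrow> P A \<Longrightarrow> P B \<Longrightarrow> P (A \<union> B)"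
  shows "P J'"
proof -
  have "finite J'" using assms(2) finite_network(2)[OF net] finite_subset by blast
  then show ?thesis
    using assms(2,3)
  proof (induction J' rule: finite_psubset_induct)
    case (psubset J')
    show ?case
    proof (cases "J' \<in> strongly_connected_sets M")
      case False
      then have "\<not> connected_pair M (users_within M J') J'"
        using psubset.prems by (simp add: strongly_connected_sets_def)
      then obtain A B I1 I2 where AB: "A \<noteq> {}" "B \<noteq> {}" "A \<union> B = J'" "A \<inter> B = {}"
        and I12: "I1 \<union> I2 = users_within M J'"
          "\<forall>i\<in>I1. route M i \<inter> B = {}" "\<forall>i\<in>I2. route M i \<inter> A = {}"
        by (rule not_connected_pairE)
      have sub: "A \<subset> J'" "B \<subset> J'" using AB by blast+
      have "users_within M (A \<union> B) = users_within M A \<union> users_within M B"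
      proof
        show "users_within M (A \<union> B) \<subseteq> users_within M A \<union> users_within M B"
          using I12 AB(3) unfolding users_within_def by blast
      qed (auto simp: users_within_def)
      then have "P (A \<union> B)"
        using AB psubset.prems(1) by (intro split psubset.IH sub) auto
      then show ?thesis using AB(3) by simp
    qed (rule SC)
  qed
qed

lemma stable_if_strongly_connected:
  assumes net: "is_network M" and "\<And>A. A \<in> strongly_connected_sets M \<Longrightarrow> 0 < slack M d A"
  shows "stable_load M d"
  unfolding stable_load_def
proof (intro allI impI)
  fix J' assume "J' \<subseteq> resources M" "J' \<noteq> {}"
  with net show "0 < slack M d J'"
    by (induction J' rule: strongly_connected_induct) (auto simp: assms slack_split)
qed

section \<open>Demands as functions of the rate, and the ratios of the algorithm\<close>

locale peak_rates =
  fixes \<rho> r :: "nat \<Rightarrow> real" and m :: nat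
  assumes \<rho>_pos: "i \<in> {1..m} \<Longrightarrow> 0 < \<rho> i"
    and r_pos: "i \<in> {1..m} \<Longrightarrow> 0 < r i"
    and r_mono: "i \<in> {1..m} \<Longrightarrow> k \<in> {1..m} \<Longrightarrow> i \<le> k \<Longrightarrow> r i \<le> r k"
begin

text \<open>The resource that type \<open>i\<close> takes in equilibrium if its optimal rate is \<open>x\<close>: there are
  \<open>\<rho> i / min x (r i)\<close> flows, each with rate \<open>x\<close>.\<close>

definition demand :: "real \<Rightarrow> nat \<Rightarrow> real" where
  "demand x i = \<rho> i * max 1 (x / r i)"

definition admissible :: "'j network \<Rightarrow> bool" where
  "admissible M \<longleftrightarrow> is_network M \<and> users M \<subseteq> {1..m} \<and> stable_load M \<rho>"

lemma demand_pos: "i \<in> {1..m} \<Longrightarrow> 0 < demand x i"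
  unfolding demand_def using \<rho>_pos by (intro mult_pos_pos) auto

lemma demand_mono: "i \<in> {1..m} \<Longrightarrow> x \<le> y \<Longrightarrow> demand x i \<le> demand y i"
  unfolding demand_def using \<rho>_pos[of i] r_pos[of i]
  by (intro mult_left_mono max.mono divide_right_mono) auto

lemma demand_strict_mono: "i \<in> {1..m} \<Longrightarrow> x < y \<Longrightarrow> r i < y \<Longrightarrow> demand x i < demand y i"
  unfolding demand_def using \<rho>_pos[of i] r_pos[of i]
  by (intro mult_strict_left_mono) (auto simp: less_max_iff_disj divide_strict_right_mono)

lemma demand_slow:
  assumes "i \<in> {1..m}" "x \<le> r i"
  shows "demand x i = \<rho> i"
proof -
  have "x / r i \<le> 1" using r_pos[OF assms(1)] assms(2) by simp
  then show ?thesis by (simp add: demand_def max.absorb1)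
qed

lemma demand_fast:
  assumes "i \<in> {1..m}" "r i \<le> x"
  shows "demand x i = x * (\<rho> i / r i)"
proof -
  have "1 \<le> x / r i" using r_pos[OF assms(1)] assms(2) by simp
  then show ?thesis by (simp add: demand_def max.absorb2)
qed

lemma demand_ge:
  assumes "i \<in> {1..m}"
  shows "\<rho> i \<le> demand x i" "x * (\<rho> i / r i) \<le> demand x i"
proof -
  have "\<rho> i * y \<le> demand x i" if "y \<le> max 1 (x / r i)" for y
    unfolding demand_def using \<rho>_pos[OF assms] that by (intro mult_left_mono) auto
  from this[of 1] this[of "x / r i"] show "\<rho> i \<le> demand x i" "x * (\<rho> i / r i) \<le> demand x i"
    by (simp_all add: mult.commute)
qed

lemma slack_antimono:
  assumes "users M \<subseteq> {1..m}" "x \<le> y"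
  shows "slack M (demand y) J' \<le> slack M (demand x) J'"
proof -
  have "sum (demand x) (users_within M J') \<le> sum (demand y) (users_within M J')"
    using assms by (intro sum_mono demand_mono) (auto simp: users_within_def)
  then show ?thesis by (simp add: slack_def)
qed

text \<open>If no user were beyond its peak rate, the demands would be the intensities, for which
  stability leaves positive slack.\<close>

lemma ex_peak_less:
  assumes adm: "admissible M" and J': "J' \<subseteq> resources M" "J' \<noteq> {}"
    and le: "slack M (demand x) J' \<le> 0"
  shows "\<exists>i\<in>users_within M J'. r i < x"
proof (rule ccontr)
  assume neg: "\<not> ?thesis"
  have "demand x i = \<rho> i" if "i \<in> users_within M J'" for i
    using neg that adm by (intro demand_slow) (auto simp: admissible_def users_within_def)
  then have "slack M (demand x) J' = slack M \<rho> J'" by (simp add: slack_def)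
  moreover have "0 < slack M \<rho> J'" using adm J' unfolding admissible_def stable_load_def by blast
  ultimately show False using le by simp
qed

text \<open>Once the slack is used up, some user is on the linear branch of its demand, which then
  grows strictly.\<close>

lemma slack_strict_antimono:
  assumes adm: "admissible M" and J': "J' \<subseteq> resources M" "J' \<noteq> {}"
    and le: "slack M (demand x) J' \<le> 0" and xy: "x < y"
  shows "slack M (demand y) J' < slack M (demand x) J'"
proof -
  have um: "users_within M J' \<subseteq> {1..m}" using adm by (auto simp: admissible_def users_within_def)
  obtain i where i: "i \<in> users_within M J'" "r i < x" using ex_peak_less[OF adm J' le] by blast
  have "sum (demand x) (users_within M J') < sum (demand y) (users_within M J')"
  proof (rule sum_strict_mono_ex1)
    show "finite (users_within M J')" using adm by (auto simp: admissible_def finite_users_within)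
    show "\<forall>i\<in>users_within M J'. demand x i \<le> demand y i" using um less_imp_le[OF xy] demand_mono by blast
    show "\<exists>i\<in>users_within M J'. demand x i < demand y i"
      using i um xy by (intro bexI[of _ i] demand_strict_mono) auto
  qed
  then show ?thesis by (simp add: slack_def)
qed

lemma tight_rate_unique:
  assumes "admissible M" "J' \<subseteq> resources M" "J' \<noteq> {}" "slack M (demand x) J' = 0"
    and "0 \<le> slack M (demand y) J'"
  shows "y \<le> x"
  using slack_strict_antimono[OF assms(1-3), of x y] assms(4,5) by force

lemma sum_split_threshold:
  fixes f g :: "nat \<Rightarrow> real"
  assumes "finite I"
  shows "(\<Sum>i\<in>I. if i > s then f i else x * g i) =
    (\<Sum>i\<in>{i\<in>I. i > s}. f i) + x * (\<Sum>i\<in>{i\<in>I. i \<le> s}. g i)"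
proof -
  have "I \<inter> {i. i > s} = {i\<in>I. i > s}" "I \<inter> - {i. i > s} = {i\<in>I. i \<le> s}" by auto
  then show ?thesis using assms by (simp add: sum.If_cases sum_distrib_left)
qed

text \<open>A demand is a maximum of two terms. Splitting the labels at \<open>s\<close> picks one
  of them for each user and can only underestimate the demand.\<close>

lemma slack_le_threshold:
  assumes adm: "admissible M"
  shows "slack M (demand x) J' \<le> capacity M J' - (\<Sum>i\<in>{i\<in>users_within M J'. i > s}. \<rho> i) -
    x * (\<Sum>i\<in>{i\<in>users_within M J'. i \<le> s}. \<rho> i / r i)"
proof -
  have "(\<Sum>i\<in>users_within M J'. if i > s then \<rho> i else x * (\<rho> i / r i)) \<le>
      (\<Sum>i\<in>users_within M J'. demand x i)"
  proof (rule sum_mono)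
    fix i assume "i \<in> users_within M J'"
    then have "i \<in> {1..m}" using adm by (auto simp: admissible_def users_within_def)
    then show "(if i > s then \<rho> i else x * (\<rho> i / r i)) \<le> demand x i"
      using demand_ge[of i x] by presburger
  qed
  then show ?thesis
    using adm finite_users_within[of M J'] by (simp add: slack_def sum_split_threshold admissible_def)
qed

lemma slack_eq_threshold:
  assumes adm: "admissible M" and s: "\<forall>i\<in>{1..m}. i \<le> s \<longleftrightarrow> r i < x"
  shows "slack M (demand x) J' = capacity M J' - (\<Sum>i\<in>{i\<in>users_within M J'. i > s}. \<rho> i) -
    x * (\<Sum>i\<in>{i\<in>users_within M J'. i \<le> s}. \<rho> i / r i)"
proof -
  have "(\<Sum>i\<in>users_within M J'. if i > s then \<rho> i else x * (\<rho> i / r i)) =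
      (\<Sum>i\<in>users_within M J'. demand x i)"
  proof (intro sum.cong refl)
    fix i assume "i \<in> users_within M J'"
    then have i: "i \<in> {1..m}" using adm by (auto simp: admissible_def users_within_def)
    then have "i \<le> s \<longleftrightarrow> r i < x" using s by blast
    then show "(if i > s then \<rho> i else x * (\<rho> i / r i)) = demand x i"
      using demand_slow[OF i, of x] demand_fast[OF i, of x] by auto
  qed
  then show ?thesis
    using adm finite_users_within[of M J'] by (simp add: slack_def sum_split_threshold admissible_def)
qed

text \<open>The user below \<open>x\<close> ensures that the threshold is at least 1, as
  \<open>0\<close> is outside the range of the algorithm.\<close>

lemma ex_threshold:
  assumes i: "i \<in> {1..m}" "r i < x"
  obtains s where "s \<in> {1..m}" "\<forall>i\<in>{1..m}. i \<le> s \<longleftrightarrow> r i < x"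
proof
  let ?S = "{i\<in>{1..m}. r i < x}"
  have fin: "finite ?S" and ne: "?S \<noteq> {}" using i by auto
  show *: "Max ?S \<in> {1..m}" using Max_in[OF fin ne] by simp
  have M: "r (Max ?S) < x" using Max_in[OF fin ne] by simp
  show "\<forall>i\<in>{1..m}. i \<le> Max ?S \<longleftrightarrow> r i < x"
  proof (intro ballI iffI)
    fix i assume "i \<in> {1..m}" "i \<le> Max ?S"
    then show "r i < x" using r_mono[OF _ *, of i] M by simp
  next
    fix i assume "i \<in> {1..m}" "r i < x"
    then show "i \<le> Max ?S" using fin by (intro Max_ge) auto
  qed
qed

lemma threshold_sum_nonneg:
  assumes "admissible M"
  shows "0 \<le> (\<Sum>i\<in>{i\<in>users_within M J'. i \<le> s}. \<rho> i / r i)"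
proof (rule sum_nonneg)
  fix i assume "i \<in> {i\<in>users_within M J'. i \<le> s}"
  then have "i \<in> {1..m}" using assms by (auto simp: admissible_def users_within_def)
  then show "0 \<le> \<rho> i / r i" using \<rho>_pos r_pos by (simp add: less_imp_le)
qed

lemma threshold_sum_pos:
  assumes "admissible M" "i \<in> users_within M J'" "i \<le> s"
  shows "0 < (\<Sum>i\<in>{i\<in>users_within M J'. i \<le> s}. \<rho> i / r i)"
proof (rule sum_pos)
  show "finite {i\<in>users_within M J'. i \<le> s}"
    using assms by (simp add: admissible_def finite_users_within)
  fix i assume "i \<in> {i\<in>users_within M J'. i \<le> s}"
  then have "i \<in> {1..m}" using assms by (auto simp: admissible_def users_within_def)
  then show "0 < \<rho> i / r i" using \<rho>_pos r_pos by simp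
qed (use assms in auto)

text \<open>A zero denominator means that all confined users have labels above \<open>s\<close>. The
  numerator is then the slack of the intensities; its positive sign selects
  \<open>\<infinity>\<close> in the division on \<open>ereal\<close>.\<close>

lemma level_ratio_eq_infinity:
  assumes adm: "admissible M" and J': "J' \<subseteq> resources M" "J' \<noteq> {}"
    and den: "(\<Sum>i\<in>{i\<in>users_within M J'. i \<le> s}. \<rho> i / r i) = 0"
  shows "level_ratio \<rho> r M s J' = \<infinity>"
proof -
  have "\<forall>i\<in>users_within M J'. i > s"
    using threshold_sum_pos[OF adm, of _ J' s] den by fastforce
  then have "{i\<in>users_within M J'. i > s} = users_within M J'" by auto
  moreover have "0 < slack M \<rho> J'" using adm J' unfolding admissible_def stable_load_def by blast
  ultimately show ?thesis
    using den by (simp add: level_ratio_def slack_def)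
qed

lemma level_ratio_not_MInfty:
  assumes "admissible M" "J' \<subseteq> resources M" "J' \<noteq> {}"
  shows "level_ratio \<rho> r M s J' \<noteq> -\<infinity>"
  using level_ratio_eq_infinity[OF assms, of s]
  by (cases "(\<Sum>i\<in>{i\<in>users_within M J'. i \<le> s}. \<rho> i / r i) = 0") (auto simp: level_ratio_def)

lemma slack_le_if_level_ratio_le:
  assumes adm: "admissible M" and J': "J' \<subseteq> resources M" "J' \<noteq> {}"
    and le: "level_ratio \<rho> r M s J' \<le> ereal x"
  shows "slack M (demand x) J' \<le> 0"
proof -
  let ?den = "\<Sum>i\<in>{i\<in>users_within M J'. i \<le> s}. \<rho> i / r i"
  have "?den \<noteq> 0" using level_ratio_eq_infinity[OF adm J'] le by force
  then have den: "0 < ?den" using threshold_sum_nonneg[OF adm, of J' s] by linarith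
  then have "(capacity M J' - (\<Sum>i\<in>{i\<in>users_within M J'. i > s}. \<rho> i)) / ?den \<le> x"
    using le by (simp add: level_ratio_def)
  then have "capacity M J' - (\<Sum>i\<in>{i\<in>users_within M J'. i > s}. \<rho> i) \<le> x * ?den"
    using den by (simp add: pos_divide_le_eq)
  then show ?thesis using slack_le_threshold[OF adm, of x J' s] by linarith
qed

text \<open>At the threshold of \<open>x\<close> the split of the demands is exact. Together with
  \<open>slack_le_if_level_ratio_le\<close>, some ratio of \<open>J'\<close> is at most
  \<open>x\<close> iff its slack at \<open>x\<close> is at most 0.\<close>

lemma ex_level_ratio_le:
  assumes adm: "admissible M" and J': "J' \<subseteq> resources M" "J' \<noteq> {}"
    and le: "slack M (demand x) J' \<le> 0"
  obtains s where "s \<in> {1..m}" "level_ratio \<rho> r M s J' \<le> ereal x"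
    "slack M (demand x) J' < 0 \<Longrightarrow> level_ratio \<rho> r M s J' < ereal x"
proof -
  obtain i where i: "i \<in> users_within M J'" "r i < x" using ex_peak_less[OF adm J' le] by blast
  then have im: "i \<in> {1..m}" using adm by (auto simp: admissible_def users_within_def)
  obtain s where s: "s \<in> {1..m}" "\<forall>i\<in>{1..m}. i \<le> s \<longleftrightarrow> r i < x"
    using ex_threshold[OF im i(2)] .
  let ?num = "capacity M J' - (\<Sum>i\<in>{i\<in>users_within M J'. i > s}. \<rho> i)"
  let ?den = "\<Sum>i\<in>{i\<in>users_within M J'. i \<le> s}. \<rho> i / r i"
  have den: "0 < ?den" using i im s by (intro threshold_sum_pos[OF adm]) auto
  then have lr: "level_ratio \<rho> r M s J' = ereal (?num / ?den)" by (simp add: level_ratio_def)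
  have eq: "slack M (demand x) J' = ?num - x * ?den" by (rule slack_eq_threshold[OF adm s(2)])
  show thesis
  proof (rule that[OF s(1)])
    show "level_ratio \<rho> r M s J' \<le> ereal x"
      unfolding lr using eq le den by (simp add: pos_divide_le_eq)
    show "level_ratio \<rho> r M s J' < ereal x" if "slack M (demand x) J' < 0"
      unfolding lr using eq that den by (simp add: pos_divide_less_eq)
  qed
qed

definition ratios :: "'j network \<Rightarrow> ereal set" where
  "ratios M = {level_ratio \<rho> r M s J' | s J'. s \<in> {1..m} \<and> J' \<in> strongly_connected_sets M}"

lemma min_ratio_alt: "min_ratio \<rho> r m M = Min (ratios M)"
  by (simp add: min_ratio_def ratios_def)

lemma finite_ratios:
  assumes "is_network M"
  shows "finite (ratios M)"
proof -
  have "finite (strongly_connected_sets M)"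
    using finite_network(2)[OF assms] by (simp add: strongly_connected_sets_def)
  moreover have "ratios M = (\<lambda>(s, J'). level_ratio \<rho> r M s J') ` ({1..m} \<times> strongly_connected_sets M)"
    unfolding ratios_def by auto blast
  ultimately show ?thesis by simp
qed

lemma strongly_connectedD:
  "J' \<in> strongly_connected_sets M \<Longrightarrow> J' \<subseteq> resources M \<and> J' \<noteq> {}"
  by (simp add: strongly_connected_sets_def)

lemma min_ratio_le:
  assumes "is_network M" "J' \<in> strongly_connected_sets M" "s \<in> {1..m}"
  shows "min_ratio \<rho> r m M \<le> level_ratio \<rho> r M s J'"
  unfolding min_ratio_alt using assms finite_ratios by (intro Min_le) (auto simp: ratios_def)

lemma min_ratio_attained:
  assumes net: "is_network M" and "resources M \<noteq> {}" "1 \<le> m"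
  obtains s J' where "s \<in> {1..m}" "J' \<in> strongly_connected_sets M"
    "level_ratio \<rho> r M s J' = min_ratio \<rho> r m M"
proof -
  have "\<exists>J'. J' \<in> strongly_connected_sets M"
    using net order.refl assms(2) by (rule strongly_connected_induct) auto
  then have "ratios M \<noteq> {}" using assms(3) unfolding ratios_def by fastforce
  then have "min_ratio \<rho> r m M \<in> ratios M"
    unfolding min_ratio_alt using finite_ratios[OF net] by (intro Min_in)
  then show thesis using that unfolding ratios_def by auto
qed

end

subsection \<open>The largest tight set\<close>

definition generic_load :: "'j network \<Rightarrow> (nat \<Rightarrow> real) \<Rightarrow> bool" where
  "generic_load M d \<longleftrightarrow> (\<forall>J'\<in>connected_sets M. \<forall>I'. users_within M J' \<subset> I' \<and> I' \<subseteq> users_meeting M J' \<longrightarrow>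
     (\<Sum>i\<in>I'. d i) \<noteq> capacity M J')"

lemma generic_loadD:
  "generic_load M d \<Longrightarrow> J' \<in> connected_sets M \<Longrightarrow> users_within M J' \<subset> I' \<Longrightarrow>
    I' \<subseteq> users_meeting M J' \<Longrightarrow> (\<Sum>i\<in>I'. d i) \<noteq> capacity M J'"
  by (simp add: generic_load_def)

text \<open>The reduction creates no new connected sets among the remaining resources; it can only
  add confined users and remove meeting ones, so the range of \<open>I'\<close> shrinks.\<close>

lemma generic_load_without:
  assumes net: "is_network M" and gen: "generic_load M d"
  shows "generic_load (without M R) d"
  unfolding generic_load_def
proof (intro ballI allI impI)
  fix J' I' assume J': "J' \<in> connected_sets (without M R)"
    and I': "users_within (without M R) J' \<subset> I' \<and> I' \<subseteq> users_meeting (without M R) J'"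
  have sub: "J' \<subseteq> resources M" "J' \<noteq> {}" "J' \<inter> R = {}"
    using J' unfolding connected_sets_def by auto
  have "connected_pair M (users M) J'"
  proof (rule ccontr)
    assume "\<not> ?thesis"
    then obtain A B I1 I2 where AB: "A \<union> B = J'" "A \<inter> B = {}" "A \<noteq> {}" "B \<noteq> {}"
      and I12: "I1 \<union> I2 = users M" "I1 \<inter> I2 = {}"
        "\<forall>i\<in>I1. route M i \<inter> B = {}" "\<forall>i\<in>I2. route M i \<inter> A = {}"
      by (rule not_connected_pairE)
    have "\<not> connected_pair (without M R) (users (without M R)) J'"
      unfolding connected_pair_def not_not
    proof (intro exI conjI)
      show "(I1 - users_within M R) \<union> (I2 - users_within M R) = users (without M R)"
        using I12(1) by auto
    qed (use AB I12 in auto)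
    then show False using J' unfolding connected_sets_def by blast
  qed
  then have "J' \<in> connected_sets M" using sub unfolding connected_sets_def by blast
  moreover have "users_within M J' \<subseteq> users_within (without M R) J'"
  proof
    fix i assume i: "i \<in> users_within M J'"
    then have "\<not> route M i \<subseteq> R"
      using route_network(2)[OF net, of i] sub(3) unfolding users_within_def by blast
    then show "i \<in> users_within (without M R) J'"
      using i unfolding users_within_def without_simps by blast
  qed
  moreover have "users_meeting (without M R) J' \<subseteq> users_meeting M J'"
    unfolding users_meeting_def by auto
  ultimately have "J' \<in> connected_sets M" "users_within M J' \<subset> I'" "I' \<subseteq> users_meeting M J'"
    using I' by (simp, meson subset_psubset_trans, meson subset_trans)
  then have "sum d I' \<noteq> capacity M J'" by (rule generic_loadD[OF gen])
  then show "sum d I' \<noteq> capacity (without M R) J'" by (simp add: capacity_def)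
qed

text \<open>This extends genericity to disconnected sets \<open>K\<close>. If \<open>K\<close>
  splits, the bounds on the subsets prevent an excess on one part from compensating a deficit on the
  other; balance on \<open>K\<close> would mean balance on both parts. When only confined users are
  present, stability replaces genericity.\<close>

lemma generic_load_unbalanced:
  assumes net: "is_network M" and stab: "stable_load M d" and gen: "generic_load M d"
    and "K \<subseteq> resources M" "K \<noteq> {}" "users_within M K \<subseteq> I" "I \<subseteq> users_meeting M K"
    and "\<And>L. L \<subseteq> K \<Longrightarrow> (\<Sum>i\<in>{i\<in>I. route M i \<inter> K \<subseteq> L}. d i) \<le> capacity M L"
  shows "sum d I \<noteq> capacity M K"
proof -
  have "finite K" using assms(4) finite_network(2)[OF net] finite_subset by blast
  then show ?thesis
    using assms(4-8)
  proof (induction K arbitrary: I rule: finite_psubset_induct)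
    case (psubset K)
    note K = psubset.prems
    show ?case
    proof (cases "K \<in> connected_sets M")
      case True
      show ?thesis
      proof (cases "I = users_within M K")
        case True
        moreover have "0 < slack M d K" using stab K(1,2) by (simp add: stable_load_def)
        ultimately show ?thesis by (simp add: slack_def)
      next
        case False
        then have "users_within M K \<subset> I" using K(3) by blast
        then show ?thesis by (rule generic_loadD[OF gen \<open>K \<in> connected_sets M\<close> _ K(4)])
      qed
    next
      case False
      then have "\<not> connected_pair M (users M) K"
        using K(1,2) by (simp add: connected_sets_def)
      then obtain A B I1 I2 where AB: "A \<union> B = K" "A \<inter> B = {}" "A \<noteq> {}" "B \<noteq> {}"
        and I12: "I1 \<union> I2 = users M" "I1 \<inter> I2 = {}"
          "\<forall>i\<in>I1. route M i \<inter> B = {}" "\<forall>i\<in>I2. route M i \<inter> A = {}"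
        by (rule not_connected_pairE)
      define IA where "IA = {i\<in>I. route M i \<inter> A \<noteq> {}}"
      define IB where "IB = {i\<in>I. route M i \<inter> K \<subseteq> B}"
      have I_users: "I \<subseteq> users M" using K(4) unfolding users_meeting_def by blast
      have dich: "route M i \<inter> A = {} \<or> route M i \<inter> B = {}" if "i \<in> I" for i
        using that I_users I12 by blast
      have finI: "finite I" using I_users finite_network(1)[OF net] finite_subset by blast
      have IAB: "I = IA \<union> IB" "IA \<inter> IB = {}"
        using AB unfolding IA_def IB_def by blast+
      have IA: "i \<in> IA \<longleftrightarrow> i \<in> I \<and> route M i \<inter> K \<subseteq> A" for i
      proof
        assume "i \<in> IA"
        then show "i \<in> I \<and> route M i \<inter> K \<subseteq> A" using dich AB unfolding IA_def by blast
      next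
        assume i: "i \<in> I \<and> route M i \<inter> K \<subseteq> A"
        then show "i \<in> IA" using K(4) AB unfolding IA_def users_meeting_def by blast
      qed
      have "sum d IB \<le> capacity M B" using K(5)[of B] AB(1) unfolding IB_def by blast
      moreover have "sum d IA \<noteq> capacity M A"
      proof (rule psubset.IH)
        show "A \<subset> K" using AB by blast
        show "users_within M A \<subseteq> IA"
          using K(3) AB route_network(2)[OF net] unfolding users_within_def IA_def by blast
        show "IA \<subseteq> users_meeting M A" using I_users unfolding IA_def users_meeting_def by blast
        fix L assume L: "L \<subseteq> A"
        have "{i\<in>IA. route M i \<inter> A \<subseteq> L} = {i\<in>I. route M i \<inter> K \<subseteq> L}"
          using IA L AB by blast
        then show "(\<Sum>i\<in>{i\<in>IA. route M i \<inter> A \<subseteq> L}. d i) \<le> capacity M L"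
          using K(5)[of L] L AB by auto
      qed (use K(1) AB in auto)
      moreover have "sum d IA \<le> capacity M A"
      proof -
        have "IA = {i\<in>I. route M i \<inter> K \<subseteq> A}" using IA by blast
        then show ?thesis using K(5)[of A] AB(1) by blast
      qed
      moreover have "sum d I = sum d IA + sum d IB"
        using IAB finI by (metis finite_Un sum.union_disjoint)
      moreover have "capacity M K = capacity M A + capacity M B"
        using AB psubset.hyps unfolding capacity_def by (metis finite_Un sum.union_disjoint)
      ultimately show ?thesis by linarith
    qed
  qed
qed

lemma sum_demand_le_capacity:
  assumes net: "is_network M" and fair: "fair_flow M d x Z" and L: "L \<subseteq> resources M"
    and I: "I \<subseteq> users M" "\<And>i j. i \<in> I \<Longrightarrow> j \<in> route M i \<Longrightarrow> j \<notin> L \<Longrightarrow> Z i j = 0"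
  shows "sum d I \<le> capacity M L"
proof -
  have "(\<Sum>j\<in>route M i \<inter> L. Z i j) = d i" if "i \<in> I" for i
  proof -
    have "(\<Sum>j\<in>route M i \<inter> L. Z i j) = (\<Sum>j\<in>route M i. Z i j)"
      using that I finite_network(3)[OF net, of i] by (intro sum.mono_neutral_left) auto
    then show ?thesis using fair that I(1) unfolding fair_flow_def by auto
  qed
  then have "sum d I = (\<Sum>i\<in>I. \<Sum>j\<in>route M i \<inter> L. Z i j)" by simp
  also have "\<dots> = (\<Sum>j\<in>resources M \<inter> L. \<Sum>i\<in>{i\<in>I. j \<in> route M i}. Z i j)"
    by (rule sum_users_routes[OF net I(1)])
  also have "\<dots> \<le> (\<Sum>j\<in>resources M \<inter> L. cap M j)"
  proof (rule sum_mono)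
    fix j assume j: "j \<in> resources M \<inter> L"
    have "(\<Sum>i\<in>{i\<in>I. j \<in> route M i}. Z i j) \<le> (\<Sum>i\<in>{i\<in>users M. j \<in> route M i}. Z i j)"
      using I(1) fair finite_network(1)[OF net] unfolding fair_flow_def by (intro sum_mono2) auto
    also have "\<dots> \<le> cap M j"
      using fair j unfolding fair_flow_def by (intro column_sum_le_cap[OF net]) auto
    finally show "(\<Sum>i\<in>{i\<in>I. j \<in> route M i}. Z i j) \<le> cap M j" .
  qed
  also have "resources M \<inter> L = L" using L by blast
  finally show ?thesis by (simp add: capacity_def)
qed

lemma fair_flow_without:
  assumes net: "is_network M" and fair: "fair_flow M d x Z"
    and zero: "\<And>i j. i \<in> users M - users_within M R \<Longrightarrow> j \<in> route M i \<inter> R \<Longrightarrow> Z i j = 0"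
  shows "fair_flow (without M R) d x Z"
proof -
  have rows: "(\<Sum>j\<in>route M i - R. Z i j) = d i" if "i \<in> users M - users_within M R" for i
  proof -
    have "(\<Sum>j\<in>route M i - R. Z i j) = (\<Sum>j\<in>route M i. Z i j)"
      using that zero finite_network(3)[OF net, of i] by (intro sum.mono_neutral_left) auto
    then show ?thesis using fair that unfolding fair_flow_def by auto
  qed
  have cols: "(\<Sum>i\<in>{i\<in>users M - users_within M R. j \<in> route M i - R}. Z i j) = cap M j"
    if j: "j \<in> used_resources (without M R)" for j
  proof -
    have "j \<in> used_resources M" "j \<notin> R" using j unfolding used_resources_def by auto
    moreover from this have "{i\<in>users M - users_within M R. j \<in> route M i - R} = {i\<in>users M. j \<in> route M i}"
      unfolding users_within_def by auto
    ultimately show ?thesis using fair unfolding fair_flow_def by auto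
  qed
  show ?thesis
    unfolding fair_flow_def
  proof (intro conjI ballI impI)
    fix i j assume "i \<in> users (without M R)" "j \<in> route (without M R) i"
    then have ij: "i \<in> users M" "j \<in> route M i" by auto
    show "0 \<le> Z i j" using fair ij unfolding fair_flow_def by blast
    fix k assume "0 < Z i j" "k \<in> users (without M R)" "j \<in> route (without M R) k"
    then have "0 < Z i j" "k \<in> users M" "j \<in> route M k" by auto
    then show "x i \<le> x k" using fair ij unfolding fair_flow_def by blast
  qed (use rows cols in simp_all)
qed


text \<open>Remaining users stay away from \<open>R\<close>, which the confined users fill alone.
  Fairness holds there because the confined users share the lowest rate \<open>y\<close>, and
  outside \<open>R\<close> because no confined user reaches it.\<close>

lemma fair_flow_extend:
  assumes net: "is_network M" and R: "R \<subseteq> resources M"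
    and fair: "fair_flow (without M R) d x Z"
    and W0: "\<And>i j. i \<in> users_within M R \<Longrightarrow> j \<in> route M i \<Longrightarrow> 0 \<le> W i j"
    and Wd: "\<And>i. i \<in> users_within M R \<Longrightarrow> (\<Sum>j\<in>route M i. W i j) = d i"
    and Wc: "\<And>j. j \<in> R \<Longrightarrow> (\<Sum>i\<in>{i\<in>users_within M R. j \<in> route M i}. W i j) = cap M j"
    and x: "\<And>i. i \<in> users_within M R \<Longrightarrow> x i = y" "\<And>i. i \<in> users M - users_within M R \<Longrightarrow> y \<le> x i"
  shows "fair_flow M d x (\<lambda>i j. if i \<in> users_within M R then W i j else if j \<in> R then 0 else Z i j)"
    (is "fair_flow M d x ?Z")
  unfolding fair_flow_def
proof (intro conjI ballI impI)
  fix i j assume i: "i \<in> users M" and j: "j \<in> route M i"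
  show "0 \<le> ?Z i j" using W0 fair i j unfolding fair_flow_def by auto
  fix k assume pos: "0 < ?Z i j" and k: "k \<in> users M" "j \<in> route M k"
  show "x i \<le> x k"
  proof (cases "i \<in> users_within M R")
    case True
    then show ?thesis using x k by (cases "k \<in> users_within M R") auto
  next
    case False
    then have "j \<notin> R" "0 < Z i j" using pos by (auto split: if_splits)
    moreover from this have "k \<notin> users_within M R" using k unfolding users_within_def by blast
    ultimately show ?thesis using fair i j k False unfolding fair_flow_def by simp
  qed
next
  fix i assume i: "i \<in> users M"
  show "(\<Sum>j\<in>route M i. ?Z i j) = d i"
  proof (cases "i \<in> users_within M R")
    case False
    have "(\<Sum>j\<in>route M i. ?Z i j) = (\<Sum>j\<in>route M i - R. Z i j)"
      using i False finite_network(3)[OF net] by (intro sum.mono_neutral_cong_right) auto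
    then show ?thesis using fair i False unfolding fair_flow_def by simp
  qed (use Wd in simp)
next
  fix j assume j: "j \<in> used_resources M"
  show "(\<Sum>i\<in>{i\<in>users M. j \<in> route M i}. ?Z i j) = cap M j"
  proof (cases "j \<in> R")
    case True
    have "(\<Sum>i\<in>{i\<in>users M. j \<in> route M i}. ?Z i j) = (\<Sum>i\<in>{i\<in>users_within M R. j \<in> route M i}. W i j)"
      using True finite_network(1)[OF net]
      by (intro sum.mono_neutral_cong_right) (auto simp: users_within_def)
    then show ?thesis using Wc True by simp
  next
    case False
    then have eq: "{i\<in>users M. j \<in> route M i} = {i\<in>users (without M R). j \<in> route (without M R) i}"
      by (auto simp: users_within_def)
    have "j \<in> used_resources (without M R)"
      using j False unfolding used_resources_def by (auto simp: users_within_def)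
    then have "(\<Sum>i\<in>{i\<in>users (without M R). j \<in> route (without M R) i}. Z i j) = cap M j"
      using fair unfolding fair_flow_def by simp
    moreover have "(\<Sum>i\<in>{i\<in>users M. j \<in> route M i}. ?Z i j) =
        (\<Sum>i\<in>{i\<in>users (without M R). j \<in> route (without M R) i}. Z i j)"
      unfolding eq using False by (intro sum.cong) auto
    ultimately show ?thesis by simp
  qed
qed

section \<open>The critical set and the construction of a fair flow\<close>

context peak_rates
begin

abbreviation critical :: "'j network \<Rightarrow> 'j set" where
  "critical M \<equiv> min_resources \<rho> r m M"

abbreviation rate :: "'j network \<Rightarrow> real" where
  "rate M \<equiv> real_of_ereal (min_ratio \<rho> r m M)"

lemma reduced_network_eq: "reduced_network \<rho> r m M = without M (critical M)"
  by (simp add: reduced_network_def without_def min_users_def)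

lemma critical_subset: "critical M \<subseteq> resources M"
  unfolding min_resources_def by (auto dest: strongly_connectedD)

lemma admissible_network: "admissible M \<Longrightarrow> is_network M"
  by (simp add: admissible_def)

lemma resources_nonempty:
  assumes "is_network M" "users M \<noteq> {}"
  shows "resources M \<noteq> {}"
  using assms route_network[of M] by blast

lemma one_le_m:
  assumes "admissible M" "users M \<noteq> {}"
  shows "1 \<le> m"
proof -
  obtain i where "i \<in> users M" using assms(2) by blast
  then have "i \<in> {1..m}" using assms(1) unfolding admissible_def by blast
  then show ?thesis by auto
qed

text \<open>Some strongly connected set confines a user: otherwise, by splitting, the set of all
  resources would confine none. For this set \<open>s = m\<close> gives a positive denominator, so
  the minimum is finite.\<close>

lemma min_ratio_eq:
  assumes adm: "admissible M" and ne: "users M \<noteq> {}"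
  shows "min_ratio \<rho> r m M = ereal (rate M)"
proof -
  note net = admissible_network[OF adm] and m = one_le_m[OF adm ne]
  have "\<exists>A\<in>strongly_connected_sets M. users_within M A \<noteq> {}"
  proof (rule ccontr)
    assume none: "\<not> ?thesis"
    have "users_within M (resources M) = {}"
      using net order.refl resources_nonempty[OF net ne]
      by (rule strongly_connected_induct) (use none in auto)
    then show False using ne route_network(1)[OF net] unfolding users_within_def by blast
  qed
  then obtain A i where A: "A \<in> strongly_connected_sets M" "i \<in> users_within M A" by blast
  have "i \<le> m" using A(2) adm unfolding admissible_def users_within_def by auto
  from threshold_sum_pos[OF adm A(2) this] have "level_ratio \<rho> r M m A \<noteq> \<infinity>"
    by (simp add: level_ratio_def)
  then have "min_ratio \<rho> r m M \<noteq> \<infinity>" using min_ratio_le[OF net A(1), of m] m by auto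
  moreover have "min_ratio \<rho> r m M \<noteq> -\<infinity>"
    using min_ratio_attained[OF net resources_nonempty[OF net ne] m]
      level_ratio_not_MInfty[OF adm] strongly_connectedD by metis
  ultimately show ?thesis by (cases "min_ratio \<rho> r m M") auto
qed

lemma slack_empty:
  assumes "is_network M"
  shows "slack M d {} = 0"
proof -
  have "users_within M {} = {}" using route_network(2)[OF assms] unfolding users_within_def by blast
  then show ?thesis by (simp add: slack_def capacity_def)
qed

text \<open>Negative slack of a strongly connected set would produce a ratio below the minimum;
  additivity over splits covers the other sets.\<close>

lemma slack_rate_nonneg:
  assumes adm: "admissible M" and ne: "users M \<noteq> {}" and J': "J' \<subseteq> resources M"
  shows "0 \<le> slack M (demand (rate M)) J'"
proof (cases "J' = {}")
  case False
  note net = admissible_network[OF adm]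
  show ?thesis
    using net J' False
  proof (induction J' rule: strongly_connected_induct)
    case (strongly_connected A)
    show ?case
    proof (rule ccontr)
      assume neg: "\<not> ?thesis"
      have A: "A \<subseteq> resources M" "A \<noteq> {}" using strongly_connected strongly_connectedD by blast+
      obtain s where "s \<in> {1..m}" "level_ratio \<rho> r M s A < ereal (rate M)"
        using ex_level_ratio_le[OF adm A, of "rate M"] neg by (metis less_imp_le not_le)
      then show False
        using min_ratio_le[OF net strongly_connected] min_ratio_eq[OF adm ne] by fastforce
    qed
  qed (simp add: slack_split[OF net])
qed (simp add: slack_empty[OF admissible_network[OF adm]])

text \<open>From here on the thresholds disappear: the minimizing sets are described by tightness at
  the critical rate alone.\<close>

lemma ratio_eq_min_iff:
  assumes adm: "admissible M" and ne: "users M \<noteq> {}" and A: "A \<in> strongly_connected_sets M"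
  shows "(\<exists>s\<in>{1..m}. level_ratio \<rho> r M s A = min_ratio \<rho> r m M) \<longleftrightarrow> slack M (demand (rate M)) A = 0"
proof
  have A': "A \<subseteq> resources M" "A \<noteq> {}" using A strongly_connectedD by blast+
  note net = admissible_network[OF adm] and eq = min_ratio_eq[OF adm ne]
  {
    assume "\<exists>s\<in>{1..m}. level_ratio \<rho> r M s A = min_ratio \<rho> r m M"
    then obtain s where "level_ratio \<rho> r M s A = min_ratio \<rho> r m M" by blast
    then have "level_ratio \<rho> r M s A \<le> ereal (rate M)" using eq by (metis order.refl)
    then show "slack M (demand (rate M)) A = 0"
      using slack_le_if_level_ratio_le[OF adm A'] slack_rate_nonneg[OF adm ne A'(1)]
      by (meson antisym)
  next
    assume "slack M (demand (rate M)) A = 0"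
    then obtain s where "s \<in> {1..m}" "level_ratio \<rho> r M s A \<le> ereal (rate M)"
      using ex_level_ratio_le[OF adm A', of "rate M"] by (metis order.refl)
    then show "\<exists>s\<in>{1..m}. level_ratio \<rho> r M s A = min_ratio \<rho> r m M"
      using min_ratio_le[OF net A] eq by (metis antisym)
  }
qed

lemma demand_nonneg: "admissible M \<Longrightarrow> \<forall>i\<in>users M. 0 \<le> demand x i"
  using demand_pos unfolding admissible_def by (meson less_imp_le subsetD)

text \<open>Union and intersection of two tight sets have nonnegative slacks with sum at most
  0.\<close>

lemma tight_Union:
  assumes adm: "admissible M" and ne: "users M \<noteq> {}" and "finite F"
    and "\<forall>A\<in>F. A \<subseteq> resources M \<and> slack M (demand (rate M)) A = 0"
  shows "slack M (demand (rate M)) (\<Union>F) = 0"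
  using assms(3,4)
proof (induction F)
  case empty
  then show ?case using slack_empty[OF admissible_network[OF adm]] by simp
next
  case (insert A F)
  then have A: "A \<subseteq> resources M" and F: "\<Union>F \<subseteq> resources M" by auto
  have "slack M (demand (rate M)) (A \<union> \<Union>F) + slack M (demand (rate M)) (A \<inter> \<Union>F) \<le> 0"
    using slack_Un_Int_le[OF admissible_network[OF adm] A F demand_nonneg[OF adm, of "rate M"]] insert by simp
  moreover have "0 \<le> slack M (demand (rate M)) (A \<union> \<Union>F)" "0 \<le> slack M (demand (rate M)) (A \<inter> \<Union>F)"
    using A F by (auto intro!: slack_rate_nonneg[OF adm ne])
  ultimately show ?case by simp
qed

lemma critical_alt:
  assumes "admissible M" "users M \<noteq> {}"
  shows "critical M = \<Union>{A\<in>strongly_connected_sets M. slack M (demand (rate M)) A = 0}"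
  unfolding min_resources_def using ratio_eq_min_iff[OF assms] by blast

lemma critical_tight:
  assumes adm: "admissible M" and ne: "users M \<noteq> {}"
  shows "slack M (demand (rate M)) (critical M) = 0"
proof -
  have "finite (strongly_connected_sets M)"
    using finite_network(2)[OF admissible_network[OF adm]] by (simp add: strongly_connected_sets_def)
  then show ?thesis
    unfolding critical_alt[OF assms] by (intro tight_Union[OF assms]) (auto dest: strongly_connectedD)
qed

text \<open>If a tight set splits, its parts have nonnegative slacks with sum 0 and are tight too.
  It is therefore a union of strongly connected tight sets.\<close>

lemma tight_subset_critical:
  assumes adm: "admissible M" and ne: "users M \<noteq> {}"
    and J': "J' \<subseteq> resources M" "slack M (demand (rate M)) J' = 0"
  shows "J' \<subseteq> critical M"
proof (cases "J' = {}")
  case False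
  note net = admissible_network[OF adm]
  show ?thesis
    using net J'(1) False J'(2)
  proof (induction J' rule: strongly_connected_induct)
    case (strongly_connected A)
    then show ?case unfolding critical_alt[OF assms(1,2)] by blast
  next
    case (split A B)
    have "0 \<le> slack M (demand (rate M)) A" "0 \<le> slack M (demand (rate M)) B"
      using split.hyps by (auto intro!: slack_rate_nonneg[OF adm ne])
    then have "slack M (demand (rate M)) A = 0" "slack M (demand (rate M)) B = 0"
      using split slack_split[OF net, of A B "demand (rate M)"] by auto
    then show ?case using split by blast
  qed
qed simp

lemma critical_nonempty:
  assumes "is_network M" "resources M \<noteq> {}" "1 \<le> m"
  shows "critical M \<noteq> {}"
proof -
  obtain s A where "s \<in> {1..m}" "A \<in> strongly_connected_sets M"
    "level_ratio \<rho> r M s A = min_ratio \<rho> r m M"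
    using min_ratio_attained[OF assms] .
  then have "A \<subseteq> critical M" "A \<noteq> {}" using strongly_connectedD unfolding min_resources_def by blast+
  then show ?thesis by blast
qed

text \<open>A set without slack in the reduced network would be tight in \<open>M\<close> when
  joined with the critical set, against the maximality of the latter.\<close>

lemma slack_without_critical_pos:
  assumes adm: "admissible M" and ne: "users M \<noteq> {}"
    and J': "J' \<subseteq> resources (without M (critical M))" "J' \<noteq> {}"
  shows "0 < slack (without M (critical M)) (demand (rate M)) J'"
proof -
  have J'': "J' \<subseteq> resources M - critical M" using J' by simp
  have "slack (without M (critical M)) (demand (rate M)) J' = slack M (demand (rate M)) (J' \<union> critical M)"
    using slack_without[OF admissible_network[OF adm] critical_subset J''] critical_tight[OF adm ne] by simp
  moreover have sub: "J' \<union> critical M \<subseteq> resources M" using J'' critical_subset[of M] by blast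
  moreover have "slack M (demand (rate M)) (J' \<union> critical M) \<noteq> 0"
    using tight_subset_critical[OF adm ne sub] J' by auto
  ultimately show ?thesis using slack_rate_nonneg[OF adm ne sub] by simp
qed

lemma admissible_without_critical:
  assumes adm: "admissible M" and ne: "users M \<noteq> {}"
  shows "admissible (without M (critical M))"
  unfolding admissible_def stable_load_def
proof (intro conjI allI impI)
  let ?M = "without M (critical M)"
  show "is_network ?M" using without_network[OF admissible_network[OF adm]] .
  show um: "users ?M \<subseteq> {1..m}" using adm unfolding admissible_def by auto
  fix J' assume J': "J' \<subseteq> resources ?M" "J' \<noteq> {}"
  have "sum \<rho> (users_within ?M J') \<le> sum (demand (rate M)) (users_within ?M J')"
    using um by (intro sum_mono demand_ge) (auto simp: users_within_def)
  then show "0 < slack ?M \<rho> J'" using slack_without_critical_pos[OF adm ne J'] by (simp add: slack_def)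
qed

lemma ex_critical_flow:
  assumes adm: "admissible M" and ne: "users M \<noteq> {}"
  shows "\<exists>W. (\<forall>i\<in>users_within M (critical M). \<forall>j\<in>route M i. 0 \<le> W i j) \<and>
    (\<forall>i\<in>users_within M (critical M). (\<Sum>j\<in>route M i. W i j) = demand (rate M) i) \<and>
    (\<forall>j\<in>critical M. (\<Sum>i\<in>{i\<in>users_within M (critical M). j \<in> route M i}. W i j) = cap M j)"
proof -
  let ?R = "critical M" and ?d = "demand (rate M)"
  let ?I = "users_within M ?R"
  note net = admissible_network[OF adm]
  have finR: "finite ?R" by (rule finite_subset[OF critical_subset finite_network(2)[OF net]])
  have "\<exists>W. (\<forall>i\<in>?I. \<forall>j\<in>route M i. 0 \<le> W i j) \<and> (\<forall>i\<in>?I. (\<Sum>j\<in>route M i. W i j) = ?d i) \<and>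
      (\<forall>j\<in>?R. (\<Sum>i\<in>{i\<in>?I. j \<in> route M i}. W i j) \<le> cap M j)"
  proof (rule fractional_hall[where J = ?R])
    show "finite ?I" using finite_users_within[OF net] .
    show "\<forall>i\<in>?I. route M i \<subseteq> ?R" by (simp add: users_within_def)
    show "\<forall>i\<in>?I. 0 \<le> ?d i" using demand_nonneg[OF adm] by (simp add: users_within_def)
    show "\<forall>A\<subseteq>?R. (\<Sum>i\<in>{i\<in>?I. route M i \<subseteq> A}. ?d i) \<le> (\<Sum>j\<in>A. cap M j)"
    proof (intro allI impI)
      fix A assume A: "A \<subseteq> ?R"
      then have "{i\<in>?I. route M i \<subseteq> A} = users_within M A" unfolding users_within_def by auto
      moreover have "0 \<le> slack M ?d A" using A critical_subset[of M] by (intro slack_rate_nonneg[OF adm ne]) auto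
      ultimately show "(\<Sum>i\<in>{i\<in>?I. route M i \<subseteq> A}. ?d i) \<le> (\<Sum>j\<in>A. cap M j)"
        by (simp add: slack_def capacity_def)
    qed
  qed (rule finR)
  then obtain W where W: "\<And>i j. i \<in> ?I \<Longrightarrow> j \<in> route M i \<Longrightarrow> 0 \<le> W i j"
      "\<And>i. i \<in> ?I \<Longrightarrow> (\<Sum>j\<in>route M i. W i j) = ?d i"
      "\<And>j. j \<in> ?R \<Longrightarrow> (\<Sum>i\<in>{i\<in>?I. j \<in> route M i}. W i j) \<le> cap M j" by blast
  define col where "col j = (\<Sum>i\<in>{i\<in>?I. j \<in> route M i}. W i j)" for j
  have "sum ?d ?I = (\<Sum>i\<in>?I. \<Sum>j\<in>route M i \<inter> ?R. W i j)"
    using W(2) by (intro sum.cong) (auto simp: users_within_def Int_absorb2)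
  also have "\<dots> = (\<Sum>j\<in>resources M \<inter> ?R. col j)"
    unfolding col_def by (rule sum_users_routes[OF net]) (auto simp: users_within_def)
  also have "resources M \<inter> ?R = ?R" using critical_subset[of M] by blast
  finally have "(\<Sum>j\<in>?R. cap M j - col j) = 0"
    using critical_tight[OF adm ne] by (simp add: slack_def capacity_def sum_subtractf)
  then have "\<forall>j\<in>?R. cap M j - col j = 0"
    using W(3) finR by (subst (asm) sum_nonneg_eq_0_iff) (auto simp: col_def)
  then show ?thesis using W(1,2) by (intro exI[of _ W]) (auto simp: col_def)
qed

text \<open>The second conjunct strengthens the induction: taken at the critical rate in the reduced
  network, it makes all later rates larger. It also supplies positivity of the rates, via
  \<open>y = 0\<close>, and the lower bound needed for arbitrary populations.\<close>

lemma ex_fair_flow: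
  assumes "admissible M"
  shows "\<exists>x Z. fair_flow M (\<lambda>i. demand (x i) i) x Z \<and>
    (\<forall>y. (\<forall>J'\<subseteq>resources M. J' \<noteq> {} \<longrightarrow> 0 < slack M (demand y) J') \<longrightarrow> (\<forall>i\<in>users M. y < x i))"
  using assms
proof (induction "card (resources M)" arbitrary: M rule: less_induct)
  case less
  note adm = less.prems and net = admissible_network[OF less.prems]
  show ?case
  proof (cases "users M = {}")
    case True
    then show ?thesis unfolding fair_flow_def used_resources_def by simp
  next
    case ne: False
    let ?R = "critical M" and ?X = "rate M"
    let ?M = "without M ?R"
    have R: "?R \<subseteq> resources M" "?R \<noteq> {}"
      using critical_subset[of M] critical_nonempty[OF net resources_nonempty[OF net ne] one_le_m[OF adm ne]] .
    have "card (resources ?M) < card (resources M)"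
      using R finite_network(2)[OF net] by (intro psubset_card_mono) auto
    from less.hyps[OF this admissible_without_critical[OF adm ne]] obtain x Z
      where fair: "fair_flow ?M (\<lambda>i. demand (x i) i) x Z"
      and gt: "\<forall>y. (\<forall>J'\<subseteq>resources ?M. J' \<noteq> {} \<longrightarrow> 0 < slack ?M (demand y) J') \<longrightarrow> (\<forall>i\<in>users ?M. y < x i)"
      by blast
    have x_gt: "\<forall>i\<in>users ?M. ?X < x i"
      using gt slack_without_critical_pos[OF adm ne] by blast
    obtain W where W: "\<And>i j. i \<in> users_within M ?R \<Longrightarrow> j \<in> route M i \<Longrightarrow> 0 \<le> W i j"
      "\<And>i. i \<in> users_within M ?R \<Longrightarrow> (\<Sum>j\<in>route M i. W i j) = demand ?X i"
      "\<And>j. j \<in> ?R \<Longrightarrow> (\<Sum>i\<in>{i\<in>users_within M ?R. j \<in> route M i}. W i j) = cap M j"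
      using ex_critical_flow[OF adm ne] by blast
    define x' where "x' i = (if i \<in> users_within M ?R then ?X else x i)" for i
    have "fair_flow ?M (\<lambda>i. demand (x' i) i) x' Z"
      by (rule fair_flow_cong[OF fair]) (auto simp: x'_def)
    from fair_flow_extend[OF net R(1) this, of W ?X]
    obtain Z' where "fair_flow M (\<lambda>i. demand (x' i) i) x' Z'"
      using W x_gt by (auto simp: x'_def less_imp_le)
    moreover have "y < x' i" if y: "\<forall>J'\<subseteq>resources M. J' \<noteq> {} \<longrightarrow> 0 < slack M (demand y) J'"
      and i: "i \<in> users M" for y i
    proof -
      have "0 < slack M (demand y) ?R" using y R by blast
      then have "y < ?X"
        using slack_antimono[of M ?X y ?R] critical_tight[OF adm ne] adm
        unfolding admissible_def by force
      then show ?thesis using x_gt i by (force simp: x'_def)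
    qed
    ultimately show ?thesis by blast
  qed
qed

end

subsection \<open>The slowest users of a fair flow\<close>

text \<open>A resource open to a slowest user serves slowest users only. Thus \<open>A\<close> alone
  fills \<open>B\<close>, and any other user confined to \<open>B\<close> would get nothing despite
  its positive demand.\<close>

lemma fair_bottleneck:
  assumes net: "is_network M" and fair: "fair_flow M d x Z" and d: "\<forall>i\<in>users M. 0 < d i"
    and A: "A = {i\<in>users M. \<forall>k\<in>users M. x i \<le> x k}" and B: "B = \<Union>(route M ` A)"
  shows "\<And>i j. i \<in> users M \<Longrightarrow> j \<in> route M i \<inter> B \<Longrightarrow> 0 < Z i j \<Longrightarrow> i \<in> A"
    and "users_within M B = A" and "sum d A = capacity M B"
proof -
  show bottleneck: "i \<in> A" if ij: "i \<in> users M" "j \<in> route M i \<inter> B" "0 < Z i j" for i j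
  proof -
    obtain k where k: "k \<in> A" "j \<in> route M k" using ij(2) B by blast
    then have "x i \<le> x k" using fair ij A unfolding fair_flow_def by blast
    then show ?thesis using k(1) ij(1) unfolding A by force
  qed
  show within: "users_within M B = A"
  proof
    show "A \<subseteq> users_within M B" unfolding users_within_def A B by blast
    show "users_within M B \<subseteq> A"
    proof
      fix i assume i: "i \<in> users_within M B"
      then have iu: "i \<in> users M" "route M i \<subseteq> B" unfolding users_within_def by auto
      have "(\<Sum>j\<in>route M i. Z i j) \<noteq> 0" using fair d iu(1) unfolding fair_flow_def by force
      then obtain j where j: "j \<in> route M i" "Z i j \<noteq> 0" by (meson sum.neutral)
      then have "0 < Z i j" using fair iu(1) unfolding fair_flow_def by force
      then show "i \<in> A" using bottleneck[OF iu(1), of j] j iu(2) by blast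
    qed
  qed
  have B_used: "B \<subseteq> used_resources M" unfolding used_resources_def A B by blast
  have AU: "A \<subseteq> users M" unfolding A by blast
  have "sum d A = (\<Sum>i\<in>A. \<Sum>j\<in>route M i \<inter> B. Z i j)"
  proof (rule sum.cong)
    fix i assume i: "i \<in> A"
    then have "route M i \<inter> B = route M i" unfolding B by blast
    then show "d i = (\<Sum>j\<in>route M i \<inter> B. Z i j)" using fair i AU unfolding fair_flow_def by auto
  qed simp
  also have "\<dots> = (\<Sum>j\<in>resources M \<inter> B. \<Sum>i\<in>{i\<in>A. j \<in> route M i}. Z i j)"
    by (rule sum_users_routes[OF net AU])
  also have "resources M \<inter> B = B" using B_used used_resources_subset[OF net] by blast
  also have "(\<Sum>j\<in>B. \<Sum>i\<in>{i\<in>A. j \<in> route M i}. Z i j) = (\<Sum>j\<in>B. cap M j)"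
  proof (rule sum.cong)
    fix j assume j: "j \<in> B"
    have "(\<Sum>i\<in>{i\<in>A. j \<in> route M i}. Z i j) = (\<Sum>i\<in>{i\<in>users M. j \<in> route M i}. Z i j)"
    proof (rule sum.mono_neutral_left)
      show "\<forall>i\<in>{i\<in>users M. j \<in> route M i} - {i\<in>A. j \<in> route M i}. Z i j = 0"
      proof
        fix i assume i: "i \<in> {i\<in>users M. j \<in> route M i} - {i\<in>A. j \<in> route M i}"
        then have "\<not> 0 < Z i j" using bottleneck[of i j] j by blast
        moreover have "0 \<le> Z i j" using fair i unfolding fair_flow_def by blast
        ultimately show "Z i j = 0" by simp
      qed
    qed (use AU finite_network(1)[OF net] in auto)
    also have "\<dots> = cap M j" using fair j B_used unfolding fair_flow_def by blast
    finally show "(\<Sum>i\<in>{i\<in>A. j \<in> route M i}. Z i j) = cap M j" .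
  qed simp
  finally show "sum d A = capacity M B" by (simp add: capacity_def)
qed

context peak_rates
begin

text \<open>The set \<open>B\<close> of resources open to the slowest users is tight at their rate \<open>y\<close>, hence \<open>y\<close> is
  the critical rate and \<open>B\<close> is contained in the critical set. Genericity is needed for the
  reverse inclusion: on the remaining critical resources the faster users would have to use up
  the capacity while each of them demands just \<open>\<rho> i\<close>.\<close>

lemma fair_critical:
  assumes adm: "admissible M" and gen: "generic_load M \<rho>" and ne: "users M \<noteq> {}"
    and fair: "fair_flow M (\<lambda>i. demand (x i) i) x Z"
  shows "i \<in> users_within M (critical M) \<Longrightarrow> x i = rate M"
    and "i \<in> users M - users_within M (critical M) \<Longrightarrow> rate M < x i"
    and "i \<in> users M - users_within M (critical M) \<Longrightarrow> j \<in> route M i \<inter> critical M \<Longrightarrow> Z i j = 0"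
    and "j \<in> critical M \<Longrightarrow> \<exists>i\<in>users_within M (critical M). j \<in> route M i \<and> 0 < Z i j"
proof -
  note net = admissible_network[OF adm]
  have um: "users M \<subseteq> {1..m}" using adm unfolding admissible_def by blast
  define A where "A = {i\<in>users M. \<forall>k\<in>users M. x i \<le> x k}"
  define B where "B = \<Union>(route M ` A)"
  define y where "y = Min (x ` users M)"
  have dpos: "\<forall>i\<in>users M. 0 < demand (x i) i" using um demand_pos by blast
  note bottleneck = fair_bottleneck[OF net fair dpos A_def B_def]
  have Z0: "0 \<le> Z i j" if "i \<in> users M" "j \<in> route M i" for i j
    using fair that unfolding fair_flow_def by blast
  have y_le: "y \<le> x i" if "i \<in> users M" for i
    unfolding y_def using that finite_network(1)[OF net] by simp
  have "y \<in> x ` users M" unfolding y_def using finite_network(1)[OF net] ne by (intro Min_in) auto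
  then obtain a where a: "a \<in> users M" "x a = y" by blast
  have A_eq: "i \<in> A \<longleftrightarrow> i \<in> users M \<and> x i = y" for i
    unfolding A_def using a y_le by force
  have B_res: "B \<subseteq> resources M" unfolding B_def A_def using route_network(1)[OF net] by blast
  have "route M a \<subseteq> B" using a A_eq unfolding B_def by blast
  then have B_ne: "B \<noteq> {}" using route_network(2)[OF net a(1)] by blast
  have "sum (demand y) A = capacity M B"
    using bottleneck(3) A_eq by (metis (no_types, lifting) sum.cong)
  then have tightB: "slack M (demand y) B = 0" using bottleneck(2) by (simp add: slack_def)
  have nonneg_y: "0 \<le> slack M (demand y) J'" if "J' \<subseteq> resources M" for J'
  proof -
    have "sum (demand y) (users_within M J') \<le> (\<Sum>i\<in>users_within M J'. demand (x i) i)"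
      using um y_le by (intro sum_mono demand_mono) (auto simp: users_within_def)
    also have "\<dots> \<le> capacity M J'"
      by (rule sum_demand_le_capacity[OF net fair that]) (auto simp: users_within_def)
    finally show ?thesis by (simp add: slack_def)
  qed
  have crit_ne: "critical M \<noteq> {}"
    using critical_nonempty[OF net resources_nonempty[OF net ne] one_le_m[OF adm ne]] .
  \<comment> \<open>\<open>B\<close> is tight at \<open>y\<close> and the critical set at the
    critical rate, while neither rate overloads the other set. Uniqueness of tight rates applies in
    both directions.\<close>
  have y: "y = rate M"
  proof (rule antisym)
    show "rate M \<le> y"
      by (rule tight_rate_unique[OF adm B_res B_ne tightB slack_rate_nonneg[OF adm ne B_res]])
    show "y \<le> rate M"
      by (rule tight_rate_unique[OF adm critical_subset crit_ne critical_tight[OF adm ne]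
            nonneg_y[OF critical_subset]])
  qed
  have B_crit: "B \<subseteq> critical M"
    using tight_subset_critical[OF adm ne B_res] tightB y by simp
  have "critical M - B = {}"
  proof (rule ccontr)
    define K where "K = critical M - B"
    define I where "I = users_within M (critical M) - A"
    assume "critical M - B \<noteq> {}"
    then have K_ne: "K \<noteq> {}" by (simp add: K_def)
    have K_res: "K \<subseteq> resources M" using critical_subset[of M] unfolding K_def by blast
    have I_users: "I \<subseteq> users M" unfolding I_def users_within_def by blast
    have zero: "Z i j = 0" if "i \<in> users M" "i \<notin> A" "j \<in> route M i \<inter> B" for i j
      using bottleneck(1)[OF that(1,3)] that Z0[OF that(1), of j] by force
    have fin: "finite (users_within M (critical M))" by (rule finite_users_within[OF net])
    have A_sub: "A \<subseteq> users_within M (critical M)"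
      using bottleneck(2) B_crit unfolding users_within_def by blast
    have le: "(\<Sum>i\<in>users_within M (critical M). demand (x i) i) \<le> capacity M (critical M)"
      by (rule sum_demand_le_capacity[OF net fair critical_subset]) (auto simp: users_within_def)
    have tight: "(\<Sum>i\<in>users_within M (critical M). demand y i) = capacity M (critical M)"
      using critical_tight[OF adm ne] y by (simp add: slack_def)
    have mono: "demand y i \<le> demand (x i) i" if "i \<in> users M" for i
      using that um y_le by (intro demand_mono) auto
    \<comment> \<open>At rate \<open>y\<close> the confined users already exhaust the critical
      capacity, so raising their rates cannot have raised any demand. A demand stays constant only
      up to the peak rate.\<close>
    have demand_I: "demand (x i) i = \<rho> i" "demand y i = \<rho> i" if i: "i \<in> I" for i
    proof -
      have iu: "i \<in> users M" "i \<in> {1..m}" using i I_users um by auto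
      have less: "y < x i" using i A_eq y_le[OF iu(1)] iu unfolding I_def by force
      have eq: "demand y i = demand (x i) i"
      proof (rule ccontr)
        assume "demand y i \<noteq> demand (x i) i"
        then have "demand y i < demand (x i) i" using mono[OF iu(1)] by simp
        then have "(\<Sum>i\<in>users_within M (critical M). demand y i) <
            (\<Sum>i\<in>users_within M (critical M). demand (x i) i)"
          using i mono unfolding I_def users_within_def
          by (intro sum_strict_mono_ex1 fin[unfolded users_within_def]) auto
        then show False using le tight by simp
      qed
      have "x i \<le> r i" using demand_strict_mono[OF iu(2) less] eq by force
      then show "demand (x i) i = \<rho> i" by (rule demand_slow[OF iu(2)])
      then show "demand y i = \<rho> i" using eq by simp
    qed
    have "sum \<rho> I \<noteq> capacity M K"
    proof (rule generic_load_unbalanced[OF net _ gen K_res K_ne])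
      show "stable_load M \<rho>" using adm unfolding admissible_def by blast
      show "users_within M K \<subseteq> I"
        using bottleneck(2) route_network(2)[OF net] unfolding I_def K_def users_within_def by blast
      show "I \<subseteq> users_meeting M K"
      proof
        fix i assume i: "i \<in> I"
        then have "i \<in> users M" "route M i \<subseteq> critical M" "i \<notin> users_within M B"
          using bottleneck(2) unfolding I_def users_within_def by auto
        then show "i \<in> users_meeting M K" unfolding K_def users_meeting_def users_within_def by blast
      qed
      fix L assume L: "L \<subseteq> K"
      define S where "S = {i\<in>I. route M i \<inter> K \<subseteq> L}"
      \<comment> \<open>Users in \<open>S\<close> are not among the slowest and send nothing over
        \<open>B\<close>; hence all their flow is on \<open>L\<close>.\<close>
      have "(\<Sum>i\<in>S. demand (x i) i) \<le> capacity M L"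
      proof (rule sum_demand_le_capacity[OF net fair])
        show "L \<subseteq> resources M" using L K_res by blast
        show "S \<subseteq> users M" using I_users unfolding S_def by blast
        fix i j assume ij: "i \<in> S" "j \<in> route M i" "j \<notin> L"
        then have "j \<in> B" "i \<in> users M" "i \<notin> A"
          unfolding S_def K_def I_def users_within_def by blast+
        then show "Z i j = 0" using zero ij by blast
      qed
      moreover have "(\<Sum>i\<in>S. demand (x i) i) = sum \<rho> S"
        using demand_I unfolding S_def by (intro sum.cong) auto
      ultimately show "sum \<rho> {i\<in>I. route M i \<inter> K \<subseteq> L} \<le> capacity M L" by (simp add: S_def)
    qed
    moreover have "sum \<rho> I = capacity M K"
    proof -
      have "sum \<rho> I = sum (demand y) I" using demand_I by simp
      also have "\<dots> = sum (demand y) (users_within M (critical M)) - sum (demand y) A"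
        unfolding I_def by (rule sum_diff[OF fin A_sub])
      also have "\<dots> = capacity M (critical M) - capacity M B"
        using tight \<open>sum (demand y) A = capacity M B\<close> by simp
      also have "\<dots> = capacity M K"
        unfolding capacity_def K_def
        by (rule sum_diff[symmetric, OF finite_subset[OF critical_subset finite_network(2)[OF net]] B_crit])
      finally show ?thesis .
    qed
    ultimately show False by simp
  qed
  then have crit: "critical M = B" using B_crit by blast
  then have crit_A: "users_within M (critical M) = A" using bottleneck(2) by simp
  show "x i = rate M" if "i \<in> users_within M (critical M)" for i
    using that A_eq y unfolding crit_A by simp
  show "rate M < x i" if "i \<in> users M - users_within M (critical M)" for i
    using that A_eq y y_le[of i] unfolding crit_A by force
  show "Z i j = 0" if "i \<in> users M - users_within M (critical M)" "j \<in> route M i \<inter> critical M" for i j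
    using that bottleneck(1)[of i j] Z0[of i j] unfolding crit_A unfolding crit by force
  show "\<exists>i\<in>users_within M (critical M). j \<in> route M i \<and> 0 < Z i j" if j: "j \<in> critical M" for j
  proof -
    have "j \<in> used_resources M" using j unfolding crit B_def A_def used_resources_def by blast
    then have "(\<Sum>i\<in>{i\<in>users M. j \<in> route M i}. Z i j) = cap M j"
      using fair unfolding fair_flow_def by blast
    moreover have "0 < cap M j" using net j critical_subset[of M] unfolding is_network_def by blast
    ultimately have "(\<Sum>i\<in>{i\<in>users M. j \<in> route M i}. Z i j) \<noteq> 0" by simp
    then obtain i where i: "i \<in> {i\<in>users M. j \<in> route M i}" "Z i j \<noteq> 0" by (meson sum.neutral)
    then have "0 < Z i j" using Z0[of i j] by simp
    then show ?thesis using bottleneck(1)[of i j] i j unfolding crit_A unfolding crit by blast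
  qed
qed

end

text \<open>For peak rates below all the fair rates, the demands of the algorithm are proportional to the
  rates; this gives fair allocations for arbitrary populations.\<close>

lemma ex_fair_flow_population:
  assumes net: "is_network N" and labels: "users N = {1..m}" and n: "\<forall>i\<in>users N. 0 < n i"
  shows "\<exists>x Z. fair_flow N (\<lambda>i. n i * x i) x Z \<and> (\<forall>i\<in>users N. 0 < x i)"
proof -
  define c where "c = Min (insert 1 (cap N ` resources N))"
  \<comment> \<open>As load \<open>n i * e\<close>, this leaves positive slack everywhere, since
    even all users together stay below each single capacity. The added 1 keeps the denominator
    positive.\<close>
  define e where "e = c / (sum n (users N) + 1)"
  note fin = finite_network[OF net]
  have c0: "0 < c" unfolding c_def using fin(2) net by (subst Min_gr_iff) (auto simp: is_network_def)
  have c_le: "c \<le> cap N j" if "j \<in> resources N" for j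
    unfolding c_def using fin(2) that by (intro Min_le) auto
  have n0: "0 \<le> sum n (users N)" using n by (intro sum_nonneg) (auto simp: less_imp_le)
  then have e0: "0 < e" unfolding e_def using c0 by simp
  have sum_e: "sum n (users N) * e < c"
    using n0 c0 unfolding e_def by (simp add: field_simps)
  interpret peak_rates "\<lambda>i. n i * e" "\<lambda>_. e" m
    by unfold_locales (use n e0 labels in auto)
  have slack_pos: "0 < slack N (\<lambda>i. n i * e) J'" if J': "J' \<subseteq> resources N" "J' \<noteq> {}" for J'
  proof -
    obtain j where j: "j \<in> J'" using J'(2) by blast
    have "(\<Sum>i\<in>users_within N J'. n i * e) \<le> (\<Sum>i\<in>users N. n i * e)"
      using n e0 fin(1) by (intro sum_mono2) (auto simp: users_within_def)
    also have "\<dots> < c" using sum_e by (simp add: sum_distrib_right)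
    also have "c \<le> cap N j" using c_le j J'(1) by blast
    also have "\<dots> \<le> capacity N J'"
      unfolding capacity_def using j J'(1) fin(2) net
      by (intro member_le_sum) (auto simp: is_network_def less_imp_le intro: finite_subset)
    finally show ?thesis by (simp add: slack_def)
  qed
  have "admissible N"
    unfolding admissible_def stable_load_def using net labels slack_pos by simp
  from ex_fair_flow[OF this] obtain x Z where xZ: "fair_flow N (\<lambda>i. demand (x i) i) x Z \<and>
    (\<forall>y. (\<forall>J'\<subseteq>resources N. J' \<noteq> {} \<longrightarrow> 0 < slack N (demand y) J') \<longrightarrow> (\<forall>i\<in>users N. y < x i))"
    by (elim exE)
  note fair = conjunct1[OF xZ]
  \<comment> \<open>At rate \<open>e\<close> all slacks are still positive, so the fair rates exceed
    the common peak rate \<open>e\<close> and all demands are on their linear branch.\<close>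
  have "demand e = (\<lambda>i. n i * e)" using e0 by (auto simp: demand_def)
  then have x_gt: "e < x i" if "i \<in> users N" for i
    using spec[OF conjunct2[OF xZ], of e] slack_pos that by simp
  have "fair_flow N (\<lambda>i. n i * x i) x Z"
  proof (rule fair_flow_cong[OF fair])
    fix i assume i: "i \<in> users N"
    then show "demand (x i) i = n i * x i" using x_gt[OF i] e0 by (simp add: demand_def max.absorb2)
  qed auto
  moreover have "0 < x i" if "i \<in> users N" for i using x_gt[OF that] e0 by simp
  ultimately show ?thesis by blast
qed

subsection \<open>Clusters and equilibria\<close>

text \<open>Here \<open>opt_rate\<close> becomes usable: a fair allocation exists for every positive
  population, and its rates are the ones described.\<close>

lemma optimal_fair:
  assumes net: "is_network N" and labels: "users N = {1..m}" and U: "is_utility U"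
    and n: "\<forall>i\<in>users N. 0 < n i"
  shows "\<forall>i\<in>users N. 0 < opt_rate N U n i"
    and "optimal N U n X \<longleftrightarrow>
      fair_flow N (\<lambda>i. n i * opt_rate N U n i) (opt_rate N U n) (\<lambda>i j. n i * X i j)"
    and "\<exists>X. optimal N U n X"
proof -
  obtain x Z where fair: "fair_flow N (\<lambda>i. n i * x i) x Z" and x0: "\<forall>i\<in>users N. 0 < x i"
    using ex_fair_flow_population[OF net labels n] by blast
  define X0 where "X0 i j = Z i j / n i" for i j
  have fair0: "fair_flow N (\<lambda>i. n i * x i) x (\<lambda>i j. n i * X0 i j)"
  proof (rule fair_flow_cong[OF fair])
    fix i j assume "i \<in> users N"
    then show "Z i j = n i * X0 i j" using n by (auto simp: X0_def)
  qed auto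
  note opt = optimal_iff_fair_rates[where U = U and n = n and x = x and X = X0, OF net U n x0 fair0]
  have rate: "opt_rate N U n i = x i" if "i \<in> users N" for i
    by (rule opt_rate_fair[where U = U and n = n and x = x and X = X0, OF net U n x0 fair0 that])
  then show "\<forall>i\<in>users N. 0 < opt_rate N U n i" using x0 by simp
  have iff: "optimal N U n X \<longleftrightarrow> fair_flow N (\<lambda>i. n i * x i) x (\<lambda>i j. n i * X i j)" for X
  proof
    assume "optimal N U n X"
    then show "fair_flow N (\<lambda>i. n i * x i) x (\<lambda>i j. n i * X i j)"
      unfolding opt using fair_flow_of_rates[where n = n and x = x and X = X0, OF net n fair0] by blast
  next
    assume fX: "fair_flow N (\<lambda>i. n i * x i) x (\<lambda>i j. n i * X i j)"
    show "optimal N U n X"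
      unfolding opt using fair_feasible[OF net n fX] fair_total_rate[OF n fX] by blast
  qed
  show "\<exists>X. optimal N U n X" using iff fair0 by blast
  show "optimal N U n X \<longleftrightarrow>
      fair_flow N (\<lambda>i. n i * opt_rate N U n i) (opt_rate N U n) (\<lambda>i j. n i * X i j)"
    unfolding iff using rate by (auto elim!: fair_flow_cong)
qed

lemma fair_flow_average:
  assumes "fair_flow N d x Z" "fair_flow N d x W"
  shows "fair_flow N d x (\<lambda>i j. (Z i j + W i j) / 2)"
  unfolding fair_flow_def
proof (intro conjI ballI impI)
  fix i j assume ij: "i \<in> users N" "j \<in> route N i"
  have ZW: "0 \<le> Z i j" "0 \<le> W i j" using assms ij unfolding fair_flow_def by blast+
  then show "0 \<le> (Z i j + W i j) / 2" by simp
  fix k assume pos: "0 < (Z i j + W i j) / 2" and k: "k \<in> users N" "j \<in> route N k"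
  then have "0 < Z i j \<or> 0 < W i j" using ZW by auto
  then show "x i \<le> x k" using assms ij k unfolding fair_flow_def by blast
next
  fix i assume "i \<in> users N"
  then have "(\<Sum>j\<in>route N i. Z i j) = d i" "(\<Sum>j\<in>route N i. W i j) = d i"
    using assms unfolding fair_flow_def by blast+
  then show "(\<Sum>j\<in>route N i. (Z i j + W i j) / 2) = d i"
    by (simp add: sum_divide_distrib[symmetric] sum.distrib)
next
  fix j assume "j \<in> used_resources N"
  then have "(\<Sum>i\<in>{i\<in>users N. j \<in> route N i}. Z i j) = cap N j"
    "(\<Sum>i\<in>{i\<in>users N. j \<in> route N i}. W i j) = cap N j"
    using assms unfolding fair_flow_def by blast+
  then show "(\<Sum>i\<in>{i\<in>users N. j \<in> route N i}. (Z i j + W i j) / 2) = cap N j"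
    by (simp add: sum_divide_distrib[symmetric] sum.distrib)
qed

lemma sym_shares: "sym (shares N X)"
  unfolding shares_def sym_def by auto

text \<open>Averaging two optimal allocations joins their supports; this makes reachability, which may
  use a different optimal allocation for every path, a transitive relation.\<close>

locale optimal_allocations =
  fixes N :: "'j network" and U :: "real \<Rightarrow> ereal" and n :: "nat \<Rightarrow> real" and m :: nat
  assumes net: "is_network N" and labels: "users N = {1..m}" and U: "is_utility U"
    and n: "\<forall>i\<in>users N. 0 < n i"
begin

abbreviation x :: "nat \<Rightarrow> real" where "x \<equiv> opt_rate N U n"

lemmas optimal_fair = optimal_fair[OF net labels U n]

lemma optimal_nonneg: "optimal N U n X \<Longrightarrow> i \<in> users N \<Longrightarrow> j \<in> route N i \<Longrightarrow> 0 \<le> X i j"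
  unfolding optimal_def feasible_def by blast

lemma optimal_average:
  assumes "optimal N U n X" "optimal N U n Y"
  shows "optimal N U n (\<lambda>i j. (X i j + Y i j) / 2)"
proof -
  have "fair_flow N (\<lambda>i. n i * x i) x (\<lambda>i j. (n i * X i j + n i * Y i j) / 2)"
    using assms unfolding optimal_fair(2) by (rule fair_flow_average)
  then show ?thesis unfolding optimal_fair(2) by (simp add: distrib_left)
qed

lemma reachable_join:
  assumes X: "optimal N U n X" "(i, k) \<in> (shares N X)\<^sup>*"
    and Y: "optimal N U n Y" "(k, l) \<in> (shares N Y)\<^sup>*"
  shows "\<exists>V. optimal N U n V \<and> (i, l) \<in> (shares N V)\<^sup>* \<and>
    (\<forall>i\<in>users N. \<forall>j\<in>route N i. 0 < Y i j \<longrightarrow> 0 < V i j)"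
proof -
  define V where "V i j = (X i j + Y i j) / 2" for i j
  have V: "optimal N U n V" using optimal_average[OF X(1) Y(1)] unfolding V_def .
  have pos: "0 < V i j" if "i \<in> users N" "j \<in> route N i" "0 < X i j \<or> 0 < Y i j" for i j
    using optimal_nonneg[OF X(1) that(1,2)] optimal_nonneg[OF Y(1) that(1,2)] that(3)
    unfolding V_def by auto
  have "shares N X \<subseteq> shares N V" "shares N Y \<subseteq> shares N V"
    unfolding shares_def using pos by blast+
  then have "(i, k) \<in> (shares N V)\<^sup>*" "(k, l) \<in> (shares N V)\<^sup>*"
    using X(2) Y(2) rtrancl_mono by blast+
  then have "(i, l) \<in> (shares N V)\<^sup>*" by (rule rtrancl_trans)
  then show ?thesis using V pos by blast
qed

text \<open>Two users served by a common resource both have the smallest rate there.\<close>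

lemma shares_same_rate:
  assumes X: "optimal N U n X" and "(i, k) \<in> (shares N X)\<^sup>*"
  shows "x i = x k"
  using assms(2)
proof (induction rule: rtrancl_induct)
  case (step k l)
  then obtain j where j: "k \<in> users N" "l \<in> users N" "j \<in> route N k" "j \<in> route N l" "0 < X k j" "0 < X l j"
    unfolding shares_def by blast
  have fair: "fair_flow N (\<lambda>i. n i * x i) x (\<lambda>i j. n i * X i j)" using X optimal_fair(2) by blast
  have "0 < n k * X k j" "0 < n l * X l j" using n j by simp_all
  then have "x k \<le> x l" "x l \<le> x k" using fair j unfolding fair_flow_def by blast+
  then show ?case using step by simp
qed simp

lemma reachable_subset:
  assumes X: "optimal N U n X" "(i, k) \<in> (shares N X)\<^sup>*"
  shows "reachable_users N U n k \<subseteq> reachable_users N U n i"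
    and "reachable_resources N U n k \<subseteq> reachable_resources N U n i"
proof -
  show "reachable_users N U n k \<subseteq> reachable_users N U n i"
  proof
    fix l assume "l \<in> reachable_users N U n k"
    then obtain Y where "l \<in> users N" and Y: "optimal N U n Y" "(k, l) \<in> (shares N Y)\<^sup>*"
      unfolding reachable_users_def by blast
    then show "l \<in> reachable_users N U n i"
      using reachable_join[OF X Y] unfolding reachable_users_def by blast
  qed
  show "reachable_resources N U n k \<subseteq> reachable_resources N U n i"
  proof
    fix j assume "j \<in> reachable_resources N U n k"
    then obtain Y l where l: "j \<in> resources N" "l \<in> users N" "j \<in> route N l" "0 < Y l j"
      and Y: "optimal N U n Y" "(k, l) \<in> (shares N Y)\<^sup>*"
      unfolding reachable_resources_def by blast
    obtain V where "optimal N U n V" "(i, l) \<in> (shares N V)\<^sup>*"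
      "\<forall>i\<in>users N. \<forall>j\<in>route N i. 0 < Y i j \<longrightarrow> 0 < V i j"
      using reachable_join[OF X Y] by blast
    then show "j \<in> reachable_resources N U n i"
      using l unfolding reachable_resources_def by blast
  qed
qed

text \<open>Reachability is symmetric, and transitive by averaging, so what a user reaches is the
  same for all users reached. The resource part is nonempty because optimal rates are
  positive.\<close>

lemma cluster_reachable:
  assumes i: "i \<in> users N"
  shows "cluster N U n (reachable_users N U n i) (reachable_resources N U n i)"
    and "i \<in> reachable_users N U n i"
    and "\<forall>k\<in>reachable_users N U n i. x k = x i"
proof -
  obtain X where X: "optimal N U n X" using optimal_fair(3) by blast
  show self: "i \<in> reachable_users N U n i"
    using i X unfolding reachable_users_def by blast
  show "\<forall>k\<in>reachable_users N U n i. x k = x i"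
    using shares_same_rate unfolding reachable_users_def by force
  have fair: "fair_flow N (\<lambda>i. n i * x i) x (\<lambda>i j. n i * X i j)" using X optimal_fair(2) by blast
  have "0 < x i" using optimal_fair(1) i by blast
  then have "total_rate N X i \<noteq> 0" using fair_total_rate[where x = x, OF n fair i] by simp
  then obtain j where j: "j \<in> route N i" "X i j \<noteq> 0"
    unfolding total_rate_def by (meson sum.neutral)
  then have "0 < X i j" using optimal_nonneg[OF X i j(1)] by simp
  moreover have "j \<in> resources N" using j route_network(1)[OF net i] by blast
  ultimately have "j \<in> reachable_resources N U n i"
    using X i j unfolding reachable_resources_def by blast
  moreover have "reachable_users N U n i = reachable_users N U n k \<and>
      reachable_resources N U n i = reachable_resources N U n k"
    if k: "k \<in> reachable_users N U n i" for k
  proof -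
    obtain Y where Y: "optimal N U n Y" "(i, k) \<in> (shares N Y)\<^sup>*"
      using k unfolding reachable_users_def by blast
    have "(k, i) \<in> (shares N Y)\<^sup>*" using Y(2) sym_rtrancl[OF sym_shares] by (meson symD)
    then show ?thesis using reachable_subset Y by blast
  qed
  ultimately show "cluster N U n (reachable_users N U n i) (reachable_resources N U n i)"
    using self unfolding cluster_def
    by (auto simp: reachable_users_def reachable_resources_def)
qed

lemma cluster_with_rate_reachable:
  assumes "i \<in> users N"
  shows "(reachable_users N U n i, reachable_resources N U n i) \<in> clusters_with_rate N U n (x i)"
  unfolding clusters_with_rate_def mem_Collect_eq case_prod_conv
  by (rule conjI[OF cluster_reachable(1,3)[OF assms]])

lemma cluster_rates_eq: "cluster_rates N U n = x ` users N"
proof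
  show "cluster_rates N U n \<subseteq> x ` users N"
    unfolding cluster_rates_def clusters_with_rate_def cluster_def by auto
  show "x ` users N \<subseteq> cluster_rates N U n"
    unfolding cluster_rates_def clusters_with_rate_def using cluster_reachable by blast
qed

lemma level_users:
  "(\<Union>(I', J')\<in>clusters_with_rate N U n y. I') = {i\<in>users N. x i = y}"
proof
  show "(\<Union>(I', J')\<in>clusters_with_rate N U n y. I') \<subseteq> {i\<in>users N. x i = y}"
    unfolding clusters_with_rate_def cluster_def by auto
  show "{i\<in>users N. x i = y} \<subseteq> (\<Union>(I', J')\<in>clusters_with_rate N U n y. I')"
  proof
    fix i assume "i \<in> {i\<in>users N. x i = y}"
    then have "i \<in> users N" and "(reachable_users N U n i, reachable_resources N U n i) \<in> clusters_with_rate N U n y"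
      using cluster_with_rate_reachable by auto
    then show "i \<in> (\<Union>(I', J')\<in>clusters_with_rate N U n y. I')"
      using cluster_reachable(2) by (intro UN_I) auto
  qed
qed

lemma level_resources:
  "(\<Union>(I', J')\<in>clusters_with_rate N U n y. J') =
    {j. \<exists>X. optimal N U n X \<and> (\<exists>i\<in>users N. x i = y \<and> j \<in> route N i \<and> 0 < X i j)}"
proof (intro equalityI subsetI)
  fix j assume "j \<in> (\<Union>(I', J')\<in>clusters_with_rate N U n y. J')"
  then obtain I' J' where cl: "cluster N U n I' J'" "\<forall>i\<in>I'. x i = y" "j \<in> J'"
    unfolding clusters_with_rate_def by auto
  then obtain i where i: "i \<in> I'" unfolding cluster_def by blast
  have "j \<in> reachable_resources N U n i" using cl(1,3) i unfolding cluster_def by blast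
  then obtain X k where "optimal N U n X" "(i, k) \<in> (shares N X)\<^sup>*" "k \<in> users N" "j \<in> route N k" "0 < X k j"
    unfolding reachable_resources_def by blast
  moreover from this have "x k = y" using shares_same_rate cl(2) i by metis
  ultimately show "j \<in> {j. \<exists>X. optimal N U n X \<and> (\<exists>i\<in>users N. x i = y \<and> j \<in> route N i \<and> 0 < X i j)}"
    by blast
next
  fix j assume "j \<in> {j. \<exists>X. optimal N U n X \<and> (\<exists>i\<in>users N. x i = y \<and> j \<in> route N i \<and> 0 < X i j)}"
  then obtain X i where X: "optimal N U n X" and i: "i \<in> users N" "x i = y" "j \<in> route N i" "0 < X i j"
    by blast
  have "j \<in> resources N" using i route_network(1)[OF net] by blast
  then have "j \<in> reachable_resources N U n i"
    using X i unfolding reachable_resources_def by blast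
  moreover have "(reachable_users N U n i, reachable_resources N U n i) \<in> clusters_with_rate N U n y"
    using cluster_with_rate_reachable[OF i(1)] i(2) by simp
  ultimately show "j \<in> (\<Union>(I', J')\<in>clusters_with_rate N U n y. J')" by (intro UN_I) auto
qed

end

section \<open>Equilibria as fair flows with rate dependent demands\<close>

context peak_rates
begin

lemma population_demand:
  assumes i: "i \<in> {1..m}" and y: "0 < y"
  shows "c * min y (r i) = \<rho> i \<longleftrightarrow> c = \<rho> i / min y (r i)"
    and "\<rho> i / min y (r i) * y = demand y i"
proof -
  have "0 < min y (r i)" using y r_pos[OF i] by simp
  then show "c * min y (r i) = \<rho> i \<longleftrightarrow> c = \<rho> i / min y (r i)" by (auto simp: field_simps)
  show "\<rho> i / min y (r i) * y = demand y i"
    using demand_slow[OF i, of y] demand_fast[OF i, of y] y by (auto simp: min_def)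
qed

lemma equilibriumD:
  assumes net: "is_network N" and labels: "users N = {1..m}" and U: "is_utility U"
    and eq: "equilibrium N U \<rho> r n"
  shows "n \<in> extensional (users N)" and "optimal_allocations N U n m"
    and "\<And>i. i \<in> users N \<Longrightarrow> n i = \<rho> i / min (opt_rate N U n i) (r i)"
    and "\<And>X. optimal N U n X \<Longrightarrow>
      fair_flow N (\<lambda>i. demand (opt_rate N U n i) i) (opt_rate N U n) (\<lambda>i j. n i * X i j)"
proof -
  have ext: "n \<in> users N \<rightarrow>\<^sub>E {0<..}"
    and bal: "\<forall>i\<in>users N. n i * min (opt_rate N U n i) (r i) = \<rho> i"
    using eq unfolding equilibrium_def by blast+
  show "n \<in> extensional (users N)" using ext by (simp add: PiE_def)
  have n: "\<forall>i\<in>users N. 0 < n i" using ext by (auto simp: PiE_def Pi_def)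
  show "optimal_allocations N U n m" using net labels U n by unfold_locales
  note opt = optimal_fair[OF net labels U n]
  show n_eq: "n i = \<rho> i / min (opt_rate N U n i) (r i)" if i: "i \<in> users N" for i
    using bal population_demand(1)[of i "opt_rate N U n i" "n i"] opt(1) i labels by blast
  show "fair_flow N (\<lambda>i. demand (opt_rate N U n i) i) (opt_rate N U n) (\<lambda>i j. n i * X i j)"
    if X: "optimal N U n X" for X
  proof (rule fair_flow_cong)
    show "fair_flow N (\<lambda>i. n i * opt_rate N U n i) (opt_rate N U n) (\<lambda>i j. n i * X i j)"
      using X opt(2) by blast
    fix i assume i: "i \<in> users N"
    then have "\<rho> i / min (opt_rate N U n i) (r i) * opt_rate N U n i = demand (opt_rate N U n i) i"
      using opt(1) labels by (intro population_demand(2)) auto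
    then show "n i * opt_rate N U n i = demand (opt_rate N U n i) i"
      unfolding n_eq[OF i] .
  qed simp_all
qed

lemma ex_equilibrium:
  assumes adm: "admissible N" and labels: "users N = {1..m}" and U: "is_utility U"
  shows "\<exists>n. equilibrium N U \<rho> r n"
proof -
  note net = admissible_network[OF adm]
  from ex_fair_flow[OF adm] obtain x Z where xZ: "fair_flow N (\<lambda>i. demand (x i) i) x Z \<and>
    (\<forall>y. (\<forall>J'\<subseteq>resources N. J' \<noteq> {} \<longrightarrow> 0 < slack N (demand y) J') \<longrightarrow> (\<forall>i\<in>users N. y < x i))"
    by (elim exE)
  \<comment> \<open>At rate 0 the slack is that of the intensities, so stability yields positive
    rates.\<close>
  have "demand 0 = \<rho>" by (auto simp: demand_def)
  then have x0: "\<forall>i\<in>users N. 0 < x i"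
    using spec[OF conjunct2[OF xZ], of 0] adm unfolding admissible_def stable_load_def by simp
  define n where "n = (\<lambda>i\<in>users N. \<rho> i / min (x i) (r i))"
  have n_eq: "n i = \<rho> i / min (x i) (r i)" if "i \<in> users N" for i using that by (simp add: n_def)
  have n: "\<forall>i\<in>users N. 0 < n i"
    using n_eq labels \<rho>_pos r_pos x0 by simp
  define X where "X i j = Z i j / n i" for i j
  have fair: "fair_flow N (\<lambda>i. n i * x i) x (\<lambda>i j. n i * X i j)"
  proof (rule fair_flow_cong[OF conjunct1[OF xZ]])
    fix i assume i: "i \<in> users N"
    then have "\<rho> i / min (x i) (r i) * x i = demand (x i) i"
      using x0 labels by (intro population_demand(2)) auto
    then show "demand (x i) i = n i * x i" unfolding n_eq[OF i] by simp
    show "Z i j = n i * X i j" for j using n i by (auto simp: X_def)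
  qed simp
  have "n i * min (opt_rate N U n i) (r i) = \<rho> i" if i: "i \<in> users N" for i
  proof -
    have "opt_rate N U n i = x i" by (rule opt_rate_fair[where x = x, OF net U n x0 fair i])
    then show ?thesis
      using population_demand(1)[of i "x i" "n i"] n_eq[OF i] x0 i labels by simp
  qed
  then have "equilibrium N U \<rho> r n"
    using n unfolding equilibrium_def by (auto simp: n_def)
  then show ?thesis by blast
qed

end

subsection \<open>The levels of the algorithm\<close>

locale peak_network = peak_rates \<rho> r m for \<rho> r :: "nat \<Rightarrow> real" and m :: nat +
  fixes N :: "'j network"
  assumes adm: "admissible N" and gen: "generic_load N \<rho>"
    and labels: "users N = {1..m}" and m_pos: "1 \<le> m"
begin

abbreviation M :: "nat \<Rightarrow> 'j network" where "M \<equiv> alg_network \<rho> r N"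

lemma card_users: "card (users N) = m"
  by (simp add: labels)

lemma M_0 [simp]: "M 0 = N"
  by (simp add: alg_network_def)

lemma M_Suc: "M (Suc k) = without (M k) (critical (M k))"
  by (simp add: alg_network_def card_users reduced_network_eq)

lemma alg_users_eq: "alg_users \<rho> r N (Suc k) = users_within (M k) (critical (M k))"
  by (simp add: alg_users_def card_users min_users_def)

lemma alg_resources_eq: "alg_resources \<rho> r N (Suc k) = critical (M k)"
  by (simp add: alg_resources_def card_users)

lemma alg_rate_eq: "alg_rate \<rho> r N (Suc k) = min_ratio \<rho> r m (M k)"
  by (simp add: alg_rate_def card_users)

lemma users_Suc: "users (M (Suc k)) = users (M k) - alg_users \<rho> r N (Suc k)"
  by (simp add: M_Suc alg_users_eq)

lemma resources_Suc: "resources (M (Suc k)) = resources (M k) - critical (M k)"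
  by (simp add: M_Suc)

lemma users_subset: "users (M k) \<subseteq> users N"
  by (induction k) (auto simp: users_Suc)

lemma resources_subset: "resources (M k) \<subseteq> resources N"
  by (induction k) (auto simp: resources_Suc)

lemma route_M: "i \<in> users N \<Longrightarrow> route (M k) i = route N i \<inter> resources (M k)"
proof (induction k)
  case 0
  then show ?case using route_network(1)[OF admissible_network[OF adm], of i] by auto
qed (auto simp: M_Suc)

lemma admissible_M: "admissible (M k)" and generic_M: "generic_load (M k) \<rho>"
proof (induction k)
  case 0
  show "admissible (M 0)" "generic_load (M 0) \<rho>" using adm gen by simp_all
next
  case (Suc k)
  note net = admissible_network[OF Suc.IH(1)]
  show "generic_load (M (Suc k)) \<rho>" using generic_load_without[OF net Suc.IH(2)] by (simp add: M_Suc)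
  show "admissible (M (Suc k))"
  proof (cases "users (M k) = {}")
    case True
    have "slack (M (Suc k)) \<rho> J' = slack (M k) \<rho> J'" for J'
      using True by (simp add: slack_def capacity_def users_within_def M_Suc)
    then show ?thesis
      using Suc.IH(1) without_network[OF net, of "critical (M k)"] True
      unfolding admissible_def stable_load_def M_Suc by auto
  next
    case False
    then show ?thesis using admissible_without_critical[OF Suc.IH(1)] by (simp add: M_Suc)
  qed
qed

lemmas net_M = admissible_network[OF admissible_M]

lemma finite_resources_M: "finite (resources (M k))"
  using net_M by (rule finite_network(2))

lemma users_empty: "resources (M k) = {} \<Longrightarrow> users (M k) = {}"
  using resources_nonempty[OF net_M] by blast

lemma route_meets_users:
  assumes "i \<in> users N" "j \<in> route N i" "j \<in> resources (M k)"
  shows "i \<in> users (M k)"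
  using assms(3)
proof (induction k)
  case 0
  then show ?case using assms by simp
next
  case (Suc k)
  then have j: "j \<in> resources (M k)" "j \<notin> critical (M k)" by (auto simp: resources_Suc)
  then have "j \<in> route (M k) i" using assms route_M by blast
  then show ?case using Suc.IH j by (auto simp: users_Suc alg_users_eq users_within_def)
qed

text \<open>Termination: while resources remain, the critical set is nonempty.\<close>

lemma card_resources_M: "resources (M k) = {} \<or> card (resources (M k)) + k \<le> card (resources N)"
proof (induction k)
  case (Suc k)
  show ?case
  proof (cases "resources (M k) = {}")
    case False
    have "critical (M k) \<noteq> {}" "critical (M k) \<subseteq> resources (M k)"
      using critical_nonempty[OF net_M False m_pos] critical_subset .
    then have "card (resources (M (Suc k))) < card (resources (M k))"
      unfolding resources_Suc using finite_resources_M by (intro psubset_card_mono) auto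
    then show ?thesis using Suc.IH False by linarith
  qed (simp add: resources_Suc)
qed simp

lemma ex_empty: "\<exists>k. resources (M k) = {}"
  using card_resources_M[of "Suc (card (resources N))"] by auto

definition steps :: nat where "steps = (LEAST k. resources (M k) = {})"

lemma resources_steps: "resources (M steps) = {}"
  unfolding steps_def using ex_empty by (rule LeastI_ex)

lemma resources_before: "k < steps \<Longrightarrow> resources (M k) \<noteq> {}"
  unfolding steps_def by (rule not_less_Least)

lemma alg_stops_steps: "alg_stops \<rho> r N steps"
  unfolding alg_stops_def using resources_steps resources_before users_empty by blast

lemma users_removed: "users N - users (M k) = (\<Union>l\<in>{1..k}. alg_users \<rho> r N l)"
proof (induction k)
  case (Suc k)
  have "alg_users \<rho> r N (Suc k) \<subseteq> users N"
    using users_subset[of k] unfolding alg_users_eq users_within_def by blast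
  then have "users N - users (M (Suc k)) = (users N - users (M k)) \<union> alg_users \<rho> r N (Suc k)"
    unfolding users_Suc by blast
  also have "\<dots> = (\<Union>l\<in>{1..Suc k}. alg_users \<rho> r N l)"
    unfolding Suc.IH by (simp add: atLeastAtMostSuc_conv Un_commute)
  finally show ?case .
qed simp

lemma users_levels: "users N = (\<Union>l\<in>{1..steps}. alg_users \<rho> r N l)"
  using users_removed[of steps] users_empty[OF resources_steps] by simp

lemma is_threshold_iff:
  "is_threshold \<rho> r N k s \<longleftrightarrow> s \<in> {1..m} \<and> ereal (r s) < alg_rate \<rho> r N k \<and>
     (s = m \<or> alg_rate \<rho> r N k \<le> ereal (r (Suc s)))"
  by (auto simp: is_threshold_def ext_peak_def card_users)

lemma threshold_unique:
  assumes "is_threshold \<rho> r N k s" "is_threshold \<rho> r N k t"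
  shows "s = t"
proof -
  have "\<not> s < t" if "is_threshold \<rho> r N k s" "is_threshold \<rho> r N k t" for s t
  proof
    assume "s < t"
    then have "alg_rate \<rho> r N k \<le> ereal (r (Suc s))" "r (Suc s) \<le> r t"
      using that unfolding is_threshold_iff by (auto intro!: r_mono)
    then have "alg_rate \<rho> r N k \<le> ereal (r t)" by (meson ereal_less_eq(3) order_trans)
    then show False using that unfolding is_threshold_iff by auto
  qed
  then show ?thesis using assms by (meson linorder_neqE_nat)
qed

text \<open>Stability puts a user beyond its peak rate into every level with users left; this gives
  progress and a threshold of at least 1.\<close>

lemma ex_user_critical:
  assumes "users (M k) \<noteq> {}"
  shows "\<exists>i\<in>alg_users \<rho> r N (Suc k). r i < rate (M k)"
  unfolding alg_users_eq
proof (rule ex_peak_less[OF admissible_M critical_subset])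
  show "critical (M k) \<noteq> {}"
    by (rule critical_nonempty[OF net_M resources_nonempty[OF net_M assms] m_pos])
  show "slack (M k) (demand (rate (M k))) (critical (M k)) \<le> 0"
    using critical_tight[OF admissible_M assms] by simp
qed

lemma alg_users_empty_iff: "alg_users \<rho> r N (Suc k) = {} \<longleftrightarrow> users (M k) = {}"
  using ex_user_critical[of k] by (auto simp: alg_users_eq users_within_def)

lemma ratio_no_users:
  assumes "users (M k) = {}" "A \<in> strongly_connected_sets (M k)"
  shows "level_ratio \<rho> r (M k) s A = \<infinity>"
proof (rule level_ratio_eq_infinity[OF admissible_M])
  show "A \<subseteq> resources (M k)" "A \<noteq> {}" using assms(2) strongly_connectedD by blast+
  have "{i\<in>users_within (M k) A. i \<le> s} = {}" using assms(1) unfolding users_within_def by blast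
  then show "(\<Sum>i\<in>{i\<in>users_within (M k) A. i \<le> s}. \<rho> i / r i) = 0" by (simp only: sum.empty)
qed

lemma min_ratio_no_users:
  assumes "users (M k) = {}" "resources (M k) \<noteq> {}"
  shows "min_ratio \<rho> r m (M k) = \<infinity>"
  using min_ratio_attained[OF net_M assms(2) m_pos] ratio_no_users[OF assms(1)] by metis

lemma critical_no_users:
  assumes "users (M k) = {}" "resources (M k) \<noteq> {}"
  shows "critical (M k) = resources (M k)"
proof
  have "J' \<subseteq> critical (M k)" if "J' \<subseteq> resources (M k)" "J' \<noteq> {}" for J'
    using net_M that
  proof (induction J' rule: strongly_connected_induct)
    case (strongly_connected A)
    have "level_ratio \<rho> r (M k) m A = min_ratio \<rho> r m (M k)"
      using ratio_no_users[OF assms(1) strongly_connected] min_ratio_no_users[OF assms] by simp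
    moreover have "m \<in> {1..m}" using m_pos by simp
    ultimately show ?case using strongly_connected unfolding min_resources_def by blast
  qed blast
  then show "resources (M k) \<subseteq> critical (M k)" using assms(2) by blast
qed (rule critical_subset)

lemma threshold_rate:
  assumes "users (M k) \<noteq> {}"
  obtains s where "is_threshold \<rho> r N (Suc k) s" "\<forall>i\<in>{1..m}. i \<le> s \<longleftrightarrow> r i < rate (M k)"
proof -
  obtain i where i: "i \<in> alg_users \<rho> r N (Suc k)" "r i < rate (M k)"
    using ex_user_critical[OF assms] by blast
  then have "i \<in> {1..m}" using users_subset[of k] labels unfolding alg_users_eq users_within_def by blast
  then obtain s where s: "s \<in> {1..m}" "\<forall>i\<in>{1..m}. i \<le> s \<longleftrightarrow> r i < rate (M k)"
    using ex_threshold i(2) by metis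
  have "alg_rate \<rho> r N (Suc k) = ereal (rate (M k))"
    unfolding alg_rate_eq by (rule min_ratio_eq[OF admissible_M assms])
  moreover have "r s < rate (M k)" using s by blast
  moreover have "rate (M k) \<le> r (Suc s)" if "s \<noteq> m"
    using s that by (metis Suc_leI atLeastAtMost_iff le_SucI le_neq_implies_less not_less not_less_eq_eq order.refl)
  ultimately have "is_threshold \<rho> r N (Suc k) s" unfolding is_threshold_iff using s(1) by auto
  then show thesis using that s(2) by blast
qed

lemma ex1_threshold:
  assumes "k \<in> {1..steps}"
  shows "\<exists>!s. is_threshold \<rho> r N k s"
proof -
  obtain l where l: "k = Suc l" "l < steps" using assms by (cases k) auto
  have "\<exists>s. is_threshold \<rho> r N k s"
  proof (cases "users (M l) = {}")
    case True
    then have "alg_rate \<rho> r N k = \<infinity>"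
      unfolding l(1) alg_rate_eq using min_ratio_no_users resources_before[OF l(2)] by blast
    then have "is_threshold \<rho> r N k m" unfolding is_threshold_iff using m_pos by simp
    then show ?thesis by blast
  next
    case False
    show ?thesis unfolding l(1) by (rule threshold_rate[OF False]) blast
  qed
  then show ?thesis using threshold_unique by blast
qed

lemma le_alg_threshold_iff:
  assumes "users (M k) \<noteq> {}" "i \<in> users N"
  shows "i \<le> alg_threshold \<rho> r N (Suc k) \<longleftrightarrow> r i < rate (M k)"
proof -
  obtain s where s: "is_threshold \<rho> r N (Suc k) s" "\<forall>i\<in>{1..m}. i \<le> s \<longleftrightarrow> r i < rate (M k)"
    using threshold_rate[OF assms(1)] .
  have "alg_threshold \<rho> r N (Suc k) = s"
    unfolding alg_threshold_def using s(1) threshold_unique by blast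
  then show ?thesis using s(2) assms(2) labels by blast
qed

end

text \<open>An arbitrary fair flow whose demands are those of its own rates. It restricts to such a
  flow on each reduced network, so every step of the algorithm determines the rates of its
  users.\<close>

locale peak_network_flow = peak_network \<rho> r m N for \<rho> r :: "nat \<Rightarrow> real" and m :: nat and N :: "'j network" +
  fixes x :: "nat \<Rightarrow> real" and Z :: "nat \<Rightarrow> 'j \<Rightarrow> real"
  assumes fair: "fair_flow N (\<lambda>i. demand (x i) i) x Z"
begin

lemma fair_M: "fair_flow (M k) (\<lambda>i. demand (x i) i) x Z"
proof (induction k)
  case (Suc k)
  show ?case
    unfolding M_Suc
  proof (rule fair_flow_without[OF net_M Suc.IH])
    fix i j assume "i \<in> users (M k) - users_within (M k) (critical (M k))" "j \<in> route (M k) i \<inter> critical (M k)"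
    then show "Z i j = 0" by (intro fair_critical(3)[OF admissible_M generic_M _ Suc.IH]) auto
  qed
qed (simp add: fair)

lemmas fair_critical_M = fair_critical[OF admissible_M generic_M _ fair_M]

lemma rate_level:
  assumes "i \<in> alg_users \<rho> r N (Suc k)"
  shows "users (M k) \<noteq> {}" "x i = rate (M k)"
proof -
  show ne: "users (M k) \<noteq> {}" using assms by (auto simp: alg_users_eq users_within_def)
  show "x i = rate (M k)" using fair_critical_M(1)[OF ne] assms by (simp add: alg_users_eq)
qed

lemma rate_later:
  assumes "i \<in> users (M (Suc k))"
  shows "rate (M k) < x i"
proof -
  have "i \<in> users (M k) - users_within (M k) (critical (M k))"
    using assms by (simp add: users_Suc alg_users_eq)
  then show ?thesis by (intro fair_critical_M(2)) auto
qed

lemma rates_increase: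
  assumes "i \<in> users N - users (M k)" "l \<in> users (M k)"
  shows "x i < x l"
  using assms
proof (induction k)
  case (Suc k)
  have l: "l \<in> users (M k)" using Suc.prems by (simp add: users_Suc)
  show ?case
  proof (cases "i \<in> users (M k)")
    case True
    then have "i \<in> alg_users \<rho> r N (Suc k)" using Suc.prems by (simp add: users_Suc)
    then show ?thesis using rate_level(2) rate_later[OF Suc.prems(2)] by simp
  qed (use Suc l in simp)
qed simp

lemma level_eq:
  assumes "users (M k) \<noteq> {}"
  shows "alg_users \<rho> r N (Suc k) = {i\<in>users N. x i = rate (M k)}"
proof
  show "alg_users \<rho> r N (Suc k) \<subseteq> {i\<in>users N. x i = rate (M k)}"
    using rate_level(2) users_subset[of k] by (auto simp: alg_users_eq users_within_def)
  obtain a where a: "a \<in> alg_users \<rho> r N (Suc k)" using ex_user_critical[OF assms] by blast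
  then have a': "a \<in> users (M k)" "x a = rate (M k)"
    using rate_level(2) by (auto simp: alg_users_eq users_within_def)
  show "{i\<in>users N. x i = rate (M k)} \<subseteq> alg_users \<rho> r N (Suc k)"
  proof
    fix i assume i: "i \<in> {i\<in>users N. x i = rate (M k)}"
    have "i \<in> users (M k)" using rates_increase[of i k a] a' i by force
    moreover have "i \<notin> users (M (Suc k))" using rate_later[of i k] i by force
    ultimately show "i \<in> alg_users \<rho> r N (Suc k)" by (simp add: users_Suc)
  qed
qed

lemma level_rates:
  assumes "users (M k) \<noteq> {}"
  shows "x ` alg_users \<rho> r N (Suc k) = {rate (M k)}"
proof -
  have "x ` alg_users \<rho> r N (Suc k) = (\<lambda>_. rate (M k)) ` alg_users \<rho> r N (Suc k)"
    using rate_level(2) by (rule image_cong[OF refl])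
  then show ?thesis using assms alg_users_empty_iff by (simp add: image_constant_conv)
qed

text \<open>Each step contributes exactly one rate, and a new one because a level contains all users
  with its rate.\<close>

lemma card_rates_removed:
  "users (M k) \<noteq> {} \<Longrightarrow> card (x ` (users N - users (M (Suc k)))) = Suc k"
proof (induction k)
  case 0
  then have "x ` alg_users \<rho> r N (Suc 0) = {rate N}" using level_rates[of 0] by simp
  then show ?case by (simp add: users_removed)
next
  case (Suc k)
  have eq: "users N - users (M (Suc (Suc k))) = (users N - users (M (Suc k))) \<union> alg_users \<rho> r N (Suc (Suc k))"
    using users_subset[of "Suc k"] by (auto simp: users_Suc[of "Suc k"] alg_users_eq users_within_def)
  from level_rates[OF Suc.prems] have "x ` (users N - users (M (Suc (Suc k)))) =
      insert (rate (M (Suc k))) (x ` (users N - users (M (Suc k))))"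
    unfolding eq image_Un by blast
  moreover have "rate (M (Suc k)) \<notin> x ` (users N - users (M (Suc k)))"
  proof
    assume "rate (M (Suc k)) \<in> x ` (users N - users (M (Suc k)))"
    then obtain i where i: "i \<in> users N - users (M (Suc k))" "x i = rate (M (Suc k))" by force
    then have "i \<in> alg_users \<rho> r N (Suc (Suc k))" using level_eq[OF Suc.prems] by blast
    then show False using i(1) by (simp add: alg_users_eq users_within_def)
  qed
  moreover have "users (M k) \<noteq> {}" using Suc.prems by (auto simp: users_Suc)
  moreover have "finite (users N)" using labels by simp
  ultimately show ?case using Suc.IH by simp
qed

text \<open>\<open>M k\<close> is treated in step \<open>Suc k\<close>; the lower rates are those of
  the \<open>k\<close> steps before, in accordance with the \<open>+ 1\<close> in
  \<open>is_cluster_level\<close>.\<close>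

lemma card_lower_rates:
  assumes "users (M k) \<noteq> {}"
  shows "card {y \<in> x ` users N. y < rate (M k)} = k"
proof -
  obtain a where a: "a \<in> users (M k)" "x a = rate (M k)"
    using ex_user_critical[OF assms] rate_level(2) by (force simp: alg_users_eq users_within_def)
  have "x i < rate (M k) \<longleftrightarrow> i \<notin> users (M k)" if i: "i \<in> users N" for i
  proof
    assume "i \<notin> users (M k)"
    then show "x i < rate (M k)" using rates_increase[of i k a] i a by simp
  next
    assume "x i < rate (M k)"
    then show "i \<notin> users (M k)"
      using rate_level(2)[of i k] rate_later[of i k] by (force simp: users_Suc)
  qed
  then have "{y \<in> x ` users N. y < rate (M k)} = x ` (users N - users (M k))" by blast
  moreover have "card (x ` (users N - users (M k))) = k"
  proof (cases k)
    case (Suc l)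
    then have "users (M l) \<noteq> {}" using assms by (auto simp: users_Suc)
    then show ?thesis using card_rates_removed Suc by simp
  qed simp
  ultimately show ?thesis by simp
qed

text \<open>A remaining user may have lost part of its route, but the lost resources serve only
  users of earlier levels.\<close>

lemma no_flow_on_removed:
  assumes "i \<in> users (M k)" "j \<in> route N i" "j \<notin> resources (M k)"
  shows "Z i j = 0"
  using assms
proof (induction k)
  case 0
  then show ?case using route_network(1)[OF admissible_network[OF adm], of i] by auto
next
  case (Suc k)
  then have i: "i \<in> users (M k) - users_within (M k) (critical (M k))"
    by (simp add: users_Suc alg_users_eq)
  show ?case
  proof (cases "j \<in> resources (M k)")
    case True
    then have "j \<in> route (M k) i \<inter> critical (M k)"
      using Suc.prems i route_M[of i k] users_subset[of k] by (auto simp: resources_Suc)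
    then show ?thesis using i by (intro fair_critical_M(3)) auto
  qed (use Suc i in simp)
qed

lemma flow_in_critical:
  assumes i: "i \<in> alg_users \<rho> r N (Suc k)" and j: "j \<in> route N i" "0 < Z i j"
  shows "j \<in> critical (M k)"
proof -
  have iu: "i \<in> users (M k)" "route (M k) i \<subseteq> critical (M k)"
    using i by (auto simp: alg_users_eq users_within_def)
  then have "j \<in> resources (M k)" using no_flow_on_removed[of i k j] j by force
  then show ?thesis using iu j(1) route_M[of i k] users_subset[of k] by blast
qed

lemma critical_has_flow:
  assumes "users (M k) \<noteq> {}" "j \<in> critical (M k)"
  shows "\<exists>i\<in>alg_users \<rho> r N (Suc k). j \<in> route N i \<and> 0 < Z i j"
proof -
  obtain i where i: "i \<in> users_within (M k) (critical (M k))" "j \<in> route (M k) i" "0 < Z i j"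
    using fair_critical_M(4)[OF assms] by blast
  then have "j \<in> route N i" using route_M[of i k] users_subset[of k] unfolding users_within_def by blast
  then show ?thesis using i unfolding alg_users_eq by blast
qed

lemma unused_level:
  assumes k: "k < steps" and empty: "users (M k) = {}"
  shows "critical (M k) = {j\<in>resources N. \<forall>i\<in>users N. j \<notin> route N i}"
  unfolding critical_no_users[OF empty resources_before[OF k]]
proof (intro equalityI subsetI)
  fix j assume "j \<in> resources (M k)"
  then show "j \<in> {j\<in>resources N. \<forall>i\<in>users N. j \<notin> route N i}"
    using empty route_meets_users[of _ j k] resources_subset[of k] by blast
next
  fix j assume j: "j \<in> {j\<in>resources N. \<forall>i\<in>users N. j \<notin> route N i}"
  have "j \<in> resources (M l)" if "l \<le> k" for l
    using that
  proof (induction l)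
    case (Suc l)
    \<comment> \<open>A step without users would remove all resources and be the last. With users
      present, critical resources carry flow, which \<open>j\<close> cannot.\<close>
    have "users (M l) \<noteq> {}"
    proof
      assume none: "users (M l) = {}"
      have "resources (M l) \<noteq> {}" using Suc.prems k by (intro resources_before) simp
      then have "resources (M (Suc l)) = {}"
        using critical_no_users[OF none] by (simp add: resources_Suc)
      then show False using resources_before[of "Suc l"] Suc.prems k by simp
    qed
    then have "j \<notin> critical (M l)"
      using critical_has_flow[of l j] j users_subset[of l] by (auto simp: alg_users_eq users_within_def)
    then show ?case using Suc by (simp add: resources_Suc)
  qed (use j in simp)
  then show "j \<in> resources (M k)" by blast
qed

end

context peak_network
begin

text \<open>Both flows have the rates computed by the algorithm, and these do not refer to a
  flow.\<close>

lemma fair_rates_unique: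
  assumes "fair_flow N (\<lambda>i. demand (x i) i) x Z" "fair_flow N (\<lambda>i. demand (y i) i) y W" "i \<in> users N"
  shows "x i = y i"
proof -
  interpret X: peak_network_flow \<rho> r m N x Z by unfold_locales (rule assms)
  interpret Y: peak_network_flow \<rho> r m N y W by unfold_locales (rule assms)
  obtain k where k: "k \<in> {1..steps}" "i \<in> alg_users \<rho> r N k" using assms(3) users_levels by blast
  then obtain l where "i \<in> alg_users \<rho> r N (Suc l)" by (cases k) auto
  then show ?thesis using X.rate_level(2) Y.rate_level(2) by simp
qed

lemma equilibrium_unique:
  assumes U: "is_utility U" and eq: "equilibrium N U \<rho> r n" "equilibrium N U \<rho> r n'"
  shows "n = n'"
proof -
  note D = equilibriumD[OF admissible_network[OF adm] labels U]
  interpret O: optimal_allocations N U n m by (rule D(2)[OF eq(1)])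
  interpret O': optimal_allocations N U n' m by (rule D(2)[OF eq(2)])
  obtain X X' where X: "optimal N U n X" "optimal N U n' X'"
    using O.optimal_fair(3) O'.optimal_fair(3) by blast
  have "opt_rate N U n i = opt_rate N U n' i" if "i \<in> users N" for i
    by (rule fair_rates_unique[OF D(4)[OF eq(1) X(1)] D(4)[OF eq(2) X(2)] that])
  then show ?thesis
    using D(3)[OF eq(1)] D(3)[OF eq(2)]
    by (intro extensionalityI[OF D(1)[OF eq(1)] D(1)[OF eq(2)]]) simp
qed

context
  fixes U n
  assumes U: "is_utility U" and eq: "equilibrium N U \<rho> r n"
begin

lemmas eqD = equilibriumD[OF admissible_network[OF adm] labels U eq]

text \<open>Stated for every optimal allocation, because the resources of a cluster level are
  collected over all of them.\<close>

lemma equilibrium_flow: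
  "optimal N U n X \<Longrightarrow> peak_network_flow \<rho> r m N (opt_rate N U n) (\<lambda>i j. n i * X i j)"
  using eqD(4) by unfold_locales

lemma ex_optimal: "\<exists>X. optimal N U n X"
proof -
  interpret O: optimal_allocations N U n m by (rule eqD(2))
  show ?thesis by (rule O.optimal_fair(3))
qed

lemma equilibrium_level:
  assumes i: "i \<in> alg_users \<rho> r N (Suc k)"
  shows "opt_rate N U n i = rate (M k)" "users (M k) \<noteq> {}"
    and "ereal (opt_rate N U n i) = alg_rate \<rho> r N (Suc k)"
    and "n i = (if i \<le> alg_threshold \<rho> r N (Suc k) then \<rho> i / r i
      else \<rho> i / real_of_ereal (alg_rate \<rho> r N (Suc k)))"
proof -
  obtain X where "optimal N U n X" using ex_optimal by blast
  then interpret F: peak_network_flow \<rho> r m N "opt_rate N U n" "\<lambda>i j. n i * X i j"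
    by (rule equilibrium_flow)
  show rate: "opt_rate N U n i = rate (M k)" and ne: "users (M k) \<noteq> {}"
    using F.rate_level[OF i] by auto
  show "ereal (opt_rate N U n i) = alg_rate \<rho> r N (Suc k)"
    unfolding alg_rate_eq rate by (rule min_ratio_eq[OF admissible_M ne, symmetric])
  have iu: "i \<in> users N" using i users_subset[of k] by (auto simp: alg_users_eq users_within_def)
  show "n i = (if i \<le> alg_threshold \<rho> r N (Suc k) then \<rho> i / r i
      else \<rho> i / real_of_ereal (alg_rate \<rho> r N (Suc k)))"
    unfolding alg_rate_eq le_alg_threshold_iff[OF ne iu] eqD(3)[OF iu] rate by (auto simp: min_def)
qed

lemma equilibrium_cluster_level:
  assumes "alg_users \<rho> r N (Suc k) \<noteq> {}"
  shows "is_cluster_level N U n (Suc k) (alg_users \<rho> r N (Suc k)) (alg_resources \<rho> r N (Suc k))"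
proof -
  have ne: "users (M k) \<noteq> {}" using assms alg_users_empty_iff by blast
  interpret O: optimal_allocations N U n m by (rule eqD(2))
  obtain X where X: "optimal N U n X" using ex_optimal by blast
  then interpret F: peak_network_flow \<rho> r m N "opt_rate N U n" "\<lambda>i j. n i * X i j"
    by (rule equilibrium_flow)
  have users: "alg_users \<rho> r N (Suc k) = {i\<in>users N. opt_rate N U n i = rate (M k)}"
    by (rule F.level_eq[OF ne])
  have "critical (M k) =
      {j. \<exists>X. optimal N U n X \<and> (\<exists>i\<in>users N. opt_rate N U n i = rate (M k) \<and> j \<in> route N i \<and> 0 < X i j)}"
  proof (intro equalityI subsetI)
    fix j assume "j \<in> critical (M k)"
    then obtain i where i: "i \<in> alg_users \<rho> r N (Suc k)" "j \<in> route N i" "0 < n i * X i j"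
      using F.critical_has_flow[OF ne] by blast
    then have "i \<in> users N" "opt_rate N U n i = rate (M k)" unfolding users by auto
    moreover have "0 < X i j" using i(3) O.n \<open>i \<in> users N\<close> by (meson zero_less_mult_pos)
    ultimately show "j \<in> {j. \<exists>X. optimal N U n X \<and>
        (\<exists>i\<in>users N. opt_rate N U n i = rate (M k) \<and> j \<in> route N i \<and> 0 < X i j)}"
      using X i(2) by blast
  next
    fix j assume "j \<in> {j. \<exists>X. optimal N U n X \<and>
        (\<exists>i\<in>users N. opt_rate N U n i = rate (M k) \<and> j \<in> route N i \<and> 0 < X i j)}"
    then obtain Y i where Y: "optimal N U n Y" and i: "i \<in> users N" "opt_rate N U n i = rate (M k)"
      "j \<in> route N i" "0 < Y i j" by blast
    \<comment> \<open>\<open>Y\<close> may differ from \<open>X\<close>, but it has the same rates,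
      and in any such flow the users of a level stay on its critical resources.\<close>
    interpret G: peak_network_flow \<rho> r m N "opt_rate N U n" "\<lambda>i j. n i * Y i j"
      by (rule equilibrium_flow[OF Y])
    show "j \<in> critical (M k)"
      using i users O.n by (intro G.flow_in_critical[of i]) auto
  qed
  moreover have "rate (M k) \<in> opt_rate N U n ` users N" using assms users by force
  ultimately show ?thesis
    unfolding is_cluster_level_def O.cluster_rates_eq O.level_users O.level_resources
      alg_resources_eq users
    using F.card_lower_rates[OF ne] by (intro bexI[of _ "rate (M k)"]) auto
qed

lemma equilibrium_unused:
  assumes "k < steps" "alg_users \<rho> r N (Suc k) = {}"
  shows "alg_resources \<rho> r N (Suc k) = {j\<in>resources N. \<forall>i\<in>users N. j \<notin> route N i}"
proof -
  obtain X where "optimal N U n X" using ex_optimal by blast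
  then interpret F: peak_network_flow \<rho> r m N "opt_rate N U n" "\<lambda>i j. n i * X i j"
    by (rule equilibrium_flow)
  show ?thesis
    unfolding alg_resources_eq using F.unused_level[OF assms(1)] assms(2) alg_users_empty_iff by blast
qed

lemma equilibrium_peak_constrained:
  "{i\<in>users N. peak_constrained N U r n i} =
    (\<Union>k\<in>{1..steps}. {i\<in>alg_users \<rho> r N k. i \<le> alg_threshold \<rho> r N k})"
proof -
  have iff: "peak_constrained N U r n i \<longleftrightarrow> i \<le> alg_threshold \<rho> r N k"
    if k: "k \<in> {1..steps}" "i \<in> alg_users \<rho> r N k" for i k
  proof -
    obtain l where l: "k = Suc l" using k(1) by (cases k) auto
    have iu: "i \<in> users N" using k users_levels by blast
    show ?thesis
      using equilibrium_level(1,2)[of i l] k(2) le_alg_threshold_iff[of l i] iu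
      unfolding l peak_constrained_def by simp
  qed
  have "i \<in> {i\<in>users N. peak_constrained N U r n i} \<longleftrightarrow>
      (\<exists>k\<in>{1..steps}. i \<in> alg_users \<rho> r N k \<and> peak_constrained N U r n i)" for i
    by (subst users_levels) blast
  also have "\<dots> i \<longleftrightarrow> i \<in> (\<Union>k\<in>{1..steps}. {i\<in>alg_users \<rho> r N k. i \<le> alg_threshold \<rho> r N k})" for i
    using iff by (simp cong: conj_cong)
  finally show ?thesis by (rule set_eqI)
qed

end

end

theorem theorem5p1:
  fixes N :: "'j network" and U :: "real \<Rightarrow> ereal" and lam mu r \<rho> :: "nat \<Rightarrow> real"
  assumes network: "is_network N"
    and labels: "users N = {1..card (users N)}" "users N \<noteq> {}"
    and pos: "\<forall>i\<in>users N. 0 < lam i \<and> 0 < mu i \<and> 0 < r i"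
    and intensity: "\<forall>i\<in>users N. \<rho> i = lam i / mu i"
    and ordered: "\<forall>i\<in>users N. \<forall>i'\<in>users N. i \<le> i' \<longrightarrow> r i \<le> r i'"
    and utility: "is_utility U"
    and stable: "\<forall>J'\<in>strongly_connected_sets N. (\<Sum>i\<in>users_within N J'. \<rho> i) < capacity N J'"
    and generic: "\<forall>J'\<in>connected_sets N. \<forall>I'. users_within N J' \<subset> I' \<and> I' \<subseteq> users_meeting N J' \<longrightarrow>
                    (\<Sum>i\<in>I'. \<rho> i) \<noteq> capacity N J'"
  shows "(\<exists>!n. equilibrium N U \<rho> r n) \<and>
    (\<exists>K. alg_stops \<rho> r N K \<and>
       (\<forall>k\<in>{1..K}. \<exists>!s. is_threshold \<rho> r N k s) \<and>
       (\<forall>n. equilibrium N U \<rho> r n \<longrightarrow>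
          (\<forall>k\<in>{1..K}.
             (\<forall>i\<in>alg_users \<rho> r N k.
                ereal (opt_rate N U n i) = alg_rate \<rho> r N k \<and>
                n i = (if i \<le> alg_threshold \<rho> r N k then \<rho> i / r i
                       else \<rho> i / real_of_ereal (alg_rate \<rho> r N k))) \<and>
             (if alg_users \<rho> r N k \<noteq> {}
              then is_cluster_level N U n k (alg_users \<rho> r N k) (alg_resources \<rho> r N k)
              else alg_resources \<rho> r N k = {j\<in>resources N. \<forall>i\<in>users N. j \<notin> route N i})) \<and>
          {i\<in>users N. peak_constrained N U r n i} =
            (\<Union>k\<in>{1..K}. {i\<in>alg_users \<rho> r N k. i \<le> alg_threshold \<rho> r N k})))"
proof -
  define m where "m = card (users N)"
  have labels_m: "users N = {1..m}" using labels(1) by (simp add: m_def)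
  have \<rho>_pos: "0 < \<rho> i" if "i \<in> users N" for i using pos intensity that by simp
  have net_stable: "is_network N \<and> users N \<subseteq> {1..m} \<and> stable_load N \<rho>"
    using network labels_m stable stable_if_strongly_connected[OF network, of \<rho>] by (simp add: slack_def)
  interpret peak_rates \<rho> r m
    by unfold_locales (use \<rho>_pos pos ordered labels_m in auto)
  have "1 \<le> m" using labels(2) labels_m by (cases m) auto
  moreover have "generic_load N \<rho>" using generic unfolding generic_load_def .
  ultimately interpret peak_network \<rho> r m N
    by unfold_locales (use net_stable labels_m in \<open>simp_all add: admissible_def\<close>)
  have unique: "\<exists>!n. equilibrium N U \<rho> r n"
    using ex_equilibrium[OF adm labels_m utility] equilibrium_unique[OF utility] by blast
  show ?thesis
  proof (intro conjI exI[of _ steps] ballI allI impI)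
    show "\<exists>!n. equilibrium N U \<rho> r n" by (rule unique)
    show "alg_stops \<rho> r N steps" by (rule alg_stops_steps)
    show "\<exists>!s. is_threshold \<rho> r N k s" if "k \<in> {1..steps}" for k by (rule ex1_threshold[OF that])
  next
    fix n assume eq: "equilibrium N U \<rho> r n"
    show "{i\<in>users N. peak_constrained N U r n i} =
        (\<Union>k\<in>{1..steps}. {i\<in>alg_users \<rho> r N k. i \<le> alg_threshold \<rho> r N k})"
      by (rule equilibrium_peak_constrained[OF utility eq])
    fix k assume "k \<in> {1..steps}"
    then obtain l where l: "k = Suc l" "l < steps" by (cases k) auto
    show "if alg_users \<rho> r N k \<noteq> {}
        then is_cluster_level N U n k (alg_users \<rho> r N k) (alg_resources \<rho> r N k)
        else alg_resources \<rho> r N k = {j\<in>resources N. \<forall>i\<in>users N. j \<notin> route N i}"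
      using equilibrium_cluster_level[OF utility eq] equilibrium_unused[OF utility eq l(2)]
      unfolding l(1) by simp
    fix i assume "i \<in> alg_users \<rho> r N k"
    then show "ereal (opt_rate N U n i) = alg_rate \<rho> r N k"
      and "n i = (if i \<le> alg_threshold \<rho> r N k then \<rho> i / r i
        else \<rho> i / real_of_ereal (alg_rate \<rho> r N k))"
      using equilibrium_level(3,4)[OF utility eq] unfolding l(1) by blast+
  qed
qed

end
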